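(* Let $(\mathcal{C},\mathcal{D})$ be a pseudo-Cartan inclusion with Cartan envelope $(\mathcal{A},\mathcal{B},\alpha)$. Then (a) $\mathcal{C}$ is simple if and only if $\mathcal{A}$ is simple; (b) $\mathcal{C}$ is unital if and only if $\mathcal{A}$ is unital; (c) $\mathcal{C}$ is separable if and only if $\mathcal{A}$ is separable.
   Context: Inclusion: C*-algebra $\mathcal{C}$ with C*-subalgebra $\mathcal{D}$. $\mathcal{N}(\mathcal{C},\mathcal{D})=\{v: v\mathcal{D}v^*\cup v^*\mathcal{D}v\subseteq\mathcal{D}\}$; regular: its span is dense in $\mathcal{C}$. $\mathcal{D}^c$: relative commutant of $\mathcal{D}$ in $\mathcal{C}$. Ideal intersection property: every nonzero closed ideal of the big algebra meets the subalgebra nontrivially. Pseudo-Cartan inclusion: regular inclusion with $\mathcal{D}$ and $\mathcal{D}^c$ abelian and both $(\mathcal{C},\mathcal{D}^c)$, $(\mathcal{D}^c,\mathcal{D})$ having the ideal intersection property. A $*$-homomorphism between inclusions is regular if it maps normalizers to normalizers. Cartan inclusion $(\mathcal{A},\mathcal{B})$: regular, $\mathcal{B}$ maximal abelian, faithful conditional expectation $\Delta:\mathcal{A}\to\mathcal{B}$. Cartan envelope: $(\mathcal{A},\mathcal{B},\alpha)$ with $(\mathcal{A},\mathcal{B})$ Cartan, $\alpha:\mathcal{C}\to\mathcal{A}$ regular $*$-monomorphism, $\alpha(\mathcal{D})\subseteq\mathcal{B}$, $(\mathcal{B},\alpha(\mathcal{D}))$ with the ideal intersection property, $\mathcal{B}=C^*(\Delta(\alpha(\mathcal{C})))$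 and $\mathcal{A}=C^*(\alpha(\mathcal{C})\cup\mathcal{B})$. *)

theory Defs
  imports "HOL-Analysis.Analysis"
begin

class cstar_algebra = real_normed_algebra + banach +
  fixes cscale :: "complex \<Rightarrow> 'a \<Rightarrow> 'a"
    and adj :: "'a \<Rightarrow> 'a"
  assumes cscale_of_real: "cscale (complex_of_real r) x = scaleR r x"
    and cscale_add_right: "cscale a (x + y) = cscale a x + cscale a y"
    and cscale_add_left: "cscale (a + b) x = cscale a x + cscale b x"
    and cscale_cscale: "cscale a (cscale b x) = cscale (a * b) x"
    and cscale_one: "cscale 1 x = x"
    and norm_cscale: "norm (cscale a x) = cmod a * norm x"
    and cscale_mult_left: "cscale a x * y = cscale a (x * y)"
    and cscale_mult_right: "x * cscale a y = cscale a (x * y)"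
    and adj_adj: "adj (adj x) = x"
    and adj_add: "adj (x + y) = adj x + adj y"
    and adj_cscale: "adj (cscale a x) = cscale (cnj a) (adj x)"
    and adj_mult: "adj (x * y) = adj y * adj x"
    and cstar_identity: "norm (adj x * x) = (norm x)\<^sup>2"

definition csubspace :: "'a::cstar_algebra set \<Rightarrow> bool" where
  "csubspace S \<longleftrightarrow> 0 \<in> S \<and> (\<forall>x\<in>S. \<forall>y\<in>S. x + y \<in> S) \<and> (\<forall>a x. x \<in> S \<longrightarrow> cscale a x \<in> S)"

definition cstar_subalgebra :: "'a::cstar_algebra set \<Rightarrow> bool" where
  "cstar_subalgebra S \<longleftrightarrow> csubspace S \<and> closed S \<and>
     (\<forall>x\<in>S. \<forall>y\<in>S. x * y \<in> S) \<and> (\<forall>x\<in>S. adj x \<in> S)"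

definition cstar_gen :: "'a::cstar_algebra set \<Rightarrow> 'a set" where
  "cstar_gen X = \<Inter>{S. cstar_subalgebra S \<and> X \<subseteq> S}"

definition cspan :: "'a::cstar_algebra set \<Rightarrow> 'a set" where
  "cspan X = {(\<Sum>x\<in>F. cscale (c x) x) | F c. finite F \<and> F \<subseteq> X}"

definition closed_ideal_in :: "'a::cstar_algebra set \<Rightarrow> 'a set \<Rightarrow> bool" where
  "closed_ideal_in S I \<longleftrightarrow> I \<subseteq> S \<and> csubspace I \<and> closed I \<and>
     (\<forall>s\<in>S. \<forall>x\<in>I. s * x \<in> I \<and> x * s \<in> I)"

definition ideal_intersection_property :: "'a::cstar_algebra set \<Rightarrow> 'a set \<Rightarrow> bool" where
  "ideal_intersection_property S T \<longleftrightarrow>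
     (\<forall>I. closed_ideal_in S I \<and> I \<noteq> {0} \<longrightarrow> I \<inter> T \<noteq> {0})"

definition abelian :: "'a::cstar_algebra set \<Rightarrow> bool" where
  "abelian S \<longleftrightarrow> (\<forall>x\<in>S. \<forall>y\<in>S. x * y = y * x)"

section \<open>Inclusions (C, D) with C the whole type\<close>

definition normalizers :: "'a::cstar_algebra set \<Rightarrow> 'a set" where
  "normalizers D = {v. \<forall>d\<in>D. v * d * adj v \<in> D \<and> adj v * d * v \<in> D}"

definition regular_inclusion :: "'a::cstar_algebra set \<Rightarrow> bool" where
  "regular_inclusion D \<longleftrightarrow> cstar_subalgebra D \<and> closure (cspan (normalizers D)) = UNIV"

definition relative_commutant :: "'a::cstar_algebra set \<Rightarrow> 'a set" where
  "relative_commutant D = {x. \<forall>d\<in>D. x * d = d * x}"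

definition pseudo_cartan :: "'a::cstar_algebra set \<Rightarrow> bool" where
  "pseudo_cartan D \<longleftrightarrow> regular_inclusion D \<and> abelian D \<and>
     abelian (relative_commutant D) \<and>
     ideal_intersection_property UNIV (relative_commutant D) \<and>
     ideal_intersection_property (relative_commutant D) D"

definition maximal_abelian :: "'a::cstar_algebra set \<Rightarrow> bool" where
  "maximal_abelian B \<longleftrightarrow> cstar_subalgebra B \<and> abelian B \<and>
     (\<forall>S. cstar_subalgebra S \<and> abelian S \<and> B \<subseteq> S \<longrightarrow> S = B)"

definition positive :: "'a::cstar_algebra \<Rightarrow> bool" where
  "positive x \<longleftrightarrow> (\<exists>y. x = adj y * y)"

definition faithful_cond_exp :: "'a::cstar_algebra set \<Rightarrow> ('a \<Rightarrow> 'a) \<Rightarrow> bool" where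
  "faithful_cond_exp B \<Delta> \<longleftrightarrow>
     (\<forall>x y. \<Delta> (x + y) = \<Delta> x + \<Delta> y) \<and> (\<forall>a x. \<Delta> (cscale a x) = cscale a (\<Delta> x)) \<and>
     range \<Delta> = B \<and> (\<forall>b\<in>B. \<Delta> b = b) \<and>
     (\<forall>b\<in>B. \<forall>x. \<forall>b'\<in>B. \<Delta> (b * x * b') = b * \<Delta> x * b') \<and>
     (\<forall>x. positive x \<longrightarrow> positive (\<Delta> x)) \<and>
     (\<forall>x. \<Delta> (adj x * x) = 0 \<longrightarrow> x = 0)"

definition star_hom :: "('c::cstar_algebra \<Rightarrow> 'a::cstar_algebra) \<Rightarrow> bool" where
  "star_hom f \<longleftrightarrow> (\<forall>x y. f (x + y) = f x + f y) \<and> (\<forall>a x. f (cscale a x) = cscale a (f x)) \<and>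
     (\<forall>x y. f (x * y) = f x * f y) \<and> (\<forall>x. f (adj x) = adj (f x))"

text \<open>Cartan envelope (A, B, alpha) of (C, D), with A the whole type 'a,
C the whole type 'c; Delta is the faithful conditional expectation of the
Cartan inclusion (A, B).\<close>
definition cartan_envelope ::
  "'c::cstar_algebra set \<Rightarrow> 'a::cstar_algebra set \<Rightarrow> ('c \<Rightarrow> 'a) \<Rightarrow> bool" where
  "cartan_envelope D B \<alpha> \<longleftrightarrow>
     (\<exists>\<Delta>. regular_inclusion B \<and> maximal_abelian B \<and> faithful_cond_exp B \<Delta> \<and>
        star_hom \<alpha> \<and> inj \<alpha> \<and> \<alpha> ` normalizers D \<subseteq> normalizers B \<and>
        \<alpha> ` D \<subseteq> B \<and> ideal_intersection_property B (\<alpha> ` D) \<and>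
        B = cstar_gen (\<Delta> ` range \<alpha>) \<and>
        UNIV = cstar_gen (range \<alpha> \<union> B))"

definition cstar_simple :: "'a::cstar_algebra itself \<Rightarrow> bool" where
  "cstar_simple _ \<longleftrightarrow> (UNIV :: 'a set) \<noteq> {0} \<and>
     (\<forall>I::'a set. closed_ideal_in UNIV I \<longrightarrow> I = {0} \<or> I = UNIV)"

definition cstar_unital :: "'a::cstar_algebra itself \<Rightarrow> bool" where
  "cstar_unital _ \<longleftrightarrow> (\<exists>e::'a. \<forall>x. e * x = x \<and> x * e = x)"

definition cstar_separable :: "'a::cstar_algebra itself \<Rightarrow> bool" where
  "cstar_separable _ \<longleftrightarrow> (\<exists>S::'a set. countable S \<and> closure S = UNIV)"

end

theory Submission
  imports Defs
begin

text \<open>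
  Separability: \<open>\<alpha>\<close> is isometric and \<open>\<Delta>\<close> is bounded, and \<open>A\<close> is generated by \<open>\<alpha>(C)\<close> and
  \<open>\<Delta>(\<alpha>(C))\<close>.

  Unit: if \<open>C\<close> is unital, then \<open>f = \<Delta>(\<alpha>(1))\<close> acts trivially on \<open>\<alpha>(D)\<close>, hence on \<open>B\<close> by the ideal
  intersection property; the corner \<open>(1 - f) A (1 - f)\<close> commutes with the maximal abelian \<open>B\<close> and
  therefore vanishes. If \<open>A\<close> is unital, then \<open>\<alpha>(v)\<^sup>* \<alpha>(v) \<in> B\<close> for every normalizer \<open>v\<close>, so
  \<open>\<alpha>(C) \<inter> B\<close> contains approximate units for \<open>\<alpha>(C)\<close>, hence for \<open>B \<ni> 1\<close>, and the closed algebra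
  \<open>\<alpha>(C)\<close> contains an element at distance less than \<open>1\<close> from \<open>1\<close>.

  Simplicity: if \<open>A\<close> is simple and \<open>I\<close> is a nonzero ideal of \<open>C\<close>, then the closed left ideal of \<open>A\<close>
  generated by \<open>\<alpha>(I \<inter> D)\<close> is two-sided, because \<open>w = j v\<close> with \<open>j \<in> I \<inter> D\<close> and \<open>v\<close> a normalizer is the
  limit of \<open>w p(w\<^sup>* w)\<close> with \<open>w\<^sup>* w \<in> I \<inter> D\<close>; so it is \<open>A\<close>, and \<open>I = C\<close>. If \<open>C\<close> is simple, a nonzero
  ideal \<open>I\<close> of \<open>A\<close> meets \<open>B\<close>, hence \<open>\<alpha>(D)\<close>, hence contains \<open>\<alpha>(C)\<close>; as approximate units of \<open>D\<close>
  act on \<open>C\<close>, it also contains \<open>\<Delta>(\<alpha>(C))\<close>. That ideals of \<open>A\<close> meet \<open>B\<close> is shown by compressing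
  an element \<open>a\<close> of the ideal with a bump function \<open>e \<in> B\<close> such that \<open>e a e\<close> is close to
  \<open>e \<Delta>(a) e\<close>.
\<close>

section \<open>Elementary facts on C*-algebras\<close>

text \<open>Neither algebra is assumed to be unital, and this shapes most of the proof. Order
  arguments are run in a unitization, units are replaced by contractive approximate units taken from
  abelian subalgebras, and inverses by iterations that stay inside the algebra. Abelian C*-algebras
  enter only through their characters: these detect the norm, and an element defined by a continuous
  function is specified by its values under all characters, so no spectrum or Gelfand space appears.
  Self-adjointness and boundedness of \<open>\<Delta>\<close>, which the definition of a conditional
  expectation does not state, are also read off from characters, once every \<open>adj w * w\<close>
  is known to have nonnegative values. In the simplicity argument only one-sided ideals are easy to
  generate from an abelian subalgebra; regularity makes them two-sided because compression by a
  normalizer preserves the generating algebra.\<close>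

lemma cscale_zero_left [simp]: "cscale 0 x = (0::'a::cstar_algebra)"
  using cscale_of_real[of 0 x] by simp

lemma cscale_zero_right [simp]: "cscale a (0::'a::cstar_algebra) = 0"
  using cscale_add_right[of a 0 0] by simp

lemma cscale_minus_right: "cscale a (- x) = - cscale a (x::'a::cstar_algebra)"
  using cscale_add_right[of a x "-x"] by (simp add: minus_unique)

lemma cscale_diff_right: "cscale a (x - y) = cscale a x - cscale a (y::'a::cstar_algebra)"
  using cscale_add_right[of a x "-y"] by (simp add: cscale_minus_right)

lemma cscale_minus_one: "cscale (-1) x = - (x::'a::cstar_algebra)"
  using cscale_of_real[of "-1" x] by simp

lemma adj_zero [simp]: "adj (0::'a::cstar_algebra) = 0"
  using adj_add[of "0::'a" 0] by simp

lemma adj_minus: "adj (- x) = - adj (x::'a::cstar_algebra)"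
  using adj_add[of x "-x"] by (simp add: minus_unique)

lemma adj_diff: "adj (x - y) = adj x - adj (y::'a::cstar_algebra)"
  using adj_add[of x "-y"] by (simp add: adj_minus)

lemma adj_scaleR: "adj (r *\<^sub>R x) = r *\<^sub>R adj (x::'a::cstar_algebra)"
  using adj_cscale[of "complex_of_real r" x] by (simp add: cscale_of_real)

lemma norm_adj [simp]: "norm (adj x) = norm (x::'a::cstar_algebra)"
proof -
  have le: "norm y \<le> norm (adj y)" for y :: 'a
  proof (cases "y = 0")
    case False
    have "norm y * norm y \<le> norm (adj y) * norm y"
      using norm_mult_ineq[of "adj y" y] by (simp add: cstar_identity power2_eq_square)
    with False show ?thesis by simp
  qed simp
  from le[of x] le[of "adj x"] show ?thesis by (simp add: adj_adj)
qed

lemma cstar_identity': "norm (x * adj x) = (norm (x::'a::cstar_algebra))\<^sup>2"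
  using cstar_identity[of "adj x"] by (simp add: adj_adj)

lemma adj_mult_self_eq_0: "adj x * x = 0 \<longleftrightarrow> x = (0::'a::cstar_algebra)"
  using cstar_identity[of x] by auto

lemma mult_adj_self_eq_0: "x * adj x = 0 \<longleftrightarrow> x = (0::'a::cstar_algebra)"
  using cstar_identity'[of x] by auto

lemma adj_one [simp]: "adj (1::'a::{cstar_algebra,real_normed_algebra_1}) = 1"
  by (metis adj_adj adj_mult mult_1_left mult_1_right)

lemma bounded_linear_adj: "bounded_linear (adj :: 'a::cstar_algebra \<Rightarrow> 'a)"
  by (rule bounded_linear_intro[where K = 1]) (auto simp: adj_add adj_scaleR)

lemma bounded_linear_cscale: "bounded_linear (cscale a :: 'a::cstar_algebra \<Rightarrow> 'a)"
proof (rule bounded_linear_intro[where K = "cmod a"])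
  show "cscale a (r *\<^sub>R x) = r *\<^sub>R cscale a x" for r and x :: 'a
    by (metis cscale_of_real cscale_cscale mult.commute)
qed (auto simp: cscale_add_right norm_cscale)

text \<open>The explicit formulas are part of the conclusion because they show that the parts stay
  in every C*-subalgebra containing \<open>x\<close>; the norm bounds later give the bound on
  \<open>\<Delta>\<close>.\<close>

lemma cscale_ii_parts:
  fixes x :: "'a::cstar_algebra"
  obtains a b where "adj a = a" "adj b = b" "x = a + cscale \<i> b" "norm a \<le> norm x" "norm b \<le> norm x"
    "a = (1/2) *\<^sub>R (x + adj x)" "b = cscale (-\<i>/2) (x - adj x)"
proof -
  let ?a = "(1/2) *\<^sub>R (x + adj x)" and ?b = "cscale (-\<i>/2) (x - adj x)"
  have half: "(1/2) *\<^sub>R y = cscale (1/2) y" for y :: 'a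
    using cscale_of_real[of "1/2" y] by simp
  have 1: "adj ?a = ?a" by (simp add: adj_scaleR adj_add adj_adj add.commute)
  have m: "cscale (- c) y = - cscale c y" for c and y :: 'a
    using cscale_cscale[of "-1" c y] by (simp add: cscale_minus_one)
  have 2: "adj ?b = ?b"
    by (simp add: adj_cscale adj_diff adj_adj m cscale_diff_right)
  have "cscale \<i> ?b = cscale (1/2) (x - adj x)" by (simp add: cscale_cscale)
  then have "?a + cscale \<i> ?b = (1/2) *\<^sub>R (x + adj x) + (1/2) *\<^sub>R (x - adj x)"
    by (simp add: half)
  also have "\<dots> = x" by (simp add: scaleR_add_right scaleR_diff_right flip: scaleR_add_left)
  finally have 3: "x = ?a + cscale \<i> ?b" by simp
  have 4: "norm ?a \<le> norm x" using norm_triangle_ineq[of x "adj x"] by simp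
  have 5: "norm ?b \<le> norm x" using norm_triangle_ineq4[of x "adj x"] by (simp add: norm_cscale norm_divide)
  show thesis by (rule that[OF 1 2 3 4 5 refl refl])
qed

lemma csubspace_zero: "csubspace S \<Longrightarrow> 0 \<in> S"
  and csubspace_add: "csubspace S \<Longrightarrow> x \<in> S \<Longrightarrow> y \<in> S \<Longrightarrow> x + y \<in> S"
  and csubspace_cscale: "csubspace S \<Longrightarrow> x \<in> S \<Longrightarrow> cscale a x \<in> S"
  by (auto simp: csubspace_def)

lemma csubspace_scaleR: "csubspace S \<Longrightarrow> x \<in> S \<Longrightarrow> r *\<^sub>R x \<in> S"
  by (metis csubspace_cscale cscale_of_real)

lemma csubspace_uminus: "csubspace S \<Longrightarrow> x \<in> S \<Longrightarrow> - x \<in> S"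
  using csubspace_cscale[of S x "-1"] by (simp add: cscale_minus_one)

lemma csubspace_diff: "csubspace S \<Longrightarrow> x \<in> S \<Longrightarrow> y \<in> S \<Longrightarrow> x - y \<in> S"
  using csubspace_add[of S x "-y"] csubspace_uminus[of S y] by simp

lemma csubspace_sum: "csubspace S \<Longrightarrow> (\<And>i. i \<in> A \<Longrightarrow> f i \<in> S) \<Longrightarrow> sum f A \<in> S"
  by (induction A rule: infinite_finite_induct) (auto intro: csubspace_zero csubspace_add)

lemma cstar_subalgebraD:
  assumes "cstar_subalgebra S"
  shows "csubspace S" "closed S" "\<And>x y. x \<in> S \<Longrightarrow> y \<in> S \<Longrightarrow> x * y \<in> S" "\<And>x. x \<in> S \<Longrightarrow> adj x \<in> S"
    "0 \<in> S" "\<And>x y. x \<in> S \<Longrightarrow> y \<in> S \<Longrightarrow> x + y \<in> S" "\<And>x y. x \<in> S \<Longrightarrow> y \<in> S \<Longrightarrow> x - y \<in> S"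
    "\<And>x. x \<in> S \<Longrightarrow> - x \<in> S" "\<And>x r. x \<in> S \<Longrightarrow> r *\<^sub>R x \<in> S" "\<And>x a. x \<in> S \<Longrightarrow> cscale a x \<in> S"
proof -
  show S: "csubspace S" "closed S" "\<And>x y. x \<in> S \<Longrightarrow> y \<in> S \<Longrightarrow> x * y \<in> S" "\<And>x. x \<in> S \<Longrightarrow> adj x \<in> S"
    using assms by (simp_all add: cstar_subalgebra_def)
  show "0 \<in> S" "\<And>x y. x \<in> S \<Longrightarrow> y \<in> S \<Longrightarrow> x + y \<in> S" "\<And>x y. x \<in> S \<Longrightarrow> y \<in> S \<Longrightarrow> x - y \<in> S"
    "\<And>x. x \<in> S \<Longrightarrow> - x \<in> S" "\<And>x r. x \<in> S \<Longrightarrow> r *\<^sub>R x \<in> S" "\<And>x a. x \<in> S \<Longrightarrow> cscale a x \<in> S"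
    using S(1) by (simp_all add: csubspace_zero csubspace_add csubspace_diff csubspace_uminus
        csubspace_scaleR csubspace_cscale)
qed

lemma cstar_subalgebra_gen: "cstar_subalgebra (cstar_gen X)"
  unfolding cstar_gen_def cstar_subalgebra_def csubspace_def by (auto intro!: closed_Inter)

lemma cstar_gen_superset: "X \<subseteq> cstar_gen X"
  unfolding cstar_gen_def by auto

lemma cstar_gen_least: "cstar_subalgebra S \<Longrightarrow> X \<subseteq> S \<Longrightarrow> cstar_gen X \<subseteq> S"
  unfolding cstar_gen_def by auto

lemma abelianD: "abelian S \<Longrightarrow> x \<in> S \<Longrightarrow> y \<in> S \<Longrightarrow> x * y = y * x"
  by (auto simp: abelian_def)

lemma cstar_subalgebra_commutant:
  assumes "\<And>x. x \<in> X \<Longrightarrow> adj x \<in> X"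
  shows "cstar_subalgebra (relative_commutant (X::'a::cstar_algebra set))"
  unfolding cstar_subalgebra_def csubspace_def relative_commutant_def
proof (intro conjI ballI allI impI)
  have "{x. \<forall>d\<in>X. x * d = d * x} = (\<Inter>d\<in>X. {x. x * d = d * x})" by auto
  also have "closed \<dots>"
    by (intro closed_INT ballI closed_Collect_eq continuous_intros)
  finally show "closed {x. \<forall>d\<in>X. x * d = d * x}" .
next
  fix x assume x: "x \<in> {x. \<forall>d\<in>X. x * d = d * x}"
  have "adj x * d = d * adj x" if "d \<in> X" for d
  proof -
    have "x * adj d = adj d * x" using x assms[OF that] by auto
    then have "adj (x * adj d) = adj (adj d * x)" by simp
    then show ?thesis by (simp add: adj_mult adj_adj)
  qed
  then show "adj x \<in> {x. \<forall>d\<in>X. x * d = d * x}" by auto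
next
  fix x y assume "x \<in> {x. \<forall>d\<in>X. x * d = d * x}" "y \<in> {x. \<forall>d\<in>X. x * d = d * x}"
  then have "x * y * d = d * (x * y)" if "d \<in> X" for d
    using that by (metis (mono_tags, lifting) mem_Collect_eq mult.assoc)
  then show "x * y \<in> {x. \<forall>d\<in>X. x * d = d * x}" by auto
qed (auto simp: distrib_left distrib_right cscale_mult_left cscale_mult_right)

text \<open>Two passes through the commutant: the commutant of \<open>X\<close> is a C*-subalgebra
  containing \<open>X\<close>, hence contains the generated algebra; so \<open>X\<close> lies in the
  commutant of the generated algebra, and then so does the generated algebra itself.\<close>

lemma abelian_cstar_gen:
  assumes adj: "\<And>x. x \<in> X \<Longrightarrow> adj x \<in> X" and comm: "\<And>x y. x \<in> X \<Longrightarrow> y \<in> X \<Longrightarrow> x * y = y * x"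
  shows "abelian (cstar_gen (X::'a::cstar_algebra set))"
proof -
  have "X \<subseteq> relative_commutant X" using comm by (auto simp: relative_commutant_def)
  then have 1: "cstar_gen X \<subseteq> relative_commutant X"
    using cstar_gen_least cstar_subalgebra_commutant adj by metis
  then have "X \<subseteq> relative_commutant (cstar_gen X)" by (fastforce simp: relative_commutant_def)
  then have "cstar_gen X \<subseteq> relative_commutant (cstar_gen X)"
    using cstar_gen_least cstar_subalgebra_commutant[of "cstar_gen X"] cstar_subalgebraD(4)[OF cstar_subalgebra_gen]
    by metis
  then show ?thesis by (auto simp: relative_commutant_def abelian_def)
qed

text \<open>\<open>1 - s\<close> is a square root of \<open>1 - x\<close>, obtained as a fixed point of \<open>s \<mapsto> (x + s\<^sup>2) / 2\<close>.\<close>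

lemma sa_sqrt:
  fixes x :: "'a::cstar_algebra"
  assumes S: "cstar_subalgebra S" and x: "x \<in> S" "adj x = x" "norm x < 1"
  obtains s where "s \<in> S" "adj s = s" "s + s - s * s = x"
proof -
  \<comment> \<open>\<open>r\<close> is the smaller root of \<open>r = (norm x + r * r) / 2\<close>,
    the scalar form of the fixed point equation. Hence \<open>T\<close> maps the ball of radius
    \<open>r\<close> into itself, and the same \<open>r < 1\<close> serves as the contraction
    constant.\<close>
  define r where "r = 1 - sqrt (1 - norm x)"
  have r: "0 \<le> r" "r < 1" using x by (auto simp: r_def)
  have "(1 - r)\<^sup>2 = 1 - norm x" using x by (simp add: r_def)
  then have r2: "norm x + r * r = 2 * r" by (simp add: power2_eq_square algebra_simps)
  define T where "T s = (1/2) *\<^sub>R (x + s * s)" for s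
  define X where "X = {s \<in> S. adj s = s \<and> norm s \<le> r}"
  have "X = S \<inter> {s. adj s = s} \<inter> cball 0 r" by (auto simp: X_def)
  also have "closed \<dots>"
    using bounded_linear.continuous_on[OF bounded_linear_adj continuous_on_id]
    by (intro closed_Int cstar_subalgebraD(2)[OF S] closed_Collect_eq closed_cball) auto
  finally have "complete X" by (rule complete_eq_closed[THEN iffD2])
  moreover have "X \<noteq> {}" using r cstar_subalgebraD(5)[OF S] by (auto simp: X_def intro!: exI[of _ 0])
  moreover have "T ` X \<subseteq> X"
  proof
    fix y assume "y \<in> T ` X"
    then obtain s where s: "s \<in> S" "adj s = s" "norm s \<le> r" "y = T s" by (auto simp: X_def)
    have "norm (x + s * s) \<le> norm x + norm s * norm s"
      using norm_triangle_le norm_mult_ineq by (metis add_left_mono)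
    also have "\<dots> \<le> norm x + r * r" using s r by (intro add_left_mono mult_mono) auto
    finally have "norm (T s) \<le> r" by (simp add: T_def r2)
    with s x show "y \<in> X"
      by (auto simp: X_def T_def adj_scaleR adj_add adj_mult intro!: cstar_subalgebraD[OF S])
  qed
  moreover have "\<forall>s\<in>X. \<forall>t\<in>X. dist (T s) (T t) \<le> r * dist s t"
  proof (intro ballI)
    fix s t assume st: "s \<in> X" "t \<in> X"
    \<comment> \<open>This splitting of \<open>s * s - t * t\<close> does not require that
      \<open>s\<close> and \<open>t\<close> commute.\<close>
    have "T s - T t = (1/2) *\<^sub>R ((s - t) * s + t * (s - t))"
      by (simp add: T_def algebra_simps)
    then have "norm (T s - T t) \<le> (1/2) * (norm ((s - t) * s) + norm (t * (s - t)))"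
      using norm_triangle_ineq by auto
    also have "\<dots> \<le> (1/2) * (norm (s - t) * r + r * norm (s - t))"
      using st r by (intro mult_left_mono add_mono order_trans[OF norm_mult_ineq] mult_mono) (auto simp: X_def)
    finally show "dist (T s) (T t) \<le> r * dist s t" by (simp add: dist_norm)
  qed
  ultimately obtain s where s: "s \<in> X" "T s = s" using Banach_fix[of X r T] r by blast
  have "2 *\<^sub>R s = x + s * s" using arg_cong[OF s(2), of "\<lambda>y. 2 *\<^sub>R y"] by (simp add: T_def)
  then have "s + s - s * s = x" by (simp add: scaleR_2 algebra_simps)
  with s(1) show ?thesis by (intro that[of s]) (auto simp: X_def)
qed

text \<open>For \<open>z = a + cscale \<i> b\<close> commutation gives
  \<open>adj z * z = a * a + b * b\<close>, and \<open>b\<close> is the imaginary part of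
  \<open>z\<close>, so \<open>norm b \<le> norm z\<close>. This stands in for monotonicity of the
  norm on positive elements before any order is available.\<close>

lemma norm_square_mono:
  fixes a b :: "'a::cstar_algebra"
  assumes "adj a = a" "adj b = b" "a * b = b * a"
  shows "norm (b * b) \<le> norm (a * a + b * b)"
proof -
  let ?z = "a + cscale \<i> b"
  have az: "adj ?z = a - cscale \<i> b"
    using cscale_cscale[of "-1" "\<i>" b] by (simp add: adj_add adj_cscale assms cscale_minus_one)
  have "adj ?z * ?z = a * a + b * b"
    unfolding az by (simp add: algebra_simps cscale_mult_left cscale_mult_right cscale_cscale cscale_minus_one cscale_diff_right assms)
  then have n: "(norm ?z)\<^sup>2 = norm (a * a + b * b)" using cstar_identity[of ?z] by simp
  have "2 *\<^sub>R cscale \<i> b = ?z - adj ?z" unfolding az by (simp add: scaleR_2)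
  then have "2 * norm b = norm (?z - adj ?z)"
    by (metis norm_cscale norm_ii mult_1 norm_scaleR abs_numeral)
  also have "\<dots> \<le> 2 * norm ?z" using norm_triangle_ineq4[of ?z "adj ?z"] unfolding norm_adj by linarith
  finally have "norm b * norm b \<le> norm ?z * norm ?z" by (intro mult_mono) auto
  with norm_mult_ineq[of b b] n show ?thesis by (simp add: power2_eq_square)
qed

section \<open>Unitization\<close>

text \<open>Taking the maximum with \<open>cmod (unz_scal u)\<close> makes this a C*-norm even if \<open>'a\<close> already has a unit,
  where the operator norm alone is only a seminorm.\<close>

datatype 'a unz = Unz (unz_scal: complex) (unz_elt: 'a)

definition unz_act :: "'a::cstar_algebra unz \<Rightarrow> 'a \<Rightarrow> 'a" where
  "unz_act u y = cscale (unz_scal u) y + unz_elt u * y"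

lemma bounded_linear_unz_act: "bounded_linear (unz_act u)"
  unfolding unz_act_def by (intro bounded_linear_add bounded_linear_cscale bounded_linear_mult_right)

instantiation unz :: (cstar_algebra) real_normed_algebra_1
begin

definition "0 = Unz 0 0"
definition "1 = Unz 1 0"
definition "u + v = Unz (unz_scal u + unz_scal v) (unz_elt u + unz_elt v)"
definition "u - v = Unz (unz_scal u - unz_scal v) (unz_elt u - unz_elt v)"
definition "- u = Unz (- unz_scal u) (- unz_elt u)"
definition "u * v = Unz (unz_scal u * unz_scal v)
  (cscale (unz_scal u) (unz_elt v) + cscale (unz_scal v) (unz_elt u) + unz_elt u * unz_elt v)"
definition "r *\<^sub>R u = Unz (r *\<^sub>R unz_scal u) (r *\<^sub>R unz_elt u)"
definition "norm u = max (cmod (unz_scal u)) (onorm (unz_act u))" for u :: "'a unz"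
definition "dist u v = norm (u - v)" for u v :: "'a unz"
definition "sgn u = inverse (norm u) *\<^sub>R u" for u :: "'a unz"
definition "uniformity = (INF e\<in>{0 <..}. principal {(x::'a unz, y). dist x y < e})"
definition "open U = (\<forall>x\<in>U. eventually (\<lambda>(x', y). x' = x \<longrightarrow> y \<in> U) uniformity)" for U :: "'a unz set"

lemmas unz_defs = zero_unz_def one_unz_def plus_unz_def minus_unz_def uminus_unz_def times_unz_def scaleR_unz_def

lemma unz_act_simps:
  "unz_act (u + v) = (\<lambda>y. unz_act u y + unz_act v y)"
  "unz_act (u * v) = unz_act u \<circ> unz_act v"
  "unz_act (r *\<^sub>R u) = (\<lambda>y. r *\<^sub>R unz_act u y)"
  "unz_act 1 = (\<lambda>y. y)"
  by (auto simp: fun_eq_iff unz_act_def unz_defs cscale_add_left cscale_add_right cscale_cscale cscale_one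
      cscale_mult_left cscale_mult_right algebra_simps cscale_of_real[symmetric] scaleR_conv_of_real)

text \<open>Testing the operator of \<open>u\<close> on \<open>adj (unz_elt u)\<close> recovers the
  norm of the algebra part by the C*-identity. Together with \<open>norm_unz_le\<close> this makes
  the norm equivalent to the sum norm, which yields definiteness and completeness.\<close>

lemma norm_unz_elt_le: "norm (unz_elt u) \<le> norm u + cmod (unz_scal u)"
proof -
  let ?x = "unz_elt u" and ?l = "unz_scal u"
  have "(norm ?x)\<^sup>2 = norm (?x * adj ?x)" by (simp add: cstar_identity')
  also have "?x * adj ?x = unz_act u (adj ?x) - cscale ?l (adj ?x)" by (simp add: unz_act_def)
  also have "norm \<dots> \<le> norm (unz_act u (adj ?x)) + norm (cscale ?l (adj ?x))"
    by (rule norm_triangle_ineq4)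
  also have "\<dots> \<le> onorm (unz_act u) * norm (adj ?x) + cmod ?l * norm (adj ?x)"
    by (intro add_mono onorm bounded_linear_unz_act) (simp add: norm_cscale)
  also have "\<dots> \<le> (norm u + cmod ?l) * norm ?x"
    by (auto simp: norm_unz_def distrib_right intro!: mult_right_mono)
  finally show ?thesis
    by (cases "norm ?x = 0") (auto simp: power2_eq_square norm_unz_def le_max_iff_disj intro: add_nonneg_nonneg)
qed

lemma norm_unz_le: "norm u \<le> cmod (unz_scal u) + norm (unz_elt u)"
proof -
  have "onorm (unz_act u) \<le> cmod (unz_scal u) + norm (unz_elt u)"
  proof (rule onorm_bound)
    fix y
    have "norm (unz_act u y) \<le> norm (cscale (unz_scal u) y) + norm (unz_elt u * y)"
      unfolding unz_act_def by (rule norm_triangle_ineq)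
    also have "\<dots> \<le> (cmod (unz_scal u) + norm (unz_elt u)) * norm y"
      using norm_mult_ineq[of "unz_elt u" y] by (simp add: norm_cscale distrib_right)
    finally show "norm (unz_act u y) \<le> (cmod (unz_scal u) + norm (unz_elt u)) * norm y" .
  qed auto
  then show ?thesis by (simp add: norm_unz_def)
qed

instance
proof
  fix u v w :: "'a unz" and r s :: real
  show "u + v + w = u + (v + w)" "u + v = v + u" "0 + u = u" "- u + u = 0" "u - v = u + - v"
    by (simp_all add: unz_defs)
  show "r *\<^sub>R (u + v) = r *\<^sub>R u + r *\<^sub>R v" "(r + s) *\<^sub>R u = r *\<^sub>R u + s *\<^sub>R u"
    "r *\<^sub>R s *\<^sub>R u = (r * s) *\<^sub>R u" "1 *\<^sub>R u = u"
    by (simp_all add: unz_defs scaleR_add_left scaleR_add_right)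
  show "(u * v) * w = u * (v * w)" "(u + v) * w = u * w + v * w" "u * (v + w) = u * v + u * w"
    by (simp_all add: unz_defs cscale_add_left cscale_add_right cscale_cscale cscale_mult_left
        cscale_mult_right algebra_simps)
  show "1 * u = u" "u * 1 = u" "(0::'a unz) \<noteq> 1" by (simp_all add: unz_defs cscale_one)
  have cr: "r *\<^sub>R cscale a x = cscale a (r *\<^sub>R x)" "cscale (r *\<^sub>R a) x = cscale a (r *\<^sub>R x)" for a and x :: 'a
    by (simp_all add: scaleR_conv_of_real cscale_cscale mult.commute flip: cscale_of_real)
  show "r *\<^sub>R u * v = r *\<^sub>R (u * v)" "u * r *\<^sub>R v = r *\<^sub>R (u * v)"
    by (simp_all add: unz_defs cr scaleR_add_right)
  show "dist u v = norm (u - v)" "sgn u = inverse (norm u) *\<^sub>R u" by (simp_all add: dist_unz_def sgn_unz_def)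
  show "uniformity = (INF e\<in>{0 <..}. principal {(x::'a unz, y). dist x y < e})"
    by (rule uniformity_unz_def)
  show "open U = (\<forall>x\<in>U. \<forall>\<^sub>F (x', y) in uniformity. x' = x \<longrightarrow> y \<in> U)" for U :: "'a unz set"
    by (rule open_unz_def)
  show "norm u = 0 \<longleftrightarrow> u = 0"
  proof
    assume n: "norm u = 0"
    then have "unz_scal u = 0" by (metis norm_unz_def max.cobounded1 norm_le_zero_iff)
    with n norm_unz_elt_le[of u] show "u = 0" by (cases u) (simp add: zero_unz_def)
  next
    assume "u = 0"
    with norm_unz_le[of u] show "norm u = 0"
      by (simp add: zero_unz_def norm_unz_def max_def split: if_splits)
  qed
  show "norm (u + v) \<le> norm u + norm v"
  proof -
    have "onorm (unz_act (u + v)) \<le> onorm (unz_act u) + onorm (unz_act v)"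
      unfolding unz_act_simps by (intro onorm_triangle bounded_linear_unz_act)
    then show ?thesis using norm_triangle_ineq[of "unz_scal u" "unz_scal v"]
      by (auto simp: norm_unz_def plus_unz_def)
  qed
  show "norm (r *\<^sub>R u) = \<bar>r\<bar> * norm u"
    unfolding norm_unz_def unz_act_simps onorm_scaleR[OF bounded_linear_unz_act]
    by (simp add: scaleR_unz_def max_mult_distrib_left)
  show "norm (u * v) \<le> norm u * norm v"
  proof -
    have "onorm (unz_act (u * v)) \<le> onorm (unz_act u) * onorm (unz_act v)"
      unfolding unz_act_simps by (intro onorm_compose bounded_linear_unz_act)
    also have "\<dots> \<le> norm u * norm v"
      by (intro mult_mono) (auto simp: norm_unz_def le_max_iff_disj intro: onorm_pos_le[OF bounded_linear_unz_act])
    finally have 1: "onorm (unz_act (u * v)) \<le> norm u * norm v" .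
    have "cmod (unz_scal (u * v)) \<le> norm u * norm v"
      by (auto simp: times_unz_def norm_mult norm_unz_def le_max_iff_disj intro!: mult_mono)
    with 1 show ?thesis by (simp add: norm_unz_def)
  qed
  show "norm (1::'a unz) = 1"
    using onorm_id_le[where ?'a='a] unfolding norm_unz_def unz_act_simps by (simp add: one_unz_def)
qed

end

definition unz_inc :: "'a::cstar_algebra \<Rightarrow> 'a unz" where "unz_inc x = Unz 0 x"

instantiation unz :: (cstar_algebra) cstar_algebra
begin

definition "cscale a u = Unz (a * unz_scal u) (cscale a (unz_elt u))"
definition "adj u = Unz (cnj (unz_scal u)) (adj (unz_elt u))"

lemma norm_unz_scal_le: "cmod (unz_scal u) \<le> norm (u :: 'a unz)"
  by (simp add: norm_unz_def)

lemma norm_unz_elt_le': "norm (unz_elt u) \<le> 2 * norm (u :: 'a unz)"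
  using norm_unz_elt_le[of u] norm_unz_scal_le[of u] by simp

lemma norm_unz_act_le: "norm (unz_act u y) \<le> norm u * norm y"
proof -
  have "norm (unz_act u y) \<le> onorm (unz_act u) * norm y" by (rule onorm[OF bounded_linear_unz_act])
  also have "\<dots> \<le> norm u * norm y" by (intro mult_right_mono) (auto simp: norm_unz_def)
  finally show ?thesis .
qed

lemma unz_act_adj: "adj (unz_act u y) * unz_act u y = adj y * unz_act (adj u * u) y"
  by (simp add: unz_act_def adj_unz_def times_unz_def adj_add adj_mult adj_cscale algebra_simps
      cscale_add_left cscale_add_right cscale_cscale cscale_mult_left cscale_mult_right)

text \<open>Both entries of the maximum satisfy this inequality: the operator norm by the
  C*-identity applied to \<open>unz_act u y\<close>, the scalar part by multiplicativity. The
  opposite inequality follows once \<open>adj\<close> is known to be isometric.\<close>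

lemma norm_unz_square_le: "(norm u)\<^sup>2 \<le> norm (adj u * u :: 'a unz)"
proof -
  let ?k = "sqrt (norm (adj u * u))"
  have "onorm (unz_act u) \<le> ?k"
  proof (rule onorm_bound)
    fix y
    have "(norm (unz_act u y))\<^sup>2 = norm (adj y * unz_act (adj u * u) y)"
      by (simp add: unz_act_adj flip: cstar_identity)
    also have "\<dots> \<le> norm y * (norm (adj u * u) * norm y)"
      using norm_mult_ineq[of "adj y" "unz_act (adj u * u) y"]
        mult_left_mono[OF norm_unz_act_le[of "adj u * u" y] norm_ge_zero[of y]] by simp
    also have "\<dots> = (?k * norm y)\<^sup>2" by (simp add: power2_eq_square)
    finally show "norm (unz_act u y) \<le> ?k * norm y" by (rule power2_le_imp_le) simp
  qed simp
  moreover have "cmod (unz_scal u) \<le> ?k"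
  proof (rule real_le_rsqrt)
    have "(cmod (unz_scal u))\<^sup>2 = cmod (unz_scal (adj u * u))"
      by (simp add: adj_unz_def times_unz_def norm_mult power2_eq_square)
    then show "(cmod (unz_scal u))\<^sup>2 \<le> norm (adj u * u)" by (simp add: norm_unz_scal_le)
  qed
  ultimately have "norm u \<le> ?k" by (simp add: norm_unz_def)
  then show ?thesis by (metis norm_ge_zero power_mono real_sqrt_pow2)
qed

instance
proof
  fix u v w :: "'a unz" and r :: real and a b :: complex
  show "cscale (complex_of_real r) u = r *\<^sub>R u"
    by (simp add: cscale_unz_def scaleR_unz_def cscale_of_real scaleR_conv_of_real)
  show "cscale a (u + v) = cscale a u + cscale a v" "cscale (a + b) u = cscale a u + cscale b u"
    "cscale a (cscale b u) = cscale (a * b) u" "cscale 1 u = u"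
    by (simp_all add: cscale_unz_def plus_unz_def cscale_add_left cscale_add_right cscale_cscale
        cscale_one algebra_simps)
  show cm: "cscale a u * v = cscale a (u * v)" "u * cscale a v = cscale a (u * v)"
    for a and u v :: "'a unz"
    by (simp_all add: cscale_unz_def times_unz_def cscale_add_right cscale_cscale cscale_mult_left
        cscale_mult_right mult_ac)
  show aa: "adj (adj u) = u" for u :: "'a unz" by (simp add: adj_unz_def adj_adj)
  show "adj (u + v) = adj u + adj v" "adj (cscale a u) = cscale (cnj a) (adj u)"
    by (simp_all add: adj_unz_def plus_unz_def cscale_unz_def adj_add adj_cscale)
  show am: "adj (u * v) = adj v * adj u"
    by (simp add: adj_unz_def times_unz_def adj_add adj_mult adj_cscale mult.commute add_ac)
  have le: "norm (cscale a u) \<le> cmod a * norm u" for a and u :: "'a unz"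
  proof -
    have "onorm (unz_act (cscale a u)) \<le> cmod a * norm u"
    proof (rule onorm_bound)
      show "norm (unz_act (cscale a u) y) \<le> cmod a * norm u * norm y" for y
      proof -
        have "unz_act (cscale a u) y = cscale a (unz_act u y)"
          by (simp add: unz_act_def cscale_unz_def cscale_add_right cscale_cscale cscale_mult_left)
        then show ?thesis
          using mult_left_mono[OF norm_unz_act_le[of u y] norm_ge_zero[of a]] by (simp add: norm_cscale mult.assoc)
      qed
    qed simp
    moreover have "cmod (unz_scal (cscale a u)) \<le> cmod a * norm u"
      by (simp add: cscale_unz_def norm_mult norm_unz_scal_le mult_left_mono)
    ultimately show ?thesis by (simp add: norm_unz_def)
  qed
  show "norm (cscale a u) = cmod a * norm u"
  proof (cases "a = 0")
    case False
    have "cscale (inverse a) (cscale a u) = u"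
      using False by (cases u) (simp add: cscale_unz_def cscale_cscale cscale_one)
    then have "norm u \<le> inverse (cmod a) * norm (cscale a u)"
      using le[of "inverse a" "cscale a u"] by (simp add: norm_inverse)
    then have "cmod a * norm u \<le> norm (cscale a u)" using False by (simp add: field_simps)
    with le[of a u] show ?thesis by simp
  qed (use le[of a u] in simp)
  have n: "norm u \<le> norm (adj u)" for u :: "'a unz"
  proof (cases "u = 0")
    case False
    have "norm u * norm u \<le> norm (adj u) * norm u"
      using norm_unz_square_le[of u] norm_mult_ineq[of "adj u" u] by (simp add: power2_eq_square)
    with False show ?thesis by simp
  qed simp
  have "norm (adj u) = norm u" using n[of u] n[of "adj u"] by (simp add: aa)
  then show "norm (adj u * u) = (norm u)\<^sup>2"
    using norm_unz_square_le[of u] norm_mult_ineq[of "adj u" u] by (simp add: power2_eq_square)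
  fix X :: "nat \<Rightarrow> 'a unz"
  assume X: "Cauchy X"
  have "Cauchy (\<lambda>n. unz_scal (X n))"
  proof (rule metric_CauchyI)
    fix e :: real assume "0 < e"
    then obtain M where "\<forall>m\<ge>M. \<forall>n\<ge>M. dist (X m) (X n) < e" using metric_CauchyD[OF X] by blast
    moreover have "dist (unz_scal (X m)) (unz_scal (X n)) \<le> dist (X m) (X n)" for m n
      using norm_unz_scal_le[of "X m - X n"] by (simp add: dist_norm minus_unz_def)
    ultimately show "\<exists>M. \<forall>m\<ge>M. \<forall>n\<ge>M. dist (unz_scal (X m)) (unz_scal (X n)) < e"
      by (meson le_less_trans)
  qed
  then obtain l where l: "(\<lambda>n. unz_scal (X n)) \<longlonglongrightarrow> l" using Cauchy_convergent convergent_def by blast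
  have "Cauchy (\<lambda>n. unz_elt (X n))"
  proof (rule metric_CauchyI)
    fix e :: real assume "0 < e"
    then obtain M where "\<forall>m\<ge>M. \<forall>n\<ge>M. dist (X m) (X n) < e / 2"
      using metric_CauchyD[OF X, of "e / 2"] by auto
    moreover have "dist (unz_elt (X m)) (unz_elt (X n)) \<le> 2 * dist (X m) (X n)" for m n
      using norm_unz_elt_le'[of "X m - X n"] by (simp add: dist_norm minus_unz_def)
    ultimately have "dist (unz_elt (X m)) (unz_elt (X n)) < e" if "m \<ge> M" "n \<ge> M" for m n
      using that by (smt (verit) field_sum_of_halves)
    then show "\<exists>M. \<forall>m\<ge>M. \<forall>n\<ge>M. dist (unz_elt (X m)) (unz_elt (X n)) < e" by blast
  qed
  then obtain x where x: "(\<lambda>n. unz_elt (X n)) \<longlonglongrightarrow> x" using Cauchy_convergent convergent_def by blast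
  have "(\<lambda>n. norm (unz_scal (X n) - l) + norm (unz_elt (X n) - x)) \<longlonglongrightarrow> 0"
    using l x by (intro tendsto_eq_intros) (auto simp: tendsto_norm_zero_iff LIM_zero_iff)
  moreover have "norm (X n - Unz l x) \<le> norm (unz_scal (X n) - l) + norm (unz_elt (X n) - x)" for n
    using norm_unz_le[of "X n - Unz l x"] by (simp add: minus_unz_def)
  ultimately have "(\<lambda>n. X n - Unz l x) \<longlonglongrightarrow> 0"
    by (intro Lim_null_comparison[where f = "\<lambda>n. X n - Unz l x"]) auto
  then have "X \<longlonglongrightarrow> Unz l x" by (simp add: LIM_zero_iff)
  then show "convergent X" by (auto simp: convergent_def)
qed

end

lemma norm_unz_inc [simp]: "norm (unz_inc x) = norm x"
  using norm_unz_le[of "unz_inc x"] norm_unz_elt_le[of "unz_inc x"] by (simp add: unz_inc_def)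

lemma unz_inc_simps:
  "unz_inc (x + y) = unz_inc x + unz_inc y" "unz_inc (x - y) = unz_inc x - unz_inc y"
  "unz_inc (x * y) = unz_inc x * unz_inc y" "unz_inc (adj x) = adj (unz_inc x)"
  "unz_inc (cscale a x) = cscale a (unz_inc x)" "unz_inc (r *\<^sub>R x) = r *\<^sub>R unz_inc x"
  "unz_inc 0 = 0" "unz_inc (- x) = - unz_inc x"
  by (simp_all add: unz_inc_def unz_defs adj_unz_def cscale_unz_def)

lemma unz_inc_eq_iff [simp]: "unz_inc x = unz_inc y \<longleftrightarrow> x = y"
  by (simp add: unz_inc_def)

lemma unz_mult_inc: "u * unz_inc x = unz_inc (unz_act u x)"
  by (simp add: unz_inc_def times_unz_def unz_act_def add.commute)

text \<open>This is \<open>S\<close> with scalars adjoined, formed inside the unitization of the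
  ambient algebra, so that its elements can be multiplied with elements outside \<open>S\<close>,
  such as normalizers.\<close>

definition unz_sub :: "'a::cstar_algebra set \<Rightarrow> 'a unz set" where
  "unz_sub S = {u. unz_elt u \<in> S}"

lemma unz_inc_in_sub [simp]: "unz_inc x \<in> unz_sub S \<longleftrightarrow> x \<in> S"
  by (simp add: unz_sub_def unz_inc_def)

lemma bounded_linear_unz_elt: "bounded_linear (unz_elt :: 'a::cstar_algebra unz \<Rightarrow> 'a)"
  by (rule bounded_linear_intro[where K = 2])
    (use norm_unz_elt_le' in \<open>auto simp: unz_defs mult.commute\<close>)

lemma cstar_subalgebra_unz_sub:
  assumes S: "cstar_subalgebra S"
  shows "cstar_subalgebra (unz_sub S)"
  unfolding cstar_subalgebra_def csubspace_def
proof (intro conjI ballI allI impI)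
  have "unz_sub S = unz_elt -` S" by (auto simp: unz_sub_def)
  then show "closed (unz_sub S)"
    using continuous_closed_vimage[OF cstar_subalgebraD(2)[OF S], of unz_elt]
      linear_continuous_at[OF bounded_linear_unz_elt] by metis
qed (use S in \<open>simp_all add: unz_sub_def unz_defs cscale_unz_def adj_unz_def cstar_subalgebraD\<close>)

lemma abelian_unz_sub: "abelian S \<Longrightarrow> abelian (unz_sub S)"
  unfolding abelian_def unz_sub_def by (auto simp: times_unz_def add_ac mult.commute)

lemma one_in_unz_sub: "cstar_subalgebra S \<Longrightarrow> 1 \<in> unz_sub S"
  by (simp add: unz_sub_def one_unz_def cstar_subalgebraD)

section \<open>Characters of abelian C*-algebras\<close>

definition is_char :: "'a::{cstar_algebra,real_normed_algebra_1} set \<Rightarrow> ('a \<Rightarrow> complex) \<Rightarrow> bool" where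
  "is_char S \<phi> \<longleftrightarrow> (\<forall>x\<in>S. \<forall>y\<in>S. \<phi> (x + y) = \<phi> x + \<phi> y \<and> \<phi> (x * y) = \<phi> x * \<phi> y) \<and>
     (\<forall>a. \<forall>x\<in>S. \<phi> (cscale a x) = a * \<phi> x) \<and> (\<forall>x\<in>S. \<phi> (adj x) = cnj (\<phi> x)) \<and> \<phi> 1 = 1 \<and>
     (\<forall>x\<in>S. cmod (\<phi> x) \<le> norm x)"

locale unital_abelian =
  fixes S :: "'a::{cstar_algebra,real_normed_algebra_1} set"
  assumes sub: "cstar_subalgebra S" and ab: "abelian S" and one: "1 \<in> S"
begin

lemmas S = cstar_subalgebraD[OF sub]

lemma comm: "x \<in> S \<Longrightarrow> y \<in> S \<Longrightarrow> x * y = y * x"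
  using ab by (rule abelianD)

lemma left_comm: "x \<in> S \<Longrightarrow> y \<in> S \<Longrightarrow> x * (y * z) = y * (x * z)"
  by (metis comm mult.assoc)

lemma of_real_in: "of_real r \<in> S"
  by (simp add: of_real_def S one)

section \<open>The order on the self-adjoint part of a unital abelian algebra\<close>

definition R where "R = {x \<in> S. adj x = x}"

lemma R_sub: "x \<in> R \<Longrightarrow> x \<in> S" and R_adj: "x \<in> R \<Longrightarrow> adj x = x"
  by (auto simp: R_def)

lemma R_add: "x \<in> R \<Longrightarrow> y \<in> R \<Longrightarrow> x + y \<in> R"
  and R_diff: "x \<in> R \<Longrightarrow> y \<in> R \<Longrightarrow> x - y \<in> R"
  and R_minus: "x \<in> R \<Longrightarrow> - x \<in> R"
  and R_scaleR: "x \<in> R \<Longrightarrow> r *\<^sub>R x \<in> R"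
  and R_of_real: "of_real r \<in> R"
  and R_one: "1 \<in> R"
  and R_zero: "0 \<in> R"
  by (auto simp: R_def S adj_add adj_diff adj_minus adj_scaleR of_real_def one)

lemma R_mult: "x \<in> R \<Longrightarrow> y \<in> R \<Longrightarrow> x * y \<in> R"
  by (auto simp: R_def S adj_mult comm)

lemmas R_closed = R_add R_diff R_minus R_scaleR R_of_real R_one R_zero R_mult

text \<open>These are the positive elements: the spectrum lies in \<open>[0, 2 t]\<close>.\<close>

definition cone where "cone = {x \<in> R. \<exists>t. norm (of_real t - x) \<le> t}"

lemma cone_R: "x \<in> cone \<Longrightarrow> x \<in> R" by (simp add: cone_def)

lemma norm_le_imp_cone: "x \<in> R \<Longrightarrow> norm x \<le> r \<Longrightarrow> of_real r - x \<in> cone"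
  by (auto simp: cone_def R_closed intro!: exI[of _ r])

lemma cone_of_real: "0 \<le> r \<Longrightarrow> of_real r \<in> cone"
  using norm_le_imp_cone[of 0 r] by (simp add: R_zero)

text \<open>After scaling to \<open>norm (k * k) < 1\<close> there is a self-adjoint
  \<open>m\<close> with \<open>k * k + m * m = 1\<close>, and \<open>norm_square_mono\<close> gives
  \<open>norm (m * m) \<le> 1\<close>. This is positivity of squares.\<close>

lemma square_norm_le:
  assumes x: "x \<in> R" and t: "norm (x * x) < t"
  shows "norm (of_real t - x * x) \<le> t"
proof -
  have t0: "0 < t" using t norm_ge_zero[of "x * x"] by linarith
  define k where "k = (1 / sqrt t) *\<^sub>R x"
  have k: "k \<in> R" "k * k = (1 / t) *\<^sub>R (x * x)" using x t0 by (auto simp: k_def R_closed)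
  have "norm (k * k) < 1" using t t0 by (simp add: k)
  then obtain s where s: "s \<in> S" "adj s = s" "s + s - s * s = k * k"
    using sa_sqrt[OF sub R_sub R_adj, of "k * k"] R_mult[OF k(1) k(1)] by blast
  define m where "m = 1 - s"
  have m: "m \<in> R" using s by (auto simp: m_def R_def S one adj_diff)
  have mm: "m * m = 1 - k * k" by (simp add: m_def algebra_simps flip: s(3))
  have "norm (m * m) \<le> norm (k * k + m * m)"
    by (rule norm_square_mono) (use k m comm R_adj R_sub in auto)
  then have le: "norm (m * m) \<le> 1" by (simp add: mm)
  have "of_real t - x * x = t *\<^sub>R (m * m)"
    using t0 by (simp add: mm k of_real_def scaleR_diff_right)
  then show ?thesis using le t0 by simp
qed

lemma cone_square: "x \<in> R \<Longrightarrow> x * x \<in> cone"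
  using square_norm_le[of x "norm (x * x) + 1"] by (auto simp: cone_def R_closed simp del: of_real_add)

text \<open>The shift by \<open>e\<close> makes \<open>(t - x) / (t + e)\<close> strictly
  contractive, as \<open>sa_sqrt\<close> requires. Later statements about \<open>cone\<close>
  therefore remove an arbitrarily small shift at the end.\<close>

lemma cone_approx_square:
  assumes x: "x \<in> cone" and e: "0 < e"
  obtains m where "m \<in> R" "m * m = x + of_real e"
proof -
  obtain t where t: "norm (of_real t - x) \<le> t" "x \<in> R" using x by (auto simp: cone_def)
  have te: "0 < t + e" using t(1) e norm_ge_zero[of "of_real t - x"] by linarith
  define y where "y = (1 / (t + e)) *\<^sub>R (of_real t - x)"
  have "norm y < 1" using t te e by (simp add: y_def)
  moreover have "y \<in> R" by (simp add: y_def R_closed t)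
  ultimately obtain s where s: "s \<in> S" "adj s = s" "s + s - s * s = y"
    using sa_sqrt[OF sub R_sub R_adj, of y] by blast
  have sR: "s \<in> R" using s by (simp add: R_def)
  have "sqrt (t + e) *\<^sub>R (1 - s) * sqrt (t + e) *\<^sub>R (1 - s) = (t + e) *\<^sub>R (1 - y)"
    using te by (simp add: algebra_simps flip: s(3))
  also have "\<dots> = of_real (t + e) - (of_real t - x)"
    using te by (simp add: y_def scaleR_diff_right of_real_def)
  also have "\<dots> = x + of_real e" by simp
  finally show ?thesis using that[of "sqrt (t + e) *\<^sub>R (1 - s)"] sR by (simp add: R_closed)
qed

lemma cone_norm_mono:
  assumes "x \<in> cone" "y \<in> cone"
  shows "norm x \<le> norm (x + y)"
proof (rule field_le_epsilon)
  fix e :: real assume "0 < e"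
  define d where "d = e / 3"
  have d: "0 < d" using \<open>0 < e\<close> by (simp add: d_def)
  obtain l where l: "l \<in> R" "l * l = x + of_real d" using cone_approx_square[OF assms(1) d] .
  obtain k where k: "k \<in> R" "k * k = y + of_real d" using cone_approx_square[OF assms(2) d] .
  have "norm (x + of_real d) \<le> norm (k * k + l * l)"
    unfolding l(2)[symmetric] by (rule norm_square_mono) (use k l comm R_adj R_sub in auto)
  also have "k * k + l * l = x + y + of_real (2 * d)" unfolding k(2) l(2) mult_2 of_real_add by (simp only: add_ac)
  also have "norm \<dots> \<le> norm (x + y) + norm (of_real (2 * d) :: 'a)" by (rule norm_triangle_ineq)
  also have "norm (of_real (2 * d) :: 'a) = 2 * d" unfolding norm_of_real using d by simp
  finally have "norm (x + of_real d) \<le> norm (x + y) + 2 * d" .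
  moreover have "norm x \<le> norm (x + of_real d) + d"
    using norm_triangle_ineq4[of "x + of_real d" "of_real d"] d by simp
  ultimately show "norm x \<le> norm (x + y) + e" by (simp add: d_def)
qed

lemma cone_add: 
  assumes "x \<in> cone" "y \<in> cone"
  shows "x + y \<in> cone"
proof -
  obtain t u where "norm (of_real t - x) \<le> t" "norm (of_real u - y) \<le> u" "x \<in> R" "y \<in> R"
    using assms by (auto simp: cone_def)
  then have "norm (of_real (t + u) - (x + y)) \<le> t + u"
    using norm_triangle_ineq[of "of_real t - x" "of_real u - y"] by (simp add: algebra_simps)
  with \<open>x \<in> R\<close> \<open>y \<in> R\<close> show ?thesis unfolding cone_def by (blast intro: R_closed)
qed

text \<open>The bound \<open>t\<close> that witnesses membership may vary with \<open>e\<close>, so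
  it is first replaced by one depending on \<open>x\<close> only: an approximate square root returns
  the element as a square, and \<open>square_norm_le\<close> applies with
  \<open>t = norm x + 1\<close>.\<close>

lemma cone_closed:
  assumes x: "x \<in> R" and e: "\<And>e. 0 < e \<Longrightarrow> x + of_real e \<in> cone"
  shows "x \<in> cone"
proof -
  define t where "t = norm x + 1"
  have "norm (of_real t - x) \<le> t"
  proof (rule field_le_epsilon)
    fix d :: real assume "0 < d"
    \<comment> \<open>\<open>2 * c \<le> d\<close> controls the final error, and
      \<open>c \<le> 1 / 4\<close> keeps \<open>norm (m * m) \<le> norm x + 2 * c\<close> strictly
      below \<open>t\<close>.\<close>
    define c where "c = min (d / 2) (1 / 4)"
    have c: "0 < c" "c \<le> 1 / 4" "2 * c \<le> d" using \<open>0 < d\<close> by (auto simp: c_def)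
    obtain m where m: "m \<in> R" "m * m = x + of_real c + of_real c"
      using cone_approx_square[OF e[OF c(1)] c(1)] .
    then have mm: "m * m = x + of_real (2 * c)" unfolding mult_2 of_real_add by (simp only: add_ac)
    have n: "norm (of_real (2 * c) :: 'a) = 2 * c" unfolding norm_of_real using c by simp
    have "norm (m * m) \<le> norm x + 2 * c"
      unfolding mm using norm_triangle_ineq[of x "of_real (2 * c)"] n by simp
    then have "norm (m * m) < t" using c by (simp add: t_def)
    then have le: "norm (of_real t - m * m) \<le> t" by (rule square_norm_le[OF m(1)])
    have E: "of_real t - x = (of_real t - m * m) + of_real (2 * c)" by (simp add: mm)
    have "norm (of_real t - x) \<le> t + 2 * c"
      unfolding E using le norm_triangle_ineq[of "of_real t - m * m" "of_real (2 * c)"] n by linarith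
    with c show "norm (of_real t - x) \<le> t + d" by simp
  qed
  with x show ?thesis by (auto simp: cone_def)
qed

text \<open>Approximate roots \<open>m\<close> and \<open>n\<close> give the square
  \<open>(m * n) * (m * n) = (x + e) * (y + e)\<close>. With \<open>e \<le> 1\<close> it differs
  from \<open>x * y\<close> by at most \<open>e * (norm x + norm y + 1)\<close>, which explains the
  choice of \<open>e\<close>.\<close>

lemma cone_mult:
  assumes x: "x \<in> cone" and y: "y \<in> cone"
  shows "x * y \<in> cone"
proof (rule cone_closed)
  show "x * y \<in> R" using x y by (intro R_mult cone_R)
  fix d :: real assume "0 < d"
  define e where "e = min 1 (d / (norm x + norm y + 1))"
  have p: "0 < norm x + norm y + 1" using norm_ge_zero[of x] norm_ge_zero[of y] by linarith
  have e0: "0 < e" "e \<le> 1" "e \<le> d / (norm x + norm y + 1)" using \<open>0 < d\<close> p by (auto simp: e_def)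
  have e: "e * (norm x + norm y + 1) \<le> d" using e0(3) p by (simp add: field_simps)
  obtain m where m: "m \<in> R" "m * m = x + of_real e" using cone_approx_square[OF x e0(1)] .
  obtain n where n: "n \<in> R" "n * n = y + of_real e" using cone_approx_square[OF y e0(1)] .
  let ?z = "e *\<^sub>R x + e *\<^sub>R y + of_real (e * e)"
  have "m * n * (m * n) = m * m * (n * n)"
    by (simp only: mult.assoc left_comm[of n m, OF R_sub R_sub, OF n(1) m(1)])
  also have "\<dots> = x * y + ?z" by (simp add: m n algebra_simps of_real_def)
  finally have mn: "x * y + ?z \<in> cone" using cone_square[of "m * n"] m n R_mult by simp
  have "norm ?z \<le> norm (e *\<^sub>R x) + norm (e *\<^sub>R y) + norm (of_real (e * e) :: 'a)"
    by (intro norm_triangle_le add_mono order_refl)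
  also have "\<dots> \<le> e * norm x + e * norm y + e"
    using e0 by (simp only: norm_of_real norm_scaleR abs_mult abs_of_pos) (simp add: mult_left_le)
  finally have "norm ?z \<le> d" using e by (simp add: algebra_simps)
  then have "of_real d - ?z \<in> cone" using x y by (intro norm_le_imp_cone R_closed cone_R)
  from cone_add[OF mn this] show "x * y + of_real d \<in> cone" by (simp add: algebra_simps)
qed

text \<open>Characters correspond to maximal preorderings of the real algebra \<open>R\<close>, which are total;
  the value of the character is the cut that the preordering defines in the reals.\<close>

definition preordering where
  "preordering Q \<longleftrightarrow> cone \<subseteq> Q \<and> Q \<subseteq> R \<and> (\<forall>x\<in>Q. \<forall>y\<in>Q. x + y \<in> Q \<and> x * y \<in> Q) \<and> - 1 \<notin> Q"

lemma preorderingD: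
  assumes "preordering Q"
  shows "x \<in> cone \<Longrightarrow> x \<in> Q" "x \<in> Q \<Longrightarrow> x \<in> R" "x \<in> Q \<Longrightarrow> x \<in> S" "x \<in> Q \<Longrightarrow> y \<in> Q \<Longrightarrow> x + y \<in> Q"
    "x \<in> Q \<Longrightarrow> y \<in> Q \<Longrightarrow> x * y \<in> Q" "- 1 \<notin> Q" "0 \<le> r \<Longrightarrow> of_real r \<in> Q"
    "x \<in> Q \<Longrightarrow> 0 \<le> r \<Longrightarrow> r *\<^sub>R x \<in> Q"
proof -
  show *: "0 \<le> r \<Longrightarrow> of_real r \<in> Q" for r using assms cone_of_real by (auto simp: preordering_def)
  show "x \<in> Q \<Longrightarrow> 0 \<le> r \<Longrightarrow> r *\<^sub>R x \<in> Q"
    using *[of r] assms by (auto simp: preordering_def scaleR_conv_of_real)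
qed (use assms R_sub in \<open>auto simp: preordering_def\<close>)

text \<open>Because \<open>x * x\<close> already lies in \<open>cone\<close>, terms of first degree
  in \<open>x\<close> suffice to describe the preordering generated by \<open>Q\<close> and
  \<open>x\<close>.\<close>

definition adjoin where "adjoin Q x = {p + x * q | p q. p \<in> Q \<and> q \<in> Q}"

lemma adjoinI: "p \<in> Q \<Longrightarrow> q \<in> Q \<Longrightarrow> p + x * q \<in> adjoin Q x"
  by (auto simp: adjoin_def)

lemma adjoin_closed:
  assumes Q: "cone \<subseteq> Q" "Q \<subseteq> R" "\<And>x y. x \<in> Q \<Longrightarrow> y \<in> Q \<Longrightarrow> x + y \<in> Q \<and> x * y \<in> Q"
    and x: "x \<in> R"
  shows "cone \<subseteq> adjoin Q x" "Q \<subseteq> adjoin Q x" "x \<in> adjoin Q x" "adjoin Q x \<subseteq> R"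
    "\<And>y z. y \<in> adjoin Q x \<Longrightarrow> z \<in> adjoin Q x \<Longrightarrow> y + z \<in> adjoin Q x \<and> y * z \<in> adjoin Q x"
proof -
  have 0: "0 \<in> Q" "1 \<in> Q" using Q(1) cone_of_real[of 0] cone_of_real[of 1] by auto
  show 1: "Q \<subseteq> adjoin Q x" using adjoinI[OF _ 0(1), of _ x] by auto
  then show "cone \<subseteq> adjoin Q x" using Q(1) by blast
  show "x \<in> adjoin Q x" using adjoinI[OF 0, of x] by auto
  show "adjoin Q x \<subseteq> R" using Q(2) x by (auto simp: adjoin_def intro!: R_closed)
  fix y z assume "y \<in> adjoin Q x" "z \<in> adjoin Q x"
  then obtain p q p' q' where *: "y = p + x * q" "z = p' + x * q'" "p \<in> Q" "q \<in> Q" "p' \<in> Q" "q' \<in> Q"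
    by (auto simp: adjoin_def)
  have in_S: "x \<in> S" "p \<in> S" "q \<in> S" "p' \<in> S" "q' \<in> S" using * x Q(2) R_sub by auto
  have "y + z = (p + p') + x * (q + q')" by (simp add: * algebra_simps)
  then have "y + z \<in> adjoin Q x" using Q(3) *(3-6) adjoinI by metis
  moreover have "y * z = (p * p' + (x * x) * (q * q')) + x * (p * q' + q * p')"
    using in_S by (simp add: * algebra_simps left_comm[of p x] left_comm[of q x])
  moreover have "x * x \<in> Q" using cone_square x Q(1) by auto
  ultimately show "y + z \<in> adjoin Q x \<and> y * z \<in> adjoin Q x"
    using Q(3) *(3-6) adjoinI by metis
qed

text \<open>If neither \<open>x\<close> nor \<open>- x\<close> belongs to \<open>Q\<close>,
  maximality puts \<open>- 1\<close> into both extensions: \<open>x * q = - (1 + p)\<close> and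
  \<open>x * q' = 1 + p'\<close>. Multiplying the two equations writes \<open>- 1\<close> as an
  element of \<open>Q\<close>.\<close>

lemma maximal_preordering_total:
  assumes Q: "preordering Q" and max: "\<And>Q'. preordering Q' \<Longrightarrow> Q \<subseteq> Q' \<Longrightarrow> Q' = Q" and x: "x \<in> R"
  shows "x \<in> Q \<or> - x \<in> Q"
proof (rule ccontr)
  note Q' = preorderingD[OF Q]
  assume n: "\<not> ?thesis"
  have "- 1 \<in> adjoin Q y" if y: "y \<in> R" "y \<notin> Q" for y
  proof (rule ccontr)
    assume m: "- 1 \<notin> adjoin Q y"
    have cl: "cone \<subseteq> Q" "Q \<subseteq> R" "\<And>x y. x \<in> Q \<Longrightarrow> y \<in> Q \<Longrightarrow> x + y \<in> Q \<and> x * y \<in> Q"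
      using Q by (auto simp: preordering_def)
    note a = adjoin_closed[OF cl y(1)]
    from a m have "preordering (adjoin Q y)" by (auto simp: preordering_def)
    from max[OF this a(2)] a(3) y(2) show False by simp
  qed
  from this[of x] this[of "- x"] n x obtain p q p' q' where
    *: "- 1 = p + x * q" "- 1 = p' - x * q'" "p \<in> Q" "q \<in> Q" "p' \<in> Q" "q' \<in> Q"
    by (auto simp: adjoin_def R_minus)
  have in_S: "x \<in> S" "p \<in> S" "q \<in> S" "p' \<in> S" "q' \<in> S" using * x Q' R_sub by auto
  have "x * q = (p + x * q) - p" "x * q' = p' - (p' - x * q')" by simp_all
  then have e: "x * q = - (1 + p)" "x * q' = 1 + p'" unfolding *(1,2)[symmetric] by simp_all
  have "(x * x) * (q * q') = (x * q) * (x * q')"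
    using in_S by (simp add: mult.assoc left_comm[of q x])
  also have "\<dots> = - (1 + p) * (1 + p')" by (simp only: e)
  finally have "- 1 = (p + p' + p * p') + (x * x) * (q * q')" by (simp add: algebra_simps)
  moreover have "\<dots> \<in> Q" using * Q' cone_square[OF x] by simp
  ultimately show False using Q'(6) by simp
qed

text \<open>Membership of \<open>H - 1\<close> will force the resulting character to be at least 1
  at \<open>H\<close>. Adjoining it is consistent: \<open>- 1 = p + (H - 1) * q\<close> means
  \<open>(1 - H) * q = 1 + p\<close>, and replacing \<open>q\<close> by an upper bound
  \<open>M\<close> gives \<open>M H \<le> M - 1\<close> in the order, against
  \<open>norm H = 1\<close>.\<close>

lemma exists_total_preordering:
  assumes H: "H \<in> cone" "norm H = 1"
  obtains Q where "preordering Q" "H - 1 \<in> Q" "\<And>x. x \<in> R \<Longrightarrow> x \<in> Q \<or> - x \<in> Q"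
proof -
  have HR: "H \<in> R" using H cone_R by simp
  let ?Q0 = "adjoin cone (H - 1)"
  have HR1: "H - 1 \<in> R" using HR by (simp add: R_closed)
  have cl: "cone \<subseteq> cone" "cone \<subseteq> R" "\<And>x y. x \<in> cone \<Longrightarrow> y \<in> cone \<Longrightarrow> x + y \<in> cone \<and> x * y \<in> cone"
    using cone_add cone_mult cone_R by auto
  note a = adjoin_closed[OF cl HR1]
  have "- 1 \<notin> ?Q0"
  proof
    assume "- 1 \<in> ?Q0"
    then obtain p q where pq: "- 1 = p + (H - 1) * q" "p \<in> cone" "q \<in> cone" by (auto simp: adjoin_def)
    \<comment> \<open>Any bound for \<open>q\<close> above 1 serves; \<open>M > 1\<close> makes the
      norm of the scalar \<open>M - 1\<close> equal to \<open>M - 1\<close>.\<close>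
    define M where "M = norm q + 2"
    have M: "M > 1" "norm q \<le> M" using norm_ge_zero[of q] by (simp_all add: M_def del: norm_ge_zero)
    have "(of_real M - q) * (of_real 1 - H) \<in> cone"
      using pq H M cone_R HR by (intro cone_mult norm_le_imp_cone) auto
    from cone_add[OF this pq(2)] have c: "(of_real M - q) * (1 - H) + p \<in> cone" by simp
    have "(1 - H) * q = p - (p + (H - 1) * q)" by (simp add: algebra_simps)
    then have "(1 - H) * q = 1 + p" unfolding pq(1)[symmetric] by simp
    moreover have "(1 - H) * q = q * (1 - H)" using pq(3) HR by (intro comm R_sub R_diff R_one) (auto dest: cone_R)
    ultimately have "(of_real M - q) * (1 - H) + p = of_real (M - 1) - M *\<^sub>R H"
      by (simp add: algebra_simps of_real_def)
    with c have c2: "of_real (M - 1) - M *\<^sub>R H \<in> cone" by simp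
    have c3: "M *\<^sub>R H \<in> cone" using cone_mult[OF cone_of_real[of M] H(1)] M by (simp add: scaleR_conv_of_real)
    from cone_norm_mono[OF c3 c2] have "norm (M *\<^sub>R H) \<le> norm (of_real (M - 1) :: 'a)" by simp
    then show False using M H by (simp del: of_real_diff)
  qed
  with a have pre: "preordering ?Q0" by (auto simp: preordering_def)
  define F where "F = {Q. preordering Q \<and> ?Q0 \<subseteq> Q}"
  have "\<exists>M\<in>F. \<forall>X\<in>F. M \<subseteq> X \<longrightarrow> X = M"
  proof (rule subset_Zorn_nonempty)
    show "F \<noteq> {}" using pre by (auto simp: F_def)
    fix C assume C: "C \<noteq> {}" "subset.chain F C"
    have "\<exists>Q\<in>C. x \<in> Q \<and> y \<in> Q" if xy: "x \<in> \<Union> C" "y \<in> \<Union> C" for x y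
    proof -
      obtain X Y where XY: "X \<in> C" "Y \<in> C" "x \<in> X" "y \<in> Y" using xy by blast
      then have "X \<subseteq> Y \<or> Y \<subseteq> X" using C(2) by (auto simp: subset_chain_def)
      with XY show ?thesis by blast
    qed
    note dir = this
    have all: "\<And>Q. Q \<in> C \<Longrightarrow> preordering Q \<and> ?Q0 \<subseteq> Q"
      using C(2) by (auto simp: subset_chain_def F_def)
    have "preordering (\<Union> C)"
      unfolding preordering_def
    proof (intro conjI ballI)
      fix x y assume "x \<in> \<Union> C" "y \<in> \<Union> C"
      then obtain X where "X \<in> C" "x \<in> X" "y \<in> X" using dir by blast
      with all[of X] have "x + y \<in> X" "x * y \<in> X" by (auto simp: preordering_def)
      with \<open>X \<in> C\<close> show "x + y \<in> \<Union> C" "x * y \<in> \<Union> C" by auto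
    qed (use C(1) all in \<open>unfold preordering_def, blast+\<close>)
    with C(1) all show "\<Union> C \<in> F" by (auto simp: F_def)
  qed
  then obtain Q where Q: "preordering Q" "?Q0 \<subseteq> Q" "\<And>X. preordering X \<Longrightarrow> Q \<subseteq> X \<Longrightarrow> X = Q"
    by (auto simp: F_def)
  show ?thesis
  proof
    show "H - 1 \<in> Q" using Q(2) a(3) by blast
  qed (use Q maximal_preordering_total in auto)
qed

end

lemma cscale_eq_Re_Im: "cscale a x = Re a *\<^sub>R x + cscale \<i> (Im a *\<^sub>R (x::'a::cstar_algebra))"
  by (metis cscale_add_left cscale_cscale cscale_of_real complex_eq)

section \<open>Characters from total preorderings\<close>

locale total_preordering = unital_abelian +
  fixes Q
  assumes preordering: "preordering Q" and total: "\<And>x. x \<in> R \<Longrightarrow> x \<in> Q \<or> - x \<in> Q"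
begin

lemmas Q = preorderingD[OF preordering]
lemmas Q_closed = Q(4,5,7,8)

lemma negative_notin: 
  assumes "r < 0" shows "of_real r \<notin> Q"
proof
  assume "of_real r \<in> Q"
  then have "(- 1 / r) *\<^sub>R of_real r \<in> Q" by (rule Q(8)) (use assms in \<open>simp add: field_simps\<close>)
  moreover have "(- 1 / r) *\<^sub>R of_real r = (- 1 :: 'a)" using assms by (simp add: of_real_def)
  ultimately show False using Q(6) by simp
qed

text \<open>\<open>Q\<close> is not assumed to be closed, so the value \<open>c\<close> of
  \<open>x\<close> is pinned down only up to every positive slack \<open>e\<close>.\<close>

definition cut :: "'a \<Rightarrow> real \<Rightarrow> bool" where
  "cut x c \<longleftrightarrow> (\<forall>e>0. of_real (c + e) - x \<in> Q \<and> x - of_real (c - e) \<in> Q)"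

text \<open>\<open>c\<close> is the infimum of the reals above \<open>x\<close>. It is finite
  because \<open>x\<close> is bounded by its norm in the order of \<open>cone\<close>, and totality
  turns the failure of an upper bound into a lower bound.\<close>

lemma cut_exists: assumes x: "x \<in> R" shows "\<exists>c. cut x c"
proof -
  define A where "A = {r. of_real r - x \<in> Q}"
  have mono: "s \<in> A" if "r \<in> A" "r \<le> s" for r s
  proof -
    have "of_real (s - r) + (of_real r - x) \<in> Q" using that by (intro Q_closed) (auto simp: A_def simp del: of_real_diff)
    then show ?thesis by (simp add: A_def)
  qed
  have ne: "norm x \<in> A" using norm_le_imp_cone[OF x, of "norm x"] by (simp add: A_def Q)
  have lower: "- norm x \<le> r" if "r \<in> A" for r
  proof (rule ccontr)
    assume "\<not> ?thesis"
    have "of_real (norm x) - (- x) \<in> Q" using norm_le_imp_cone[of "- x" "norm x"] x by (simp add: Q R_minus)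
    moreover have "of_real r - x \<in> Q" using that by (simp add: A_def)
    ultimately have "(of_real (norm x) - (- x)) + (of_real r - x) \<in> Q" by (rule Q)
    then have "of_real (norm x + r) \<in> Q" by simp
    with negative_notin[of "norm x + r"] \<open>\<not> ?thesis\<close> show False by simp
  qed
  then have bdd: "bdd_below A" by (rule bdd_belowI)
  have "cut x (Inf A)"
    unfolding cut_def
  proof (intro allI impI conjI)
    fix e :: real assume "0 < e"
    then obtain r where "r \<in> A" "r < Inf A + e"
      using cInf_lessD[of A "Inf A + e"] ne by auto
    then show "of_real (Inf A + e) - x \<in> Q" using mono[of r "Inf A + e"] by (simp add: A_def)
    show "x - of_real (Inf A - e) \<in> Q"
    proof (rule ccontr)
      assume "x - of_real (Inf A - e) \<notin> Q"
      then have "- (x - of_real (Inf A - e)) \<in> Q" using total x R_diff R_of_real by blast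
      then have "Inf A - e \<in> A" by (simp add: A_def)
      from cInf_lower[OF this bdd] \<open>0 < e\<close> show False by simp
    qed
  qed
  then show ?thesis ..
qed

lemma cut_le: assumes "cut x c" "cut x d" shows "d \<le> c"
proof (rule ccontr)
  assume n: "\<not> d \<le> c"
  define e where "e = (d - c) / 4"
  have "0 < e" using n by (simp add: e_def)
  then have "(of_real (c + e) - x) + (x - of_real (d - e)) \<in> Q" using assms by (intro Q_closed) (auto simp: cut_def)
  moreover have "(of_real a - x) + (x - of_real b) = of_real (a - b)" for a b by simp
  ultimately have "of_real (c + e - (d - e)) \<in> Q" by (simp only:)
  with negative_notin[of "c + e - (d - e)"] n show False by (simp add: e_def field_simps)
qed

definition val where "val x = (THE c. cut x c)"

lemma val_eqI: "cut x c \<Longrightarrow> val x = c"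
  unfolding val_def by (rule the_equality) (use cut_le in \<open>auto intro: antisym\<close>)

lemma cut_val: "x \<in> R \<Longrightarrow> cut x (val x)"
  using cut_exists val_eqI by metis

lemma cut_add: assumes "cut x c" "cut y d" shows "cut (x + y) (c + d)"
  unfolding cut_def
proof (intro allI impI conjI)
  fix e :: real assume "0 < e"
  then have *: "of_real (c + e/2) - x \<in> Q" "x - of_real (c - e/2) \<in> Q" "of_real (d + e/2) - y \<in> Q" "y - of_real (d - e/2) \<in> Q"
    using assms by (auto simp: cut_def simp del: of_real_add of_real_diff)
  have sum: "(of_real a - x) + (of_real b - y) = of_real (a + b) - (x + y)"
    "(x - of_real a) + (y - of_real b) = (x + y) - of_real (a + b)" for a b
    by simp_all
  have "of_real (c + e/2) - x + (of_real (d + e/2) - y) = of_real ((c + e/2) + (d + e/2)) - (x + y)"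
    by (rule sum)
  also have "(c + e/2) + (d + e/2) = c + d + e" by simp
  finally show "of_real (c + d + e) - (x + y) \<in> Q" using Q(4)[OF *(1,3)] by (simp only:)
  have "x - of_real (c - e/2) + (y - of_real (d - e/2)) = (x + y) - of_real ((c - e/2) + (d - e/2))"
    by (rule sum)
  also have "(c - e/2) + (d - e/2) = c + d - e" by simp
  finally show "x + y - of_real (c + d - e) \<in> Q" using Q(4)[OF *(2,4)] by (simp only:)
qed

lemma cut_minus: "cut x c \<Longrightarrow> cut (- x) (- c)"
  unfolding cut_def by (simp add: algebra_simps)

lemma cut_of_real: "cut (of_real r) r"
  unfolding cut_def using Q(7) by (auto simp flip: of_real_diff simp del: of_real_add)

lemma cut_scaleR_pos: 
  assumes "cut x c" "0 < r" shows "cut (r *\<^sub>R x) (r * c)"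
  unfolding cut_def
proof (intro allI impI conjI)
  fix e :: real assume "0 < e"
  then have "0 < e / r" using assms by simp
  then have "r *\<^sub>R (of_real (c + e / r) - x) \<in> Q" "r *\<^sub>R (x - of_real (c - e / r)) \<in> Q"
    using assms by (auto simp: cut_def intro!: Q_closed simp del: of_real_add of_real_diff)
  moreover have "r *\<^sub>R (of_real (c + e / r) - x) = of_real (r * c + e) - r *\<^sub>R x"
    "r *\<^sub>R (x - of_real (c - e / r)) = r *\<^sub>R x - of_real (r * c - e)"
    using assms by (simp_all add: of_real_def scaleR_diff_right distrib_left right_diff_distrib)
  ultimately show "of_real (r * c + e) - r *\<^sub>R x \<in> Q" "r *\<^sub>R x - of_real (r * c - e) \<in> Q" by simp_all
qed

lemma cut_scaleR: assumes "cut x c" shows "cut (r *\<^sub>R x) (r * c)"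
proof -
  consider "0 < r" | "r = 0" | "0 < - r" by linarith
  then show ?thesis
  proof cases
    case 2 then show ?thesis using cut_of_real[of 0] by simp
  next
    case 3 then show ?thesis using cut_scaleR_pos[OF cut_minus[OF assms] 3] by simp
  qed (use cut_scaleR_pos assms in auto)
qed

text \<open>Subtracting \<open>c\<close> reduces to value 0, where
  \<open>(d - y) * (d + y) = d * d - y * y\<close> bounds the square from above and
  \<open>cone_square\<close> bounds it from below. Multiplicativity of \<open>val\<close> follows by
  polarization.\<close>

lemma cut_square: assumes x: "x \<in> R" and c: "cut x c" shows "cut (x * x) (c * c)"
proof -
  define y where "y = x - of_real c"
  have y: "y \<in> R" using x by (simp add: y_def R_closed)
  have cy: "cut y 0" using cut_add[OF c cut_of_real[of "- c"]] by (simp add: y_def)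
  have "cut (y * y) 0"
    unfolding cut_def
  proof (intro allI impI conjI)
    fix e :: real assume "0 < e"
    define d where "d = sqrt e"
    have "0 < d" "d * d = e" using \<open>0 < e\<close> by (auto simp: d_def)
    then have "(of_real (0 + d) - y) * (y - of_real (0 - d)) \<in> Q" using cy unfolding cut_def by (intro Q_closed) blast+
    also have "(of_real (0 + d) - y) * (y - of_real (0 - d)) = of_real (d * d) - y * y"
      by (simp add: of_real_def algebra_simps)
    finally show "of_real (0 + e) - y * y \<in> Q" using \<open>d * d = e\<close> by simp
    have "y * y + of_real e \<in> Q" using \<open>0 < e\<close> by (intro Q_closed Q(1)[OF cone_square[OF y]]) simp
    then show "y * y - of_real (0 - e) \<in> Q" by simp
  qed
  note cyy = this
  have two: "(c * 2) *\<^sub>R x = c *\<^sub>R x + c *\<^sub>R x" by (metis mult_2_right scaleR_add_left)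
  from cut_add[OF cut_add[OF cyy cut_scaleR[OF c, of "2 * c"]] cut_of_real[of "- c * c"]]
  have "cut (y * y + (2 * c) *\<^sub>R x + of_real (- c * c)) (c * c)" by simp
  also have "y * y + (2 * c) *\<^sub>R x + of_real (- c * c) = x * x"
    by (simp add: y_def of_real_def algebra_simps two)
  finally show ?thesis .
qed

lemma val_add: "x \<in> R \<Longrightarrow> y \<in> R \<Longrightarrow> val (x + y) = val x + val y"
  by (intro val_eqI cut_add cut_val)

lemma val_scaleR: "x \<in> R \<Longrightarrow> val (r *\<^sub>R x) = r * val x"
  by (intro val_eqI cut_scaleR cut_val)

lemma val_diff: "x \<in> R \<Longrightarrow> y \<in> R \<Longrightarrow> val (x - y) = val x - val y"
  using val_add[of x "(-1) *\<^sub>R y"] val_scaleR[of y "-1"] by (simp add: R_minus)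

lemma val_minus: "x \<in> R \<Longrightarrow> val (- x) = - val x"
  using val_scaleR[of x "-1"] by simp

lemma val_mult: assumes x: "x \<in> R" and y: "y \<in> R" shows "val (x * y) = val x * val y"
proof -
  have "x * y + x * y = (x + y) * (x + y) - (x * x + y * y)"
    using comm[OF R_sub[OF x] R_sub[OF y]] by (simp add: algebra_simps)
  then have "val (x * y) + val (x * y) = val ((x + y) * (x + y)) - (val (x * x) + val (y * y))"
    using val_add[of "x * y" "x * y"] val_diff[of "(x + y) * (x + y)" "x * x + y * y"]
      val_add[of "x * x" "y * y"] x y by (simp add: R_closed)
  also have "\<dots> = (val x + val y) * (val x + val y) - (val x * val x + val y * val y)"
    using val_eqI[OF cut_square[OF _ cut_val]] x y by (simp add: R_closed val_add)
  finally show ?thesis by (simp add: algebra_simps)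
qed

lemma val_nonneg: assumes "x \<in> Q" shows "0 \<le> val x"
proof (rule ccontr)
  assume n: "\<not> 0 \<le> val x"
  have c: "cut x (val x)" using assms by (intro cut_val Q(2))
  have "0 < (- val x) / 2" using n by simp
  then have "of_real (val x + (- val x) / 2) - x \<in> Q" using c unfolding cut_def by blast
  from Q(4)[OF this assms] have "of_real (val x + (- val x) / 2) \<in> Q" by simp
  with negative_notin[of "val x + (- val x) / 2"] n show False by (simp add: field_simps)
qed

definition chr where "chr z = Complex (val ((1/2) *\<^sub>R (z + adj z))) (val (cscale (-\<i>/2) (z - adj z)))"

lemma chr_eq: assumes "p \<in> R" "q \<in> R" shows "chr (p + cscale \<i> q) = Complex (val p) (val q)"
proof -
  have m: "cscale (- \<i>) x = - cscale \<i> x" for x :: 'a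
    using cscale_cscale[of "-1" \<i> x] by (simp add: cscale_minus_one)
  have a: "adj (p + cscale \<i> q) = p - cscale \<i> q" using assms by (simp add: adj_add adj_cscale R_adj m)
  have 1: "(1/2) *\<^sub>R (p + cscale \<i> q + adj (p + cscale \<i> q)) = p"
  proof -
    have "p + cscale \<i> q + (p - cscale \<i> q) = 2 *\<^sub>R p" by (simp add: scaleR_2)
    then show ?thesis unfolding a by simp
  qed
  have "p + cscale \<i> q - adj (p + cscale \<i> q) = 2 *\<^sub>R cscale \<i> q" unfolding a by (simp add: scaleR_2)
  also have "\<dots> = cscale (2 * \<i>) q" using cscale_of_real[of 2 "cscale \<i> q"] by (simp add: cscale_cscale)
  finally have 2: "cscale (-\<i>/2) (p + cscale \<i> q - adj (p + cscale \<i> q)) = q"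
    by (simp add: cscale_cscale cscale_one)
  show ?thesis unfolding chr_def 1 2 ..
qed

lemma R_parts: assumes "z \<in> S" obtains p q where "p \<in> R" "q \<in> R" "z = p + cscale \<i> q"
proof -
  obtain p q where *: "adj p = p" "adj q = q" "z = p + cscale \<i> q"
    "p = (1/2) *\<^sub>R (z + adj z)" "q = cscale (-\<i>/2) (z - adj z)" by (rule cscale_ii_parts[of z])
  have "p \<in> S" "q \<in> S" using assms by (simp_all add: *(4,5) S)
  then have "p \<in> R" "q \<in> R" using *(1,2) by (simp_all add: R_def)
  then show ?thesis using *(3) by (rule that)
qed

lemma is_char_chr: "is_char S chr"
  unfolding is_char_def
proof (intro conjI ballI allI)
  fix z w assume "z \<in> S" "w \<in> S"
  obtain p q where z: "p \<in> R" "q \<in> R" "z = p + cscale \<i> q" using R_parts[OF \<open>z \<in> S\<close>] .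
  obtain p' q' where w: "p' \<in> R" "q' \<in> R" "w = p' + cscale \<i> q'" using R_parts[OF \<open>w \<in> S\<close>] .
  have "z + w = (p + p') + cscale \<i> (q + q')" by (simp add: z w cscale_add_right)
  then have "chr (z + w) = Complex (val (p + p')) (val (q + q'))"
    using z w chr_eq by (simp only: R_closed)
  then show "chr (z + w) = chr z + chr w"
    using z w by (simp add: chr_eq val_add complex_eq_iff)
  have "z * w = (p * p' - q * q') + cscale \<i> (p * q' + q * p')"
    by (simp add: z w algebra_simps cscale_mult_left cscale_mult_right cscale_cscale cscale_add_right cscale_minus_one)
  then have "chr (z * w) = Complex (val (p * p' - q * q')) (val (p * q' + q * p'))"
    using z w chr_eq by (simp only: R_closed)
  then show "chr (z * w) = chr z * chr w"
    using z w by (simp add: chr_eq R_closed val_add val_diff val_mult complex_eq_iff)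
next
  fix a z assume "z \<in> S"
  obtain p q where z: "p \<in> R" "q \<in> R" "z = p + cscale \<i> q" using R_parts[OF \<open>z \<in> S\<close>] .
  have "cscale a z = cscale a p + cscale \<i> (cscale a q)"
    by (simp add: z cscale_add_right cscale_cscale mult.commute)
  also have "\<dots> = (Re a *\<^sub>R p - Im a *\<^sub>R q) + cscale \<i> (Re a *\<^sub>R q + Im a *\<^sub>R p)"
    unfolding cscale_eq_Re_Im[of a] by (simp add: cscale_add_right cscale_cscale cscale_minus_one)
  finally have "chr (cscale a z) = Complex (val (Re a *\<^sub>R p - Im a *\<^sub>R q)) (val (Re a *\<^sub>R q + Im a *\<^sub>R p))"
    using z chr_eq by (simp only: R_closed)
  then show "chr (cscale a z) = a * chr z"
    using z by (simp add: chr_eq R_closed val_add val_diff val_scaleR complex_eq_iff)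
next
  have adj: "chr (adj z) = cnj (chr z)" and norm: "cmod (chr z) \<le> norm z" if "z \<in> S" for z
  proof -
    obtain p q where z: "p \<in> R" "q \<in> R" "z = p + cscale \<i> q" using R_parts[OF \<open>z \<in> S\<close>] .
    have m: "cscale (- \<i>) x = cscale \<i> (- x)" for x :: 'a
      using cscale_cscale[of \<i> "-1" x] by (simp add: cscale_minus_one)
    have a: "adj z = p + cscale \<i> (- q)" using z by (simp add: adj_add adj_cscale R_adj m)
    then show "chr (adj z) = cnj (chr z)"
      using z by (simp add: chr_eq R_closed val_minus complex_eq_iff)
    let ?n = "norm z * norm z"
    have aR: "p * p + q * q \<in> R" using z by (simp add: R_closed)
    have "adj z * z = p * p + q * q" unfolding a using comm[OF R_sub[OF z(1)] R_sub[OF z(2)]]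
      by (simp add: z(3) algebra_simps cscale_mult_left cscale_mult_right cscale_cscale cscale_add_right
          cscale_diff_right cscale_minus_one cscale_minus_right)
    then have "norm (p * p + q * q) = ?n" using cstar_identity[of z] by (simp add: power2_eq_square)
    then have "of_real ?n - (p * p + q * q) \<in> Q" using norm_le_imp_cone[OF aR, of ?n] by (auto intro: Q)
    from val_nonneg[OF this] have "val p * val p + val q * val q \<le> ?n"
      using z val_eqI[OF cut_of_real[of ?n]] by (simp add: val_diff val_add val_mult R_closed del: of_real_mult)
    moreover have "(cmod (chr z))\<^sup>2 = val p * val p + val q * val q"
      unfolding z(3) chr_eq[OF z(1,2)] cmod_power2 by (simp add: power2_eq_square)
    ultimately have "(cmod (chr z))\<^sup>2 \<le> (norm z)\<^sup>2" by (simp only: power2_eq_square)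
    then show "cmod (chr z) \<le> norm z" by (rule power2_le_imp_le) simp
  qed
  show "\<And>z. z \<in> S \<Longrightarrow> chr (adj z) = cnj (chr z)" "\<And>z. z \<in> S \<Longrightarrow> cmod (chr z) \<le> norm z" by (fact adj norm)+
  have "val 1 = 1" "val 0 = 0" using val_eqI[OF cut_of_real[of 1]] val_eqI[OF cut_of_real[of 0]] by simp_all
  then show "chr 1 = 1" using chr_eq[of 1 0] by (simp add: R_closed complex_eq_iff)
qed

lemma chr_R: "p \<in> R \<Longrightarrow> chr p = of_real (val p)"
  using chr_eq[of p 0] val_eqI[OF cut_of_real[of 0]] by (simp add: R_closed complex_eq_iff)

end

context unital_abelian
begin

lemma char_cone:
  assumes "H \<in> cone" "norm H = 1"
  obtains \<phi> where "is_char S \<phi>" "1 \<le> cmod (\<phi> H)"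
proof -
  obtain P where P: "preordering P" "H - 1 \<in> P" "\<And>x. x \<in> R \<Longrightarrow> x \<in> P \<or> - x \<in> P"
    using exists_total_preordering[OF assms] by blast
  interpret total_preordering S P by unfold_locales (use P in auto)
  have HR: "H \<in> R" using assms cone_R by simp
  have "0 \<le> val H - val 1" using val_nonneg[OF P(2)] HR by (simp add: val_diff R_closed)
  then have "1 \<le> cmod (chr H)" using val_eqI[OF cut_of_real[of 1]] HR by (simp add: chr_R)
  with is_char_chr that show ?thesis by blast
qed

text \<open>This is the isometry of the Gelfand transform. For \<open>k = h / norm h\<close> the
  element \<open>adj k * k\<close> lies in \<open>cone\<close> and has norm 1, so some character is
  at least 1 there, that is, has modulus at least 1 at \<open>k\<close>.\<close>

theorem exists_char_norm:
  assumes h: "h \<in> S"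
  obtains \<phi> where "is_char S \<phi>" "cmod (\<phi> h) = norm h"
proof (cases "h = 0")
  case True
  obtain \<phi> where \<phi>: "is_char S \<phi>" using char_cone[of 1] cone_of_real[of 1] by auto
  then have "\<phi> (cscale 0 h) = 0 * \<phi> h" using h unfolding is_char_def by blast
  with \<phi> that[of \<phi>] True show ?thesis by simp
next
  case False
  obtain p q where z: "adj p = p" "adj q = q" "h = p + cscale \<i> q"
    "p = (1/2) *\<^sub>R (h + adj h)" "q = cscale (-\<i>/2) (h - adj h)" by (rule cscale_ii_parts[of h])
  have "p \<in> S" "q \<in> S" using h by (simp_all add: z(4,5) S)
  then have pq: "p \<in> R" "q \<in> R" using z(1,2) by (simp_all add: R_def)
  define k where "k = (1 / norm h) *\<^sub>R h"
  have k: "k \<in> S" "norm k = 1" using h False by (auto simp: k_def S)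
  have "adj h * h = p * p + q * q"
  proof -
    have m: "cscale (- \<i>) x = cscale \<i> (- x)" for x :: 'a
      using cscale_cscale[of \<i> "-1" x] by (simp add: cscale_minus_one)
    have a: "adj h = p + cscale \<i> (- q)" unfolding z(3) using z(1,2) by (simp add: adj_add adj_cscale m)
    show ?thesis unfolding a using comm[OF R_sub[OF pq(1)] R_sub[OF pq(2)]]
      by (simp add: z(3) algebra_simps cscale_mult_left cscale_mult_right cscale_cscale cscale_add_right
          cscale_diff_right cscale_minus_one cscale_minus_right)
  qed
  then have "adj h * h \<in> cone" using pq by (simp add: cone_add cone_square)
  moreover have "adj k * k = of_real (1 / norm h * (1 / norm h)) * (adj h * h)"
    by (simp add: k_def adj_scaleR of_real_def)
  ultimately have "adj k * k \<in> cone"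
    using cone_mult cone_of_real[of "1 / norm h * (1 / norm h)"] by simp
  moreover have "norm (adj k * k) = 1" using k by (simp add: cstar_identity)
  ultimately obtain \<phi> where \<phi>: "is_char S \<phi>" "1 \<le> cmod (\<phi> (adj k * k))" by (rule char_cone)
  have "cmod (\<phi> (adj k * k)) = (cmod (\<phi> k))\<^sup>2"
    using \<phi>(1) k S(4)[OF k(1)] by (simp add: is_char_def norm_mult power2_eq_square)
  then have "1 \<le> cmod (\<phi> k)" using \<phi>(2) power2_le_imp_le[of 1 "cmod (\<phi> k)"] by simp
  moreover have "\<phi> h = norm h * \<phi> k"
  proof -
    have "h = cscale (norm h) k" using False by (simp add: k_def cscale_of_real)
    then show ?thesis using \<phi>(1) k unfolding is_char_def by metis
  qed
  ultimately have "norm h \<le> cmod (\<phi> h)" using mult_left_mono[of 1 "cmod (\<phi> k)" "norm h"] by (simp add: norm_mult)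
  moreover have "cmod (\<phi> h) \<le> norm h" using \<phi>(1) h by (simp add: is_char_def)
  ultimately show ?thesis using \<phi>(1) that[of \<phi>] by simp
qed

lemma norm_le_char: "y \<in> S \<Longrightarrow> (\<And>\<phi>. is_char S \<phi> \<Longrightarrow> cmod (\<phi> y) \<le> e) \<Longrightarrow> norm y \<le> e"
  using exists_char_norm by metis

end

section \<open>Functional calculus and positivity\<close>

definition peval :: "(nat \<Rightarrow> real) \<Rightarrow> nat \<Rightarrow> 'a::real_algebra_1 \<Rightarrow> 'a" where
  "peval a n x = (\<Sum>i\<le>n. a i *\<^sub>R x ^ i)"

lemma peval_approx:
  fixes f :: "real \<Rightarrow> real"
  assumes "continuous_on UNIV f" "0 < e"
  obtains a n where "\<And>t. \<bar>t\<bar> \<le> M \<Longrightarrow> \<bar>f t - peval a n t\<bar> < e"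
proof -
  obtain g where g: "real_polynomial_function g" "\<And>t. t \<in> {-M..M} \<Longrightarrow> \<bar>f t - g t\<bar> < e"
    using Stone_Weierstrass_real_polynomial_function[of "{-M..M}" f e] assms continuous_on_subset by blast
  then obtain a n where "g = (\<lambda>x. \<Sum>i\<le>n. a i * x ^ i)" using real_polynomial_function_iff_sum by auto
  with g(2) that[of a n] show ?thesis by (simp add: peval_def abs_le_iff)
qed

lemma unital_abelian_gen:
  fixes h :: "'a::{cstar_algebra,real_normed_algebra_1}"
  assumes "adj h = h"
  shows "unital_abelian (cstar_gen {1, h})"
proof
  show "abelian (cstar_gen {1, h})" by (rule abelian_cstar_gen) (use assms in auto)
  show "1 \<in> cstar_gen {1, h}" using cstar_gen_superset by blast
qed (rule cstar_subalgebra_gen)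

context unital_abelian
begin

lemma charD:
  assumes "is_char S \<phi>"
  shows "x \<in> S \<Longrightarrow> y \<in> S \<Longrightarrow> \<phi> (x + y) = \<phi> x + \<phi> y" "x \<in> S \<Longrightarrow> y \<in> S \<Longrightarrow> \<phi> (x * y) = \<phi> x * \<phi> y"
    "x \<in> S \<Longrightarrow> \<phi> (cscale a x) = a * \<phi> x" "x \<in> S \<Longrightarrow> \<phi> (adj x) = cnj (\<phi> x)" "\<phi> 1 = 1"
    "x \<in> S \<Longrightarrow> cmod (\<phi> x) \<le> norm x" "x \<in> S \<Longrightarrow> \<phi> (r *\<^sub>R x) = of_real r * \<phi> x" "\<phi> 0 = 0"
    "x \<in> S \<Longrightarrow> \<phi> (- x) = - \<phi> x" "x \<in> S \<Longrightarrow> y \<in> S \<Longrightarrow> \<phi> (x - y) = \<phi> x - \<phi> y"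
    "\<phi> (of_real r) = of_real r"
proof -
  show add: "\<And>x y. x \<in> S \<Longrightarrow> y \<in> S \<Longrightarrow> \<phi> (x + y) = \<phi> x + \<phi> y"
    and "x \<in> S \<Longrightarrow> y \<in> S \<Longrightarrow> \<phi> (x * y) = \<phi> x * \<phi> y"
    and sc: "\<And>a x. x \<in> S \<Longrightarrow> \<phi> (cscale a x) = a * \<phi> x" and "x \<in> S \<Longrightarrow> \<phi> (adj x) = cnj (\<phi> x)"
    and one': "\<phi> 1 = 1" and "x \<in> S \<Longrightarrow> cmod (\<phi> x) \<le> norm x"
    using assms by (simp_all add: is_char_def)
  show scR: "\<phi> (r *\<^sub>R x) = of_real r * \<phi> x" if "x \<in> S" for r x
    using sc[OF that, of "of_real r"] by (simp add: cscale_of_real)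
  show "\<phi> 0 = 0" using scR[OF one, of 0] by simp
  show m: "\<phi> (- x) = - \<phi> x" if "x \<in> S" for x using scR[OF that, of "-1"] by simp
  show "x \<in> S \<Longrightarrow> y \<in> S \<Longrightarrow> \<phi> (x - y) = \<phi> x - \<phi> y" using add[of x "- y"] m[of y] S(8)[of y] by simp
  show "\<phi> (of_real r) = of_real r" using scR[OF one, of r] one' by (simp add: of_real_def)
qed

lemma char_real: "is_char S \<phi> \<Longrightarrow> x \<in> R \<Longrightarrow> \<phi> x = of_real (Re (\<phi> x))"
  using charD(4)[of \<phi> x] R_adj[of x] R_sub[of x] by (simp add: complex_eq_iff)

lemma char_real_le: "is_char S \<phi> \<Longrightarrow> x \<in> R \<Longrightarrow> \<bar>Re (\<phi> x)\<bar> \<le> norm x"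
  using charD(6)[of \<phi> x] R_sub[of x] abs_Re_le_cmod[of "\<phi> x"] by simp

lemma R_power: "x \<in> R \<Longrightarrow> x ^ n \<in> R"
  by (induction n) (auto intro: R_closed)

lemma peval_R: "x \<in> R \<Longrightarrow> peval a n x \<in> R"
proof -
  assume x: "x \<in> R"
  have "sum f A \<in> R" if "\<And>i. f i \<in> R" for f :: "nat \<Rightarrow> 'a" and A
    by (induction A rule: infinite_finite_induct) (auto simp: that intro: R_closed)
  note sum_R = this
  show ?thesis unfolding peval_def by (intro sum_R R_scaleR R_power x)
qed

lemma char_peval: 
  assumes \<phi>: "is_char S \<phi>" and x: "x \<in> R"
  shows "\<phi> (peval a n x) = of_real (peval a n (Re (\<phi> x)))"
proof -
  have pow: "\<phi> (x ^ i) = of_real (Re (\<phi> x) ^ i)" for i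
  proof (induction i)
    case (Suc i)
    then show ?case using charD(2)[OF \<phi> R_sub[OF x] R_sub[OF R_power[OF x]], of i] char_real[OF \<phi> x] by simp
  qed (simp add: charD[OF \<phi>])
  show ?thesis
  proof (induction n)
    case 0
    show ?case using charD(7)[OF \<phi> one] by (simp add: peval_def charD[OF \<phi>])
  next
    case (Suc n)
    have "\<phi> (peval a (Suc n) x) = \<phi> (peval a n x) + \<phi> (a (Suc n) *\<^sub>R x ^ Suc n)"
      unfolding peval_def sum.atMost_Suc
      by (rule charD(1)[OF \<phi>]) (use peval_R[OF x, of a n] R_power[OF x, of "Suc n"] in \<open>auto simp: peval_def R_sub S\<close>)
    also have "\<phi> (a (Suc n) *\<^sub>R x ^ Suc n) = of_real (a (Suc n)) * of_real (Re (\<phi> x) ^ Suc n)"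
      using charD(7)[OF \<phi> R_sub[OF R_power[OF x]], of "a (Suc n)" "Suc n"] pow[of "Suc n"] by simp
    finally show ?case using Suc by (simp add: peval_def)
  qed
qed

lemma char_eqI:
  assumes "x \<in> S" "y \<in> S" "\<And>\<phi>. is_char S \<phi> \<Longrightarrow> \<phi> x = \<phi> y"
  shows "x = y"
proof -
  have "norm (x - y) \<le> 0" using assms by (intro norm_le_char) (auto simp: charD S)
  then show ?thesis by simp
qed

lemma norm_peval_diff_le:
  assumes "y \<in> S" "x \<in> R" "\<And>\<phi>. is_char S \<phi> \<Longrightarrow> cmod (\<phi> y - of_real (peval a n (Re (\<phi> x)))) \<le> e"
  shows "norm (y - peval a n x) \<le> e"
  using assms by (intro norm_le_char) (auto simp: charD char_peval peval_R R_sub S)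

text \<open>Weierstrass polynomials for \<open>f\<close> on \<open>[- norm x, norm x]\<close>,
  evaluated at \<open>x\<close>, form a Cauchy sequence because the norm is detected by characters.
  The result is described by its character values, which determine it.\<close>

lemma functional_calculus:
  assumes f: "continuous_on UNIV f" and x: "x \<in> R"
  obtains y where "y \<in> R" "\<And>\<phi>. is_char S \<phi> \<Longrightarrow> \<phi> y = of_real (f (Re (\<phi> x)))"
proof -
  have "\<forall>n::nat. \<exists>a N. \<forall>t. \<bar>t\<bar> \<le> norm x \<longrightarrow> \<bar>f t - peval a N t\<bar> < 1 / Suc n"
  proof
    fix n :: nat
    obtain a N where "\<And>t. \<bar>t\<bar> \<le> norm x \<Longrightarrow> \<bar>f t - peval a N t\<bar> < 1 / Suc n"
      by (rule peval_approx[OF f, of "1 / Suc n" "norm x"]) auto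
    then show "\<exists>a N. \<forall>t. \<bar>t\<bar> \<le> norm x \<longrightarrow> \<bar>f t - peval a N t\<bar> < 1 / Suc n" by blast
  qed
  then obtain a N where aN: "\<And>n t. \<bar>t\<bar> \<le> norm x \<Longrightarrow> \<bar>f t - peval (a n) (N n) t\<bar> < 1 / Suc n" by metis
  define Y where "Y n = peval (a n) (N n) x" for n
  have YR: "Y n \<in> R" for n by (simp add: Y_def peval_R x)
  have \<phi>Y: "cmod (\<phi> (Y n) - of_real (f (Re (\<phi> x)))) \<le> 1 / Suc n" if \<phi>: "is_char S \<phi>" for \<phi> n
    unfolding Y_def char_peval[OF \<phi> x] of_real_diff[symmetric] norm_of_real
    using aN[OF char_real_le[OF \<phi> x], of n] by linarith
  have YY: "norm (Y m - Y n) \<le> 1 / Suc m + 1 / Suc n" for m n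
  proof (rule norm_le_char)
    fix \<phi> assume \<phi>: "is_char S \<phi>"
    have "\<phi> (Y m - Y n) = (\<phi> (Y m) - of_real (f (Re (\<phi> x)))) - (\<phi> (Y n) - of_real (f (Re (\<phi> x))))"
      using charD(10)[OF \<phi> R_sub[OF YR] R_sub[OF YR]] by simp
    also have "cmod \<dots> \<le> 1 / Suc m + 1 / Suc n"
      by (rule order_trans[OF norm_triangle_ineq4]) (intro add_mono \<phi>Y \<phi>)
    finally show "cmod (\<phi> (Y m - Y n)) \<le> 1 / Suc m + 1 / Suc n" .
  qed (intro S(7) R_sub YR)
  have "Cauchy Y"
  proof (rule metric_CauchyI)
    fix e :: real assume "0 < e"
    then have "0 < e / 2" by simp
    then obtain K :: nat where K: "1 / Suc K < e / 2" by (rule nat_approx_posE)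
    have "dist (Y m) (Y n) < e" if "m \<ge> K" "n \<ge> K" for m n
    proof -
      have "1 / Suc m \<le> 1 / Suc K" "1 / Suc n \<le> 1 / Suc K" using that by (auto simp: frac_le)
      with YY[of m n] K show ?thesis unfolding dist_norm by linarith
    qed
    then show "\<exists>M. \<forall>m\<ge>M. \<forall>n\<ge>M. dist (Y m) (Y n) < e" by blast
  qed
  then obtain y where y: "Y \<longlonglongrightarrow> y" using Cauchy_convergent convergent_def by blast
  have yS: "y \<in> S" using closed_sequentially[OF S(2) _ y] YR R_sub by blast
  have inv: "(\<lambda>n. 1 / real (Suc n)) \<longlonglongrightarrow> 0" using LIMSEQ_inverse_real_of_nat by (simp add: inverse_eq_divide)
  have \<phi>y: "\<phi> y = of_real (f (Re (\<phi> x)))" if \<phi>: "is_char S \<phi>" for \<phi>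
  proof -
    have 1: "(\<lambda>n. norm (y - Y n) + 1 / Suc n) \<longlonglongrightarrow> 0 + 0"
    proof (rule tendsto_add[OF _ inv])
      have "(\<lambda>n. y - Y n) \<longlonglongrightarrow> 0" using tendsto_diff[OF tendsto_const y, of y] by simp
      then show "(\<lambda>n. norm (y - Y n)) \<longlonglongrightarrow> 0" by (rule tendsto_norm_zero)
    qed
    have "cmod (\<phi> y - of_real (f (Re (\<phi> x)))) \<le> norm (y - Y n) + 1 / Suc n" for n
    proof -
      have "\<phi> y - of_real (f (Re (\<phi> x))) = \<phi> (y - Y n) + (\<phi> (Y n) - of_real (f (Re (\<phi> x))))"
        using charD(10)[OF \<phi> yS R_sub[OF YR]] by simp
      also have "cmod \<dots> \<le> norm (y - Y n) + 1 / Suc n"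
        by (rule order_trans[OF norm_triangle_ineq])
          (intro add_mono \<phi>Y[OF \<phi>] charD(6)[OF \<phi>] S(7)[OF yS R_sub[OF YR]])
      finally show ?thesis .
    qed
    then have "cmod (\<phi> y - of_real (f (Re (\<phi> x)))) \<le> 0 + 0"
      by (intro LIMSEQ_le_const[OF 1] exI allI impI)
    then show ?thesis by simp
  qed
  have "adj y = y" by (rule char_eqI) (auto simp: yS S charD \<phi>y)
  with yS that \<phi>y show ?thesis by (simp add: R_def)
qed

end

section \<open>Positivity of \<open>adj w * w\<close>\<close>

lemma peval_intertwine:
  fixes p q u :: "'a::real_algebra_1"
  assumes "q * u = u * p"
  shows "peval a n q * u = u * peval a n p"
proof -
  have "q ^ i * u = u * p ^ i" for i
  proof (induction i)
    case (Suc i)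
    have "q ^ Suc i * u = q * (q ^ i * u)" by (simp add: mult.assoc)
    also have "\<dots> = (q * u) * p ^ i" by (simp add: Suc mult.assoc)
    finally show ?case by (simp add: assms mult.assoc)
  qed simp
  then show ?thesis by (simp add: peval_def sum_distrib_left sum_distrib_right)
qed

text \<open>The algebra generated by \<open>a\<close> serves only to prove the bound; the bound
  itself speaks about the ambient norm, so such bounds can be added for squares that do not
  commute.\<close>

lemma square_shift_le:
  fixes a :: "'a::{cstar_algebra,real_normed_algebra_1}"
  assumes "adj a = a"
  obtains t where "norm (of_real t - a * a) \<le> t"
proof -
  interpret unital_abelian "cstar_gen {1, a}" using assms by (rule unital_abelian_gen)
  have "a \<in> R" using assms cstar_gen_superset[of "{1, a}"] by (simp add: R_def)
  then show ?thesis using that[OF square_norm_le[of a "norm (a * a) + 1"]] by simp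
qed

context unital_abelian
begin

text \<open>If the spectrum of \<open>w\<^sup>* w\<close> had a negative part \<open>n\<close>, then \<open>u = w n\<close> would satisfy
  \<open>u\<^sup>* u = - n\<^sup>3 \<le> 0 \<le> u u\<^sup>*\<close>. Since \<open>u\<close> intertwines \<open>u u\<^sup>*\<close> with \<open>u\<^sup>* u\<close>, it also
  intertwines their absolute values, which forces \<open>u = 0\<close>.\<close>

theorem char_adj_mult_nonneg:
  assumes w: "adj w * w \<in> S" and \<phi>: "is_char S \<phi>"
  shows "0 \<le> Re (\<phi> (adj w * w))"
proof -
  define h where "h = adj w * w"
  have hR: "h \<in> R" using w by (simp add: R_def h_def adj_mult adj_adj)
  have "continuous_on UNIV (\<lambda>t::real. max 0 (- t))" by (intro continuous_intros)
  then obtain n where n: "n \<in> R" "\<And>\<psi>. is_char S \<psi> \<Longrightarrow> \<psi> n = of_real (max 0 (- Re (\<psi> h)))"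
    using functional_calculus[OF _ hR] by blast
  define u where "u = w * n"
  define p where "p = n * (n * n)"
  have pR: "p \<in> R" by (simp add: p_def R_mult n)
  have \<psi>p: "\<psi> p = of_real (max 0 (- Re (\<psi> h)) ^ 3)" if "is_char S \<psi>" for \<psi>
    using that n(1) by (simp add: p_def charD R_sub R_mult S n(2) power3_eq_cube)
  have "adj u * u = n * h * n" using n(1) by (simp add: u_def h_def adj_mult R_adj mult.assoc)
  also have "\<dots> = - p"
  proof (rule char_eqI)
    fix \<psi> assume \<psi>: "is_char S \<psi>"
    have "\<psi> (n * h * n) = \<psi> n * \<psi> h * \<psi> n" using n(1) hR \<psi> by (simp add: charD R_sub S)
    also have "\<psi> h = of_real (Re (\<psi> h))" by (rule char_real[OF \<psi> hR])
    finally show "\<psi> (n * h * n) = \<psi> (- p)"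
      using \<psi> pR by (auto simp: charD(9) R_sub \<psi>p n(2) max_def power3_eq_cube simp flip: of_real_mult)
  qed (use n hR pR in \<open>simp_all add: R_sub S\<close>)
  finally have uu: "adj u * u = - p" .
  define q where "q = u * adj u"
  have q_adj: "adj q = q" by (simp add: q_def adj_mult adj_adj)
  interpret V: unital_abelian "cstar_gen {1, q}" using q_adj by (rule unital_abelian_gen)
  have qR: "q \<in> V.R" using q_adj cstar_gen_superset[of "{1, q}"] by (simp add: V.R_def)
  obtain a b where ab: "adj a = a" "adj b = b" "u = a + cscale \<i> b" by (rule cscale_ii_parts[of u])
  have au: "adj u = a - cscale \<i> b"
    using cscale_cscale[of "-1" \<i> b] by (simp add: ab adj_add adj_cscale cscale_minus_one)
  have "adj u * u + u * adj u = (a * a + a * a) + (b * b + b * b)"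
    by (simp add: au) (simp add: ab(3) algebra_simps cscale_mult_left cscale_mult_right cscale_cscale
        cscale_minus_one cscale_diff_right cscale_add_right)
  then have q: "q = (a * a + a * a) + (b * b + b * b) + p" by (simp add: uu flip: q_def) (simp add: algebra_simps)
  obtain s t where st: "norm (of_real s - a * a) \<le> s" "norm (of_real t - b * b) \<le> t"
    using square_shift_le ab by metis
  define r where "r = norm p"
  have r: "norm (of_real r - p) \<le> r"
  proof (rule norm_le_char)
    fix \<psi> assume \<psi>: "is_char S \<psi>"
    have "cmod (\<psi> p) \<le> r" using charD(6)[OF \<psi>] pR by (simp add: R_sub r_def)
    moreover have "\<psi> (of_real r - p) = of_real (r - max 0 (- Re (\<psi> h)) ^ 3)"
      using pR \<psi> by (simp add: charD R_sub \<psi>p of_real_in)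
    moreover have "0 \<le> max 0 (- Re (\<psi> h)) ^ 3" by simp
    ultimately show "cmod (\<psi> (of_real r - p)) \<le> r"
      by (simp only: \<psi>p[OF \<psi>] norm_of_real)
  qed (simp add: pR R_sub S of_real_in)
  \<comment> \<open>The summands of \<open>q\<close> need not commute, so positivity of
    \<open>q\<close> is not an addition inside one \<open>cone\<close>. The bounds are added in the
    ambient norm, and the total is then read in the abelian algebra generated by
    \<open>q\<close>.\<close>
  define T where "T = (s + s) + (t + t) + r"
  have "of_real T - q = ((of_real s - a * a) + (of_real s - a * a)) + ((of_real t - b * b) + (of_real t - b * b)) + (of_real r - p)"
    unfolding q T_def of_real_add by (simp only: algebra_simps)
  also have "norm \<dots> \<le> T" unfolding T_def by (intro norm_triangle_le add_mono st r)
  finally have T: "norm (of_real T - q) \<le> T" .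
  have \<psi>q: "0 \<le> Re (\<psi> q)" if \<psi>: "is_char (cstar_gen {1, q}) \<psi>" for \<psi>
  proof -
    have "\<psi> (of_real T - q) = of_real (T - Re (\<psi> q))"
      using V.charD(10)[OF \<psi> V.of_real_in V.R_sub[OF qR], of T] V.charD(11)[OF \<psi>, of T] V.char_real[OF \<psi> qR] by simp
    moreover have "cmod (\<psi> (of_real T - q)) \<le> T"
      using V.charD(6)[OF \<psi> V.S(7)[OF V.of_real_in V.R_sub[OF qR]], of T] T by linarith
    ultimately show ?thesis by (simp only: norm_of_real)
  qed
  have int: "q * u = u * (- p)" by (simp add: q_def mult.assoc uu)
  have "norm (q * u - u * p) \<le> 0 + e" if "0 < e" for e
  proof -
    define k where "k = norm u + 1"
    define d where "d = e / (2 * k)"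
    have "0 < k" unfolding k_def by (rule add_nonneg_pos) simp_all
    then have d: "0 < d" "2 * d * k = e" using that by (simp_all add: d_def)
    obtain c N where c: "\<And>t. \<bar>t\<bar> \<le> max (norm q) (norm p) \<Longrightarrow> \<bar>\<bar>t\<bar> - peval c N t\<bar> < d"
      using peval_approx[OF _ d(1), of abs] continuous_on_rabs[OF continuous_on_id] by metis
    have 1: "norm (q - peval c N q) \<le> d"
    proof (rule V.norm_peval_diff_le[OF V.R_sub[OF qR] qR])
      fix \<psi> assume \<psi>: "is_char (cstar_gen {1, q}) \<psi>"
      have "\<psi> q - of_real (peval c N (Re (\<psi> q))) = of_real (\<bar>Re (\<psi> q)\<bar> - peval c N (Re (\<psi> q)))"
        using V.char_real[OF \<psi> qR] \<psi>q[OF \<psi>] by simp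
      then show "cmod (\<psi> q - of_real (peval c N (Re (\<psi> q)))) \<le> d"
        using c[of "Re (\<psi> q)"] V.char_real_le[OF \<psi> qR] by (simp only: norm_of_real) linarith
    qed
    have mp: "- p \<in> R" using pR by (simp add: R_minus)
    have 2: "norm (p - peval c N (- p)) \<le> d"
    proof (rule norm_peval_diff_le[OF R_sub[OF pR] mp])
      fix \<psi> assume \<psi>: "is_char S \<psi>"
      have "Re (\<psi> p) \<ge> 0" by (simp add: \<psi>p[OF \<psi>])
      then have "\<psi> p - of_real (peval c N (Re (\<psi> (- p)))) = of_real (\<bar>Re (\<psi> (- p))\<bar> - peval c N (Re (\<psi> (- p))))"
        using char_real[OF \<psi> pR] charD(9)[OF \<psi> R_sub[OF pR]] by simp
      then show "cmod (\<psi> p - of_real (peval c N (Re (\<psi> (- p))))) \<le> d"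
        using c[of "Re (\<psi> (- p))"] char_real_le[OF \<psi> mp] by (simp only: norm_of_real) (simp add: le_max_iff_disj)
    qed
    have "q * u - u * p = (q - peval c N q) * u - u * (p - peval c N (- p))"
      using peval_intertwine[OF int, of c N] by (simp add: algebra_simps)
    also have "norm \<dots> \<le> d * norm u + norm u * d"
      by (rule order_trans[OF norm_triangle_ineq4], rule add_mono)
        (use order_trans[OF norm_mult_ineq mult_right_mono[OF 1 norm_ge_zero]]
          order_trans[OF norm_mult_ineq mult_left_mono[OF 2 norm_ge_zero]] in auto)
    also have "\<dots> \<le> e" using d(1) by (simp add: k_def algebra_simps flip: d(2))
    finally show ?thesis by simp
  qed
  then have "q * u = u * p" using field_le_epsilon[of "norm (q * u - u * p)" 0] by simp
  with int have "u * p = - (u * p)" by simp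
  then have "u * p = 0" by (simp add: equation_minus_iff[of "u * p"] eq_neg_iff_add_eq_0 flip: scaleR_2)
  then have "(adj u * u) * p = 0" by (simp add: mult.assoc)
  then have "p * p = 0" by (simp add: uu)
  then have "\<phi> p * \<phi> p = 0" using charD(2)[OF \<phi> R_sub[OF pR] R_sub[OF pR]] by (simp add: charD(8)[OF \<phi>])
  then have "max 0 (- Re (\<phi> h)) ^ 3 = 0" by (simp add: \<psi>p[OF \<phi>])
  then show ?thesis by (simp add: h_def max_def split: if_splits)
qed

end

text \<open>\<open>gapp h n = 1 - (1 - h)\<^sup>n\<close>, written without a unit.\<close>

primrec gapp :: "'a::ring \<Rightarrow> nat \<Rightarrow> 'a" where
  "gapp h 0 = 0"
| "gapp h (Suc n) = gapp h n + h - gapp h n * h"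

lemma gapp_in:
  assumes "csubspace J" "\<And>x y. x \<in> J \<Longrightarrow> y \<in> J \<Longrightarrow> x * y \<in> J" "h \<in> J"
  shows "gapp h n \<in> J"
  by (induction n) (auto intro!: csubspace_zero csubspace_add csubspace_diff assms)

lemma unz_inc_gapp: "1 - unz_inc (gapp h n) = (1 - unz_inc h) ^ n"
proof (induction n)
  case (Suc n)
  have "1 - unz_inc (gapp h (Suc n)) = (1 - unz_inc (gapp h n)) * (1 - unz_inc h)"
    by (simp add: unz_inc_simps algebra_simps)
  then show ?case by (simp add: Suc power_commutes)
qed (simp add: unz_inc_simps)

text \<open>Bernoulli's inequality bounds \<open>m * t\<close> by \<open>(1 + t) ^ m\<close>, and
  \<open>(1 + t) * (1 - t) \<le> 1\<close>. This is the rate at which the approximate units below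
  converge, uniform in \<open>t\<close>.\<close>

lemma bernoulli_bound:
  fixes t :: real
  assumes "0 \<le> t" "t \<le> 1"
  shows "t * (1 - t) ^ m * m \<le> 1"
proof -
  have "m * t * (1 - t) ^ m \<le> (1 + t) ^ m * (1 - t) ^ m"
    using Bernoulli_inequality[of t m] assms by (intro mult_right_mono) auto
  also have "\<dots> = (1 - t * t) ^ m" by (simp add: algebra_simps flip: power_mult_distrib)
  also have "\<dots> \<le> 1" using assms by (intro power_le_one) (auto simp: mult_le_one)
  finally show ?thesis by (simp add: ac_simps)
qed

text \<open>With \<open>h\<close> a multiple of \<open>adj w * w\<close> of norm at most 1, take
  \<open>j = gapp h n\<close>. Then \<open>1 - j = (1 - h) ^ n\<close> is a contraction, since
  \<open>h\<close> has values in \<open>[0, 1]\<close>, and the C*-identity reduces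
  \<open>w - w * j\<close> to \<open>bernoulli_bound\<close>. As a polynomial in \<open>h\<close>
  without constant term, \<open>j\<close> stays in \<open>J\<close>.\<close>

lemma right_approximate_unit:
  fixes w :: "'a::cstar_algebra"
  assumes J: "csubspace J" "\<And>x y. x \<in> J \<Longrightarrow> y \<in> J \<Longrightarrow> x * y \<in> J" and w: "adj w * w \<in> J" and e: "0 < e"
  obtains j where "j \<in> J" "\<And>x. norm (x - x * j) \<le> norm x" "norm (w - w * j) < e"
proof -
  define r where "r = 1 / ((norm w)\<^sup>2 + 1)"
  have w1: "0 < (norm w)\<^sup>2 + 1" by (rule add_nonneg_pos) simp_all
  have r: "0 < r" "r * (norm w)\<^sup>2 \<le> 1" using w1 by (simp_all add: r_def)
  define h where "h = r *\<^sub>R (adj w * w)"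
  have hJ: "h \<in> J" using J w by (simp add: h_def csubspace_scaleR)
  define H where "H = unz_inc h"
  \<comment> \<open>Writing \<open>H\<close> as \<open>adj v * v\<close> makes
    \<open>char_adj_mult_nonneg\<close> applicable, although \<open>v\<close> need not lie in the
    algebra generated by \<open>H\<close>.\<close>
  define v where "v = sqrt r *\<^sub>R unz_inc w"
  have Hv: "H = adj v * v" using r by (simp add: H_def h_def v_def unz_inc_simps adj_scaleR)
  have Ha: "adj H = H" by (simp add: Hv adj_mult adj_adj)
  interpret unital_abelian "cstar_gen {1, H}" using Ha by (rule unital_abelian_gen)
  have HR: "H \<in> R" using Ha cstar_gen_superset[of "{1, H}"] by (simp add: R_def)
  have nH: "norm H \<le> 1" using r by (simp add: H_def h_def cstar_identity)
  have t: "0 \<le> Re (\<phi> H)" "Re (\<phi> H) \<le> 1" "\<phi> H = of_real (Re (\<phi> H))" if "is_char (cstar_gen {1, H}) \<phi>" for \<phi>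
    using char_adj_mult_nonneg[OF _ that, of v] R_sub[OF HR] char_real_le[OF that HR] nH char_real[OF that HR]
    by (auto simp: Hv[symmetric])
  have KR: "(1 - H) ^ n \<in> R" for n by (intro R_power R_closed HR)
  have \<phi>K: "\<phi> ((1 - H) ^ n) = of_real ((1 - Re (\<phi> H)) ^ n)" if "is_char (cstar_gen {1, H}) \<phi>" for \<phi> n
  proof (induction n)
    case (Suc n)
    have "\<phi> (1 - H) = of_real (1 - Re (\<phi> H))"
      using that t(3)[OF that] by (simp add: charD(10) one R_sub HR charD(5))
    then show ?case using Suc that charD(2)[OF that R_sub R_sub, OF _ KR[of n], of "1 - H"] HR
      by (simp add: R_closed)
  qed (simp add: charD[OF that])
  have c1: "norm ((1 - H) ^ n) \<le> 1" for n
  proof (rule norm_le_char)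
    fix \<phi> assume \<phi>: "is_char (cstar_gen {1, H}) \<phi>"
    show "cmod (\<phi> ((1 - H) ^ n)) \<le> 1"
      unfolding \<phi>K[OF \<phi>] norm_of_real using t[OF \<phi>] by (simp add: power_le_one)
  qed (rule R_sub[OF KR])
  have "norm (x - x * gapp h n) \<le> norm x" for x n
  proof -
    have "norm (x - x * gapp h n) = norm (unz_inc x * (1 - unz_inc (gapp h n)))"
      by (simp add: algebra_simps flip: unz_inc_simps)
    also have "\<dots> \<le> norm (unz_inc x) * norm ((1 - H) ^ n)" unfolding unz_inc_gapp H_def by (rule norm_mult_ineq)
    also have "\<dots> \<le> norm x" using mult_left_mono[OF c1[of n], of "norm x"] by simp
    finally show ?thesis .
  qed
  moreover obtain n :: nat where n: "n > 0" "1 / (r * n) < e\<^sup>2"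
  proof -
    obtain n :: nat where "1 / (r * e\<^sup>2) < n" using reals_Archimedean2 by blast
    moreover have p: "0 < 1 / (r * e\<^sup>2)" using r e by simp
    ultimately have n: "0 < real n" by (rule less_trans[rotated])
    then show ?thesis using r e \<open>1 / (r * e\<^sup>2) < n\<close> by (intro that[of n]) (auto simp: field_simps)
  qed
  have "norm (w - w * gapp h n) < e"
  proof -
    let ?K = "(1 - H) ^ n"
    have "norm (w - w * gapp h n) = norm (unz_inc w * (1 - unz_inc (gapp h n)))"
      by (simp add: algebra_simps flip: unz_inc_simps)
    also have "\<dots> = norm (unz_inc w * ?K)" unfolding unz_inc_gapp H_def ..
    finally have "(norm (w - w * gapp h n))\<^sup>2 = norm (adj (unz_inc w * ?K) * (unz_inc w * ?K))"
      by (simp add: cstar_identity)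
    also have "adj (unz_inc w * ?K) * (unz_inc w * ?K) = ?K * (unz_inc (adj w * w) * ?K)"
      using KR by (simp add: adj_mult R_adj unz_inc_simps mult.assoc)
    also have "unz_inc (adj w * w) = (1 / r) *\<^sub>R H" using r by (simp add: H_def h_def unz_inc_simps)
    also have "norm (?K * ((1 / r) *\<^sub>R H * ?K)) \<le> 1 / (r * n)"
    proof (rule norm_le_char)
      fix \<phi> assume \<phi>: "is_char (cstar_gen {1, H}) \<phi>"
      define s where "s = Re (\<phi> H)"
      have s: "0 \<le> s" "s \<le> 1" "\<phi> H = of_real s" using t[OF \<phi>] by (simp_all add: s_def)
      have "\<phi> (?K * ((1 / r) *\<^sub>R H * ?K)) = of_real ((1 - s) ^ n * ((1 / r) * s * (1 - s) ^ n))"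
        using \<phi>K[OF \<phi>, of n] KR HR by (simp add: charD[OF \<phi>] S R_sub s(3) flip: s_def)
      moreover have "(1 - s) ^ n * ((1 / r) * s * (1 - s) ^ n) \<le> 1 / (r * n)"
      proof -
        have "s * (1 - s) ^ n \<le> 1 / n" using bernoulli_bound[OF s(1,2), of n] n by (simp add: field_simps)
        moreover have "(1 - s) ^ n \<le> 1" "0 \<le> (1 - s) ^ n" using s by (simp_all add: power_le_one)
        ultimately have "(1 - s) ^ n * (s * (1 - s) ^ n) \<le> 1 * (1 / n)" using s by (intro mult_mono) auto
        then have "(1 / r) * ((1 - s) ^ n * (s * (1 - s) ^ n)) \<le> (1 / r) * (1 / n)"
          using r by (intro mult_left_mono) auto
        then show ?thesis by (simp add: ac_simps)
      qed
      moreover have "0 \<le> (1 - s) ^ n * ((1 / r) * s * (1 - s) ^ n)" using s r by simp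
      ultimately show "cmod (\<phi> (?K * ((1 / r) *\<^sub>R H * ?K))) \<le> 1 / (r * n)"
        by (simp only: norm_of_real abs_of_nonneg)
    qed (intro S R_sub[OF KR] R_sub[OF HR])
    also have "\<dots> < e\<^sup>2" by (rule n)
    finally show ?thesis using e by (simp add: power2_less_imp_less)
  qed
  ultimately show ?thesis using that[of "gapp h n"] gapp_in[OF J hJ, of n] by blast
qed

section \<open>Homomorphisms\<close>

lemma star_homD:
  assumes "star_hom f"
  shows "f (x + y) = f x + f y" "f (cscale a x) = cscale a (f x)" "f (x * y) = f x * f y" "f (adj x) = adj (f x)"
    "f 0 = 0" "f (r *\<^sub>R x) = r *\<^sub>R f x" "f (- x) = - f x" "f (x - y) = f x - f y"
proof -
  show add: "f (x + y) = f x + f y" and sc: "f (cscale a x) = cscale a (f x)"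
    and "f (x * y) = f x * f y" "f (adj x) = adj (f x)" for x y a
    using assms by (simp_all add: star_hom_def)
  show "f 0 = 0" using add[of 0 0] by simp
  show "f (r *\<^sub>R x) = r *\<^sub>R f x" by (simp add: sc flip: cscale_of_real)
  show m: "f (- x) = - f x" for x using sc[of "-1" x] by (simp add: cscale_minus_one)
  show "f (x - y) = f x - f y" using add[of x "- y"] by (simp add: m)
qed

lemma cstar_subalgebra_UNIV: "cstar_subalgebra UNIV"
  by (simp add: cstar_subalgebra_def csubspace_def)

text \<open>For self-adjoint \<open>h\<close> with \<open>norm h < 1\<close>,
  \<open>1 - h * h\<close> is a square. Its root is carried by \<open>f\<close> to the unitization
  of the target, so \<open>1 - f h * f h\<close> is a square as well and
  \<open>norm (f h) \<le> 1\<close>. The root is taken in the algebra of \<open>h\<close> so that it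
  commutes with \<open>h\<close>.\<close>

theorem star_hom_norm_le:
  assumes f: "star_hom f"
  shows "norm (f x) \<le> norm x"
proof -
  note F = star_homD[OF f]
  have 1: "norm (f h) \<le> 1" if h: "adj h = h" "norm h < 1" for h
  proof -
    have "norm (h * h) < 1"
      using norm_mult_ineq[of h h] mult_strict_mono[of "norm h" 1 "norm h" 1] h by simp
    moreover have "h * h \<in> cstar_gen {h}"
      using cstar_subalgebraD(3)[OF cstar_subalgebra_gen] cstar_gen_superset[of "{h}"] by blast
    moreover have "adj (h * h) = h * h" using h by (simp add: adj_mult)
    ultimately obtain s where s: "s \<in> cstar_gen {h}" "adj s = s" "s + s - s * s = h * h"
      using sa_sqrt[OF cstar_subalgebra_gen] by metis
    have "abelian (cstar_gen {h})" using h by (intro abelian_cstar_gen) auto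
    then have "s * h = h * s" using s(1) cstar_gen_superset[of "{h}"] by (auto simp: abelian_def)
    then have c: "f s * f h = f h * f s" by (metis F(3))
    define a where "a = 1 - unz_inc (f s)"
    define b where "b = unz_inc (f h)"
    have "a * a = 1 - unz_inc (f (s + s - s * s))"
      by (simp add: a_def F algebra_simps unz_inc_simps)
    then have ab: "a * a + b * b = 1" by (simp add: s(3) b_def F unz_inc_simps)
    have "norm (b * b) \<le> norm (a * a + b * b)"
      by (rule norm_square_mono)
        (simp_all add: a_def b_def adj_diff s(2) h(1) algebra_simps c flip: unz_inc_simps F(4))
    then have "norm (f h * f h) \<le> 1" unfolding ab by (simp add: b_def flip: unz_inc_simps)
    moreover have "norm (f h * f h) = (norm (f h))\<^sup>2"
      using cstar_identity[of "f h"] by (simp add: h(1) flip: F(4))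
    ultimately show ?thesis using power2_le_imp_le[of "norm (f h)" 1] by simp
  qed
  have sa: "norm (f h) \<le> norm h" if h: "adj h = h" for h
  proof (rule field_le_epsilon)
    fix e :: real assume "0 < e"
    define t where "t = norm h + e"
    have t: "0 < t" "norm h < t" using \<open>0 < e\<close> by (simp_all add: t_def add_nonneg_pos)
    then have "norm (f ((1 / t) *\<^sub>R h)) \<le> 1" using h by (intro 1) (simp_all add: adj_scaleR)
    then show "norm (f h) \<le> norm h + e" using t by (simp add: F field_simps) (simp add: t_def)
  qed
  have "(norm (f x))\<^sup>2 = norm (f (adj x * x))" by (simp add: F cstar_identity)
  also have "\<dots> \<le> (norm x)\<^sup>2" using sa[of "adj x * x"] by (simp add: adj_mult adj_adj cstar_identity)
  finally show ?thesis by (rule power2_le_imp_le) simp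
qed

lemma star_hom_peval:
  fixes f :: "'a::{cstar_algebra,real_normed_algebra_1} \<Rightarrow> 'b::{cstar_algebra,real_normed_algebra_1}"
  assumes f: "star_hom f" "f 1 = 1"
  shows "f (peval a n x) = peval a n (f x)"
proof -
  have "f (x ^ i) = f x ^ i" for i by (induction i) (simp_all add: star_homD(3)[OF f(1)] f(2))
  then show ?thesis
    by (induction n) (simp_all add: peval_def star_homD[OF f(1)] f(2))
qed

text \<open>If \<open>norm (f h) < norm h\<close>, the function \<open>g\<close> vanishes on
  \<open>[- norm (f h), norm (f h)]\<close> but not at \<open>\<plusminus> norm h\<close>. Then
  \<open>g(h)\<close> is nonzero, while its image, a limit of polynomials in \<open>f h\<close>, is
  zero: this contradicts injectivity.\<close>

lemma star_hom_unital_isometry: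
  fixes f :: "'a::{cstar_algebra,real_normed_algebra_1} \<Rightarrow> 'b::{cstar_algebra,real_normed_algebra_1}"
  assumes f: "star_hom f" "f 1 = 1" and inj: "inj f"
  shows "norm (f x) = norm x"
proof -
  note F = star_homD[OF f(1)]
  have sa: "norm h \<le> norm (f h)" if h: "adj h = h" for h
  proof (rule ccontr)
    assume "\<not> ?thesis"
    then have lt: "norm (f h) < norm h" by simp
    have fh: "adj (f h) = f h" by (simp add: h flip: F(4))
    interpret C: unital_abelian "cstar_gen {1, h}" using h by (rule unital_abelian_gen)
    interpret A: unital_abelian "cstar_gen {1, f h}" using fh by (rule unital_abelian_gen)
    have hR: "h \<in> C.R" using h cstar_gen_superset[of "{1, h}"] by (simp add: C.R_def)
    have fhR: "f h \<in> A.R" using fh cstar_gen_superset[of "{1, f h}"] by (simp add: A.R_def)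
    define g where "g t = max 0 (\<bar>t\<bar> - norm (f h))" for t
    have g: "continuous_on UNIV g" unfolding g_def by (intro continuous_intros)
    obtain y where y: "y \<in> C.R" "\<And>\<phi>. is_char (cstar_gen {1, h}) \<phi> \<Longrightarrow> \<phi> y = of_real (g (Re (\<phi> h)))"
      using C.functional_calculus[OF g hR] by blast
    have "norm (f y) \<le> 0 + e" if "0 < e" for e
    proof -
      have "0 < e / 2" using that by simp
      then obtain c N where c: "\<And>t. \<bar>t\<bar> \<le> norm h \<Longrightarrow> \<bar>g t - peval c N t\<bar> < e / 2"
        using peval_approx[OF g, of "e / 2" "norm h"] by blast
      have "norm (y - peval c N h) \<le> e / 2"
      proof (rule C.norm_peval_diff_le[OF C.R_sub[OF y(1)] hR])
        fix \<phi> assume \<phi>: "is_char (cstar_gen {1, h}) \<phi>"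
        show "cmod (\<phi> y - of_real (peval c N (Re (\<phi> h)))) \<le> e / 2"
          unfolding y(2)[OF \<phi>] of_real_diff[symmetric] norm_of_real
          using c[OF C.char_real_le[OF \<phi> hR]] by simp
      qed
      then have 1: "norm (f (y - peval c N h)) \<le> e / 2" by (rule order_trans[OF star_hom_norm_le[OF f(1)]])
      have 2: "norm (peval c N (f h)) \<le> e / 2"
      proof (rule A.norm_le_char)
        fix \<phi> assume \<phi>: "is_char (cstar_gen {1, f h}) \<phi>"
        have "\<bar>Re (\<phi> (f h))\<bar> \<le> norm (f h)" by (rule A.char_real_le[OF \<phi> fhR])
        then show "cmod (\<phi> (peval c N (f h))) \<le> e / 2"
          unfolding A.char_peval[OF \<phi> fhR] norm_of_real
          using c[of "Re (\<phi> (f h))"] lt by (simp add: g_def)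
      qed (rule A.R_sub[OF A.peval_R[OF fhR]])
      have "f y = f (y - peval c N h) + peval c N (f h)"
        by (simp add: F star_hom_peval[OF f])
      then show ?thesis using norm_triangle_ineq[of "f (y - peval c N h)" "peval c N (f h)"] 1 2 by simp
    qed
    then have "f y = f 0" using field_le_epsilon[of "norm (f y)" 0] by (simp add: F)
    then have "y = 0" using inj by (simp add: inj_eq)
    obtain \<phi> where \<phi>: "is_char (cstar_gen {1, h}) \<phi>" "cmod (\<phi> h) = norm h"
      using C.exists_char_norm[OF C.R_sub[OF hR]] by blast
    have "\<bar>Re (\<phi> h)\<bar> = norm h" using \<phi>(2) C.char_real[OF \<phi>(1) hR] by (metis norm_of_real)
    then show False using y(2)[OF \<phi>(1)] lt \<open>y = 0\<close> by (simp add: C.charD(8)[OF \<phi>(1)] g_def)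
  qed
  have "(norm x)\<^sup>2 \<le> (norm (f x))\<^sup>2"
    using sa[of "adj x * x"] by (simp add: adj_mult adj_adj cstar_identity F)
  then have "norm x \<le> norm (f x)" by (rule power2_le_imp_le) simp
  with star_hom_norm_le[OF f(1), of x] show ?thesis by simp
qed

text \<open>Even between unital algebras \<open>f\<close> need not preserve the unit. Its extension
  to the unitizations acts as the identity on scalars, preserves the new unit and remains
  injective.\<close>

theorem star_hom_isometry:
  assumes f: "star_hom f" and inj: "inj f"
  shows "norm (f x) = norm x"
proof -
  define F where "F u = Unz (unz_scal u) (f (unz_elt u))" for u
  have "star_hom F"
    by (simp add: star_hom_def F_def unz_defs cscale_unz_def adj_unz_def star_homD[OF f])
  moreover have "F 1 = 1" by (simp add: F_def one_unz_def star_homD[OF f])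
  moreover have "inj F"
    by (rule injI) (metis F_def unz.inject unz.collapse injD[OF inj])
  ultimately have "norm (F (unz_inc x)) = norm (unz_inc x)" by (rule star_hom_unital_isometry)
  moreover have "F (unz_inc x) = unz_inc (f x)" by (simp add: F_def unz_inc_def)
  ultimately show ?thesis by simp
qed

lemma bounded_linear_star_hom: "star_hom f \<Longrightarrow> bounded_linear f"
  by (rule bounded_linear_intro[where K = 1]) (auto simp: star_homD star_hom_norm_le)

section \<open>Approximate units\<close>

text \<open>For the \<open>J\<close> used below this is the closed left ideal generated by
  \<open>J\<close>. Demanding that \<open>1 - j\<close> be contractive on all \<open>x\<close> is
  what makes the set stable under sums and limits.\<close>

definition right_unit_set :: "'a::cstar_algebra set \<Rightarrow> 'a set" where
  "right_unit_set J = {a. \<forall>e>0. \<exists>j\<in>J. (\<forall>x. norm (x - x * j) \<le> norm x) \<and> norm (a - a * j) < e}"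

text \<open>Neither closedness nor stability under \<open>adj\<close> is asked, so that the image of
  \<open>I \<inter> D\<close> under \<open>\<alpha>\<close> qualifies directly.\<close>

definition abelian_algebra :: "'a::cstar_algebra set \<Rightarrow> bool" where
  "abelian_algebra J \<longleftrightarrow> csubspace J \<and> (\<forall>x\<in>J. \<forall>y\<in>J. x * y \<in> J) \<and> abelian J"

context
  fixes J :: "'a::cstar_algebra set"
  assumes J_alg: "abelian_algebra J"
begin

lemma abelian_algebraD: "csubspace J" "\<And>x y. x \<in> J \<Longrightarrow> y \<in> J \<Longrightarrow> x * y \<in> J" "abelian J"
  using J_alg by (simp_all add: abelian_algebra_def)

lemma right_unit_setD:
  assumes "a \<in> right_unit_set J" "0 < e"
  obtains j where "j \<in> J" "\<And>x. norm (x - x * j) \<le> norm x" "norm (a - a * j) < e"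
  using assms by (auto simp: right_unit_set_def)

lemma right_unit_set_left_mult: 
  assumes "a \<in> right_unit_set J" shows "x * a \<in> right_unit_set J"
  unfolding right_unit_set_def
proof (intro CollectI allI impI)
  fix e :: real assume "0 < e"
  have nx: "0 < norm x + 1" by (rule add_nonneg_pos) simp_all
  obtain j where j: "j \<in> J" "\<And>x. norm (x - x * j) \<le> norm x" "norm (a - a * j) < e / (norm x + 1)"
    using right_unit_setD[OF assms, of "e / (norm x + 1)"] nx \<open>0 < e\<close> by auto
  have "norm (x * a - x * a * j) = norm (x * (a - a * j))" by (simp add: algebra_simps)
  also have "\<dots> \<le> (norm x + 1) * norm (a - a * j)"
    by (rule order_trans[OF norm_mult_ineq]) (simp add: mult_right_mono)
  also have "\<dots> < e" using j(3) nx by (simp add: field_simps)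
  finally show "\<exists>j\<in>J. (\<forall>x. norm (x - x * j) \<le> norm x) \<and> norm (x * a - x * a * j) < e" using j by blast
qed

lemma right_unit_set_right_mult: 
  assumes "a \<in> right_unit_set J" and comm: "\<And>j. j \<in> J \<Longrightarrow> j * b = b * j"
  shows "a * b \<in> right_unit_set J"
  unfolding right_unit_set_def
proof (intro CollectI allI impI)
  fix e :: real assume "0 < e"
  have nb: "0 < norm b + 1" by (rule add_nonneg_pos) simp_all
  obtain j where j: "j \<in> J" "\<And>x. norm (x - x * j) \<le> norm x" "norm (a - a * j) < e / (norm b + 1)"
    using right_unit_setD[OF assms(1), of "e / (norm b + 1)"] nb \<open>0 < e\<close> by auto
  have "norm (a * b - a * b * j) = norm ((a - a * j) * b)" using comm[OF j(1)] by (simp add: algebra_simps)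
  also have "\<dots> \<le> norm (a - a * j) * (norm b + 1)"
    by (rule order_trans[OF norm_mult_ineq]) (simp add: mult_left_mono)
  also have "\<dots> < e" using j(3) nb by (simp add: field_simps)
  finally show "\<exists>j\<in>J. (\<forall>x. norm (x - x * j) \<le> norm x) \<and> norm (a * b - a * b * j) < e" using j by blast
qed

text \<open>For a sum, the units \<open>i\<close> and \<open>j\<close> are joined to \<open>i + j - i j\<close>, since
  \<open>1 - (i + j - i j) = (1 - i) (1 - j)\<close>.\<close>

lemma right_unit_set_add: 
  assumes "a \<in> right_unit_set J" "b \<in> right_unit_set J" shows "a + b \<in> right_unit_set J"
  unfolding right_unit_set_def
proof (intro CollectI allI impI)
  fix e :: real assume "0 < e"
  then have e2: "0 < e / 2" by simp
  obtain i where i: "i \<in> J" "\<And>x. norm (x - x * i) \<le> norm x" "norm (a - a * i) < e / 2"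
    using right_unit_setD[OF assms(1) e2] by blast
  obtain j where j: "j \<in> J" "\<And>x. norm (x - x * j) \<le> norm x" "norm (b - b * j) < e / 2"
    using right_unit_setD[OF assms(2) e2] by blast
  have ij: "i * j = j * i" using abelian_algebraD(3) i j by (auto simp: abelian_def)
  define k where "k = i + j - i * j"
  have kJ: "k \<in> J" using i j abelian_algebraD(1,2) by (auto simp: k_def intro!: csubspace_diff csubspace_add)
  have k: "x - x * k = (x - x * i) - (x - x * i) * j" "x - x * k = (x - x * j) - (x - x * j) * i" for x
    by (simp_all add: k_def algebra_simps ij)
  have 1: "norm (x - x * k) \<le> norm x" for x
    unfolding k(1) using j(2)[of "x - x * i"] i(2)[of x] by linarith
  have 2: "norm (a - a * k) < e / 2" unfolding k(1) using j(2)[of "a - a * i"] i(3) by linarith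
  have 3: "norm (b - b * k) < e / 2" unfolding k(2) using i(2)[of "b - b * j"] j(3) by linarith
  have E: "(a + b) - (a + b) * k = (a - a * k) + (b - b * k)" by (simp add: algebra_simps)
  have "norm ((a + b) - (a + b) * k) < e"
    unfolding E using norm_triangle_ineq[of "a - a * k" "b - b * k"] 2 3 by linarith
  with 1 kJ show "\<exists>j\<in>J. (\<forall>x. norm (x - x * j) \<le> norm x) \<and> norm (a + b - (a + b) * j) < e" by blast
qed

lemma right_unit_set_cscale:
  assumes "a \<in> right_unit_set J" shows "cscale c a \<in> right_unit_set J"
  unfolding right_unit_set_def
proof (intro CollectI allI impI)
  fix e :: real assume "0 < e"
  have nx: "0 < cmod c + 1" by (rule add_nonneg_pos) simp_all
  obtain j where j: "j \<in> J" "\<And>x. norm (x - x * j) \<le> norm x" "norm (a - a * j) < e / (cmod c + 1)"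
    using right_unit_setD[OF assms, of "e / (cmod c + 1)"] nx \<open>0 < e\<close> by auto
  have "norm (cscale c a - cscale c a * j) = norm (cscale c (a - a * j))"
    by (simp add: cscale_mult_left cscale_diff_right)
  also have "\<dots> \<le> (cmod c + 1) * norm (a - a * j)" by (simp add: norm_cscale mult_right_mono)
  also have "\<dots> < e" using j(3) nx by (simp add: field_simps)
  finally show "\<exists>j\<in>J. (\<forall>x. norm (x - x * j) \<le> norm x) \<and> norm (cscale c a - cscale c a * j) < e" using j by blast
qed

lemma csubspace_right_unit_set: "csubspace (right_unit_set J)"
  unfolding csubspace_def
proof (intro conjI ballI allI impI)
  show "0 \<in> right_unit_set J"
    using csubspace_zero[OF abelian_algebraD(1)] by (auto simp: right_unit_set_def intro!: bexI[of _ 0])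
qed (blast intro: right_unit_set_add right_unit_set_cscale)+

lemma closed_right_unit_set: "closed (right_unit_set J)"
proof -
  have "a \<in> right_unit_set J" if a: "a \<in> closure (right_unit_set J)" for a
    unfolding right_unit_set_def
  proof (intro CollectI allI impI)
    fix e :: real assume "0 < e"
    then have e2: "0 < e / 2" by simp
    then obtain b where b: "b \<in> right_unit_set J" "norm (a - b) < e / 2"
      using a unfolding closure_approachable dist_norm by (metis norm_minus_commute)
    obtain j where j: "j \<in> J" "\<And>x. norm (x - x * j) \<le> norm x" "norm (b - b * j) < e / 2"
      using right_unit_setD[OF b(1) e2] by blast
    have E: "a - a * j = ((a - b) - (a - b) * j) + (b - b * j)" by (simp add: algebra_simps)
    have "norm (a - a * j) < e"
      unfolding E using norm_triangle_ineq[of "(a - b) - (a - b) * j" "b - b * j"] j(2)[of "a - b"] j(3) b(2) by linarith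
    with j show "\<exists>j\<in>J. (\<forall>x. norm (x - x * j) \<le> norm x) \<and> norm (a - a * j) < e" by blast
  qed
  then show ?thesis using closure_subset_eq by blast
qed

lemma in_right_unit_set:
  assumes "adj w * w \<in> J" shows "w \<in> right_unit_set J"
  unfolding right_unit_set_def
proof (intro CollectI allI impI)
  fix e :: real assume "0 < e"
  obtain j where "j \<in> J" "\<And>x. norm (x - x * j) \<le> norm x" "norm (w - w * j) < e"
    using right_approximate_unit[OF abelian_algebraD(1) _ assms \<open>0 < e\<close>] abelian_algebraD(2) by blast
  then show "\<exists>j\<in>J. (\<forall>x. norm (x - x * j) \<le> norm x) \<and> norm (w - w * j) < e" by blast
qed

end

section \<open>Conditional expectations\<close>

locale abelian_subalgebra =
  fixes B :: "'a::cstar_algebra set"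
  assumes B_sub: "cstar_subalgebra B" and B_ab: "abelian B"
begin

sublocale U: unital_abelian "unz_sub B"
  by unfold_locales (simp_all add: B_sub B_ab cstar_subalgebra_unz_sub abelian_unz_sub one_in_unz_sub)

lemmas B = cstar_subalgebraD[OF B_sub]

lemma B_comm: "x \<in> B \<Longrightarrow> y \<in> B \<Longrightarrow> x * y = y * x"
  using B_ab by (rule abelianD)

lemma unz_inc_R: "b \<in> B \<Longrightarrow> adj b = b \<Longrightarrow> unz_inc b \<in> U.R"
  by (simp add: U.R_def flip: unz_inc_simps)

lemma B_eqI:
  assumes "x \<in> B" "y \<in> B" "\<And>\<phi>. is_char (unz_sub B) \<phi> \<Longrightarrow> \<phi> (unz_inc x) = \<phi> (unz_inc y)"
  shows "x = y"
  using U.char_eqI[of "unz_inc x" "unz_inc y"] assms by simp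

lemma B_norm_le:
  assumes "x \<in> B" "\<And>\<phi>. is_char (unz_sub B) \<phi> \<Longrightarrow> cmod (\<phi> (unz_inc x)) \<le> e"
  shows "norm x \<le> e"
  using U.norm_le_char[of "unz_inc x"] assms by simp

text \<open>The character \<open>unz_scal\<close> vanishes on \<open>B\<close>, so \<open>f 0 = 0\<close> keeps the functional
  calculus inside \<open>B\<close>.\<close>

lemma functional_calculus0:
  assumes f: "continuous_on UNIV f" "f 0 = 0" and b: "b \<in> B" "adj b = b"
  obtains y where "y \<in> B" "adj y = y"
    "\<And>\<phi>. is_char (unz_sub B) \<phi> \<Longrightarrow> \<phi> (unz_inc y) = of_real (f (Re (\<phi> (unz_inc b))))"
proof -
  obtain u where u: "u \<in> U.R" "\<And>\<phi>. is_char (unz_sub B) \<phi> \<Longrightarrow> \<phi> u = of_real (f (Re (\<phi> (unz_inc b))))"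
    using U.functional_calculus[OF f(1) unz_inc_R[OF b]] by blast
  have "is_char (unz_sub B) unz_scal"
    by (simp add: is_char_def norm_unz_scal_le) (simp add: unz_defs cscale_unz_def adj_unz_def)
  from u(2)[OF this] have "unz_scal u = 0" by (simp add: unz_inc_def f(2))
  then have e: "u = unz_inc (unz_elt u)" by (cases u) (simp add: unz_inc_def)
  have "unz_elt u \<in> B" using U.R_sub[OF u(1)] by (simp add: unz_sub_def)
  moreover have "adj (unz_elt u) = unz_elt u"
    using U.R_adj[OF u(1)] e by (metis unz_inc_eq_iff unz_inc_simps(4))
  ultimately show ?thesis using that[of "unz_elt u"] u(2) e by simp
qed

lemma char_positive:
  assumes "positive y" "y \<in> B" "is_char (unz_sub B) \<phi>"
  obtains r where "\<phi> (unz_inc y) = of_real r" "0 \<le> r"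
proof -
  obtain z where z: "y = adj z * z" using assms(1) by (auto simp: positive_def)
  have R: "unz_inc y \<in> U.R" using assms(2) by (intro unz_inc_R) (simp_all add: z adj_mult adj_adj)
  have "0 \<le> Re (\<phi> (unz_inc y))"
    using U.char_adj_mult_nonneg[of "unz_inc z" \<phi>] assms(2,3) by (simp add: z flip: unz_inc_simps)
  then show ?thesis by (rule that[OF U.char_real[OF assms(3) R]])
qed

end

locale cond_exp = abelian_subalgebra B for B :: "'a::cstar_algebra set" +
  fixes \<Delta>
  assumes ce: "faithful_cond_exp B \<Delta>"
begin

lemma Delta_add: "\<Delta> (x + y) = \<Delta> x + \<Delta> y" and Delta_cscale: "\<Delta> (cscale a x) = cscale a (\<Delta> x)"
  and Delta_in: "\<Delta> x \<in> B" and Delta_id: "b \<in> B \<Longrightarrow> \<Delta> b = b"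
  and Delta_bimodule: "b \<in> B \<Longrightarrow> b' \<in> B \<Longrightarrow> \<Delta> (b * x * b') = b * \<Delta> x * b'"
  and Delta_positive: "positive x \<Longrightarrow> positive (\<Delta> x)"
  and Delta_faithful: "\<Delta> (adj x * x) = 0 \<Longrightarrow> x = 0"
proof -
  note c1 = ce[unfolded faithful_cond_exp_def] note c2 = c1[THEN conjunct2] note c3 = c2[THEN conjunct2]
  note c4 = c3[THEN conjunct2] note c5 = c4[THEN conjunct2] note c6 = c5[THEN conjunct2]
  show "\<Delta> (x + y) = \<Delta> x + \<Delta> y" using c1[THEN conjunct1] by (rule spec2)
  show "\<Delta> (cscale a x) = cscale a (\<Delta> x)" using c2[THEN conjunct1] by (rule spec2)
  show "\<Delta> x \<in> B" unfolding c3[THEN conjunct1, symmetric] by (rule rangeI)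
  show "b \<in> B \<Longrightarrow> \<Delta> b = b" using c4[THEN conjunct1] by (rule bspec)
  show "b \<in> B \<Longrightarrow> b' \<in> B \<Longrightarrow> \<Delta> (b * x * b') = b * \<Delta> x * b'"
    using c5[THEN conjunct1, THEN bspec, THEN spec, THEN bspec] .
  show "positive x \<Longrightarrow> positive (\<Delta> x)" using c6[THEN conjunct1, THEN spec, THEN mp] .
  show "\<Delta> (adj x * x) = 0 \<Longrightarrow> x = 0" using c6[THEN conjunct2, THEN spec, THEN mp] .
qed

lemma Delta_zero: "\<Delta> 0 = 0" using Delta_add[of 0 0] by simp

lemma Delta_minus: "\<Delta> (- x) = - \<Delta> x" using Delta_cscale[of "-1" x] by (simp add: cscale_minus_one)

lemma Delta_diff: "\<Delta> (x - y) = \<Delta> x - \<Delta> y"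
  using Delta_add[of x "- y"] by (simp add: Delta_minus)

lemma Delta_scaleR: "\<Delta> (r *\<^sub>R x) = r *\<^sub>R \<Delta> x"
  by (simp add: Delta_cscale flip: cscale_of_real)

text \<open>For \<open>b \<in> B\<close> and \<open>x\<close> self-adjoint of norm \<open>< 1\<close>, with \<open>(1 - s)\<^sup>2 = 1 - x\<close>:
  \<open>b\<^sup>* b - b\<^sup>* x b = ((1 - s) b)\<^sup>* ((1 - s) b)\<close>.\<close>

lemma Delta_sandwich_positive:
  assumes x: "adj x = x" "norm x < 1" and b: "b \<in> B"
  shows "positive (adj b * b - adj b * \<Delta> x * b)"
proof -
  obtain s where s: "adj s = s" "s + s - s * s = x"
    using sa_sqrt[OF cstar_subalgebra_UNIV, of x] x by auto
  have "adj (b - s * b) * (b - s * b) = adj b * b - adj b * (s + s - s * s) * b"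
    by (simp add: adj_diff adj_mult s(1) algebra_simps)
  then have "positive (adj b * b - adj b * x * b)" unfolding positive_def s(2) by metis
  then have "positive (\<Delta> (adj b * b - adj b * x * b))" by (rule Delta_positive)
  then show ?thesis using b by (simp add: Delta_diff Delta_id B Delta_bimodule)
qed

text \<open>Since \<open>B\<close> may lack a unit, \<open>1 - \<Delta> x\<close> is tested after
  multiplication by \<open>adj d\<close> and \<open>d\<close> with \<open>d = \<Delta> x\<close>. At
  a character with value \<open>z \<noteq> 0\<close> at \<open>d\<close>, this shows that
  \<open>1 - z\<close> and, using \<open>- x\<close>, also \<open>1 + z\<close> are nonnegative
  reals; so \<open>z\<close> is real with modulus at most 1.\<close>

lemma Delta_sa:
  assumes x: "adj x = x" "norm x < 1"
  shows "adj (\<Delta> x) = \<Delta> x \<and> norm (\<Delta> x) \<le> 1"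
proof -
  define d where "d = \<Delta> x"
  have d: "d \<in> B" by (simp add: d_def Delta_in)
  have *: "\<phi> (unz_inc d) = of_real (Re (\<phi> (unz_inc d))) \<and> \<bar>Re (\<phi> (unz_inc d))\<bar> \<le> 1"
    if \<phi>: "is_char (unz_sub B) \<phi>" for \<phi>
  proof (cases "\<phi> (unz_inc d) = 0")
    case False
    define z where "z = \<phi> (unz_inc d)"
    have z: "z \<noteq> 0" using False by (simp add: z_def)
    have pos: "\<exists>r. cnj z * z * (1 - w) = of_real r \<and> 0 \<le> r"
      if w: "positive (adj d * d - adj d * y * d)" "y \<in> B" "w = \<phi> (unz_inc y)" for w y
    proof -
      have "adj d * d - adj d * y * d \<in> B" using d w by (simp add: B)
      then obtain r where "\<phi> (unz_inc (adj d * d - adj d * y * d)) = of_real r" "0 \<le> r"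
        using char_positive[OF w(1) _ \<phi>] by blast
      moreover have "\<phi> (unz_inc (adj d * d - adj d * y * d)) = cnj z * z * (1 - w)"
        using d w by (simp add: unz_inc_simps U.charD[OF \<phi>] U.S z_def w(3) algebra_simps)
      ultimately show ?thesis by auto
    qed
    have zz: "cnj z * z = of_real ((cmod z)\<^sup>2)" using complex_norm_square[of z] by (simp add: mult.commute)
    have z2: "0 < (cmod z)\<^sup>2" using z by simp
    have div: "\<exists>s. 1 - w = of_real s \<and> 0 \<le> s" if "\<exists>r. cnj z * z * (1 - w) = of_real r \<and> 0 \<le> r" for w
    proof -
      from that obtain r where r: "of_real ((cmod z)\<^sup>2) * (1 - w) = of_real r" "0 \<le> r" unfolding zz by auto
      then have "1 - w = of_real (r / (cmod z)\<^sup>2)" using z2 by (simp add: field_simps)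
      moreover have "0 \<le> r / (cmod z)\<^sup>2" using r by simp
      ultimately show ?thesis by blast
    qed
    obtain s where s: "1 - z = of_real s" "0 \<le> s"
      using div[OF pos[OF Delta_sandwich_positive[OF x d] Delta_in]] by (auto simp: z_def d_def)
    have "adj (- x) = - x" "norm (- x) < 1" using x by (simp_all add: adj_minus)
    from div[OF pos[OF Delta_sandwich_positive[OF this d] Delta_in refl]] d
    obtain t where t: "1 + z = of_real t" "0 \<le> t"
      by (auto simp: Delta_minus unz_inc_simps U.charD[OF \<phi>] z_def simp flip: d_def)
    have "z = of_real (1 - s)" using s(1) by (simp add: algebra_simps)
    moreover from this t s have "of_real (2 - s) = (of_real t :: complex)" by simp
    then have "2 - s = t" using of_real_eq_iff by blast
    ultimately show ?thesis using s t by (simp flip: z_def)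
  qed simp
  have "adj d = d"
  proof (rule B_eqI)
    fix \<phi> assume \<phi>: "is_char (unz_sub B) \<phi>"
    show "\<phi> (unz_inc (adj d)) = \<phi> (unz_inc d)"
      using *[OF \<phi>] d by (simp add: unz_inc_simps U.charD(4)[OF \<phi>]) (metis complex_cnj_complex_of_real)
  qed (simp_all add: d B)
  moreover have "norm d \<le> 1"
  proof (rule B_norm_le[OF d])
    fix \<phi> assume \<phi>: "is_char (unz_sub B) \<phi>"
    show "cmod (\<phi> (unz_inc d)) \<le> 1" using *[OF \<phi>] by (metis norm_of_real)
  qed
  ultimately show ?thesis by (simp add: d_def)
qed

lemma Delta_sa': 
  assumes x: "adj x = x"
  shows "adj (\<Delta> x) = \<Delta> x" "norm (\<Delta> x) \<le> norm x"
proof -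
  have scaled: "adj (\<Delta> x) = \<Delta> x \<and> norm (\<Delta> x) \<le> t" if "norm x < t" for t
  proof -
    have t: "0 < t" using that norm_ge_zero[of x] by linarith
    have "adj (\<Delta> ((1 / t) *\<^sub>R x)) = \<Delta> ((1 / t) *\<^sub>R x) \<and> norm (\<Delta> ((1 / t) *\<^sub>R x)) \<le> 1"
      by (rule Delta_sa) (use x t that in \<open>auto simp: adj_scaleR\<close>)
    then show ?thesis using t by (simp add: Delta_scaleR adj_scaleR field_simps)
  qed
  show "adj (\<Delta> x) = \<Delta> x" using scaled[of "norm x + 1"] by simp
  show "norm (\<Delta> x) \<le> norm x" by (rule field_le_epsilon) (use scaled in auto)
qed

lemma Delta_adj: "\<Delta> (adj x) = adj (\<Delta> x)"
proof -
  obtain a b where ab: "adj a = a" "adj b = b" "x = a + cscale \<i> b" by (rule cscale_ii_parts[of x])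
  show ?thesis unfolding ab(3) using Delta_sa'(1)[OF ab(1)] Delta_sa'(1)[OF ab(2)]
    by (simp add: adj_add adj_cscale Delta_add Delta_cscale ab)
qed

text \<open>The factor 2 comes from bounding real and imaginary parts separately; it accounts for
  the halved tolerances in later estimates.\<close>

lemma norm_Delta_le: "norm (\<Delta> x) \<le> 2 * norm x"
proof -
  obtain a b where ab: "adj a = a" "adj b = b" "x = a + cscale \<i> b" "norm a \<le> norm x" "norm b \<le> norm x"
    by (rule cscale_ii_parts[of x])
  have "\<Delta> x = \<Delta> a + cscale \<i> (\<Delta> b)" unfolding ab(3) by (simp add: Delta_add Delta_cscale)
  then have "norm (\<Delta> x) \<le> norm (\<Delta> a) + norm (\<Delta> b)"
    using norm_triangle_ineq[of "\<Delta> a" "cscale \<i> (\<Delta> b)"] by (simp add: norm_cscale)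
  with Delta_sa'(2)[OF ab(1)] Delta_sa'(2)[OF ab(2)] ab(4,5) show ?thesis by linarith
qed

lemma bounded_linear_Delta: "bounded_linear \<Delta>"
  by (rule bounded_linear_intro[where K = 2])
    (use norm_Delta_le in \<open>auto simp: Delta_add Delta_scaleR mult.commute\<close>)

text \<open>The two-sided bimodule rule cannot be used with 1 on the left. It does show that the
  difference \<open>z\<close> satisfies \<open>c * z * c' = 0\<close> for all \<open>c\<close> and
  \<open>c'\<close> in \<open>B\<close>; \<open>c = adj z\<close> and \<open>c' = adj z * z\<close>
  then force \<open>z = 0\<close>.\<close>

lemma Delta_mult_right: assumes b: "b \<in> B" shows "\<Delta> (x * b) = \<Delta> x * b"
proof -
  define z where "z = \<Delta> (x * b) - \<Delta> x * b"
  have z: "z \<in> B" using b by (simp add: z_def B Delta_in)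
  have "c * z * c' = 0" if c: "c \<in> B" "c' \<in> B" for c c'
  proof -
    have "c * \<Delta> (x * b) * c' = \<Delta> (c * (x * b) * c')" using c by (simp only: Delta_bimodule)
    also have "\<dots> = \<Delta> (c * x * (b * c'))" by (simp only: mult.assoc)
    also have "\<dots> = c * (\<Delta> x * b) * c'" using c b by (simp only: Delta_bimodule B(3)) (simp only: mult.assoc)
    finally show ?thesis by (simp add: z_def algebra_simps)
  qed
  from this[OF B(4)[OF z] B(3)[OF B(4)[OF z] z]] have "(adj z * z) * (adj z * z) = 0"
    by (simp add: mult.assoc)
  then have "adj z * z = 0" using adj_mult_self_eq_0[of "adj z * z"] by (simp add: adj_mult adj_adj)
  then show ?thesis using adj_mult_self_eq_0[of z] by (simp add: z_def)
qed

end

section \<open>Ideals in Cartan inclusions\<close>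

text \<open>Topologically: if \<open>v\<close> moves a point of the support of \<open>c\<close>, then some nonzero \<open>c k\<close> is
  supported on a set which \<open>v\<close> moves off itself; otherwise \<open>c v b c\<close> commutes with \<open>S\<close>.\<close>

lemma (in unital_abelian) normalizer_commutes_or_moves:
  assumes K: "K \<subseteq> S" "\<And>k s. k \<in> K \<Longrightarrow> s \<in> S \<Longrightarrow> k * s \<in> K" "\<And>k. k \<in> K \<Longrightarrow> adj k \<in> K"
    and v: "\<And>k. k \<in> K \<Longrightarrow> v * k * adj v \<in> K" "\<And>k. k \<in> K \<Longrightarrow> adj v * k * v \<in> K"
    and c: "c \<in> K" and fixed: "\<And>k. k \<in> K \<Longrightarrow> c * k \<noteq> 0 \<Longrightarrow> \<exists>b\<in>K. (c * k) * v * b * (c * k) \<noteq> 0"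
    and b: "b \<in> K" and f: "f \<in> R"
  shows "f * (c * v * b * c) = (c * v * b * c) * f"
proof -
  have KS: "k \<in> K \<Longrightarrow> k \<in> S" for k using K(1) by blast
  \<comment> \<open>In terms of supports, \<open>v\<close> moves no point under \<open>c\<close>, so
    it cannot carry \<open>c * s\<close> below a \<open>g\<close> that is disjoint from it.
    Otherwise \<open>c * (s * k)\<close> would be nonzero, and the product supplied by
    \<open>fixed\<close> would contain the factor \<open>g * (c * s)\<close>.\<close>
  have local: "g * v * (c * s) = 0" if g: "g \<in> K" and s: "s \<in> S" and 0: "g * (c * s) = 0" for g s
  proof -
    define k where "k = adj v * (adj g * g) * v"
    have k: "k \<in> K" unfolding k_def by (intro v K(2) K(3) g KS)
    have "c * (s * k) = 0"
    proof (rule ccontr)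
      assume "c * (s * k) \<noteq> 0"
      moreover have "s * k \<in> K" using K(2)[OF k s] comm[OF s KS[OF k]] by simp
      ultimately obtain b where b: "b \<in> K" "(c * (s * k)) * v * b * (c * (s * k)) \<noteq> 0" using fixed by blast
      have ck: "c * (s * k) = k * (c * s)"
        using comm[OF S(3)[OF KS[OF c] s] KS[OF k]] by (simp add: mult.assoc)
      define t where "t = v * b * adj v"
      have t: "t \<in> S" using v(1)[OF b(1)] KS by (simp add: t_def)
      have "(c * (s * k)) * v * b * (c * (s * k)) = k * ((c * s) * (t * (adj g * (g * (v * (c * s))))))"
        by (simp add: ck) (simp add: k_def t_def mult.assoc)
      also have "(c * s) * (t * (adj g * (g * (v * (c * s))))) = t * (adj g * ((g * (c * s)) * (v * (c * s))))"
      proof -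
        have cs: "c * s \<in> S" and gs: "adj g \<in> S" "g \<in> S" by (intro S(3,4) KS c s g)+
        have "(c * s) * (t * (adj g * (g * X))) = t * (adj g * ((g * (c * s)) * X))" for X
          using left_comm[OF cs t] left_comm[OF cs gs(1)] left_comm[OF cs gs(2)] by (simp only: mult.assoc)
        then show ?thesis .
      qed
      also have "\<dots> = 0" by (simp add: 0)
      finally show False using b(2) by simp
    qed
    moreover have "c * (s * k) = k * (c * s)"
      using comm[OF S(3)[OF KS[OF c] s] KS[OF k]] by (simp add: mult.assoc)
    ultimately have "adj (g * v * (c * s)) * (g * v * (c * s)) = 0"
      by (simp add: k_def adj_mult mult.assoc)
    then show ?thesis by (simp add: adj_mult_self_eq_0)
  qed
  define w where "w = c * v * b * c"
  have wxw: "w * x * adj w \<in> S" if x: "x \<in> S" for x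
  proof -
    have "b * (c * (x * (adj c * adj b))) \<in> K" by (intro K(2,3) b S KS c x)
    then have "v * (b * (c * (x * (adj c * adj b)))) * adj v \<in> S" by (intro KS v)
    from S(3)[OF S(3)[OF KS[OF c] this] KS[OF K(3)[OF c]]]
    show ?thesis by (simp add: w_def adj_mult mult.assoc)
  qed
  have ww: "w * adj w \<in> S" using wxw[OF one] by simp
  \<comment> \<open>\<open>z\<close> itself need not lie in \<open>S\<close>, but
    \<open>z * adj z\<close> does, so characters can test it.\<close>
  define z where "z = f * w - w * f"
  have fS: "f \<in> S" and fa: "adj f = f" using f by (simp_all add: R_sub R_adj)
  have zz: "z * adj z = f * (w * adj w) * f - f * (w * f * adj w) - (w * f * adj w) * f + w * (f * f) * adj w"
    by (simp add: z_def adj_diff adj_mult fa algebra_simps)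
  have "z * adj z = 0"
  proof (rule char_eqI)
    show "z * adj z \<in> S" unfolding zz by (intro S(3,6,7) fS ww wxw)
    show "0 \<in> S" by (rule S)
    fix \<phi> assume \<phi>: "is_char S \<phi>"
    \<comment> \<open>Under \<open>\<phi>\<close> the outer factors \<open>f\<close> may be replaced
      by the number \<open>s\<close>, which turns \<open>z\<close> into
      \<open>- w * (f - s)\<close>. This is the content of \<open>\<phi>m\<close>.\<close>
    define s where "s = Re (\<phi> f)"
    have \<phi>f: "\<phi> f = of_real s" unfolding s_def by (rule char_real[OF \<phi> f])
    define m where "m = f - of_real s"
    have mR: "m \<in> R" unfolding m_def by (intro R_closed f)
    have "w * (m * m) * adj w = w * (f * f) * adj w - (2 * s) *\<^sub>R (w * f * adj w) + (s * s) *\<^sub>R (w * adj w)"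
    proof -
      have two: "(s * 2) *\<^sub>R x = s *\<^sub>R x + s *\<^sub>R x" for x :: 'a by (metis mult_2_right scaleR_add_left)
      show ?thesis by (simp add: m_def algebra_simps of_real_def two)
    qed
    then have m1: "\<phi> (w * (m * m) * adj w)
      = \<phi> (w * (f * f) * adj w) - of_real (2 * s) * \<phi> (w * f * adj w) + of_real (s * s) * \<phi> (w * adj w)"
      by (simp only: charD(1,7,10)[OF \<phi>] S(3,6,7,9) wxw ww fS)
    have m2: "\<phi> (z * adj z) = of_real s * \<phi> (w * adj w) * of_real s - of_real s * \<phi> (w * f * adj w)
      - \<phi> (w * f * adj w) * of_real s + \<phi> (w * (f * f) * adj w)"
      unfolding zz by (simp only: charD(1,2,10)[OF \<phi>] S(3,6,7) wxw ww fS \<phi>f)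
    have \<phi>m: "\<phi> (w * (m * m) * adj w) = \<phi> (z * adj z)"
      unfolding m1 m2 by (simp add: algebra_simps)
    have le: "cmod (\<phi> (z * adj z)) \<le> (norm w)\<^sup>2 * e\<^sup>2" if e: "0 < e" for e
    proof -
      \<comment> \<open>\<open>F\<close> is a bump around the level \<open>s\<close> of
        \<open>f\<close>, and \<open>r\<close> is \<open>m\<close> truncated to
        \<open>[- e, e]\<close>. The remainder \<open>G = m - r\<close> vanishes where
        \<open>F\<close> does not, so \<open>local\<close> gives \<open>F * w * G = 0\<close>: next
        to \<open>F\<close>, \<open>w * m\<close> may be replaced by \<open>w * r\<close>, whose
        norm is at most \<open>e * norm w\<close>.\<close>
      have c1: "continuous_on UNIV (\<lambda>t. max 0 (e - \<bar>t - s\<bar>))" by (intro continuous_intros)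
      have c2: "continuous_on UNIV (\<lambda>t. max (- e) (min e (t - s)))" by (intro continuous_intros)
      obtain F where F: "F \<in> R" "\<And>\<psi>. is_char S \<psi> \<Longrightarrow> \<psi> F = of_real (max 0 (e - \<bar>Re (\<psi> f) - s\<bar>))"
        using functional_calculus[OF c1 f] by blast
      obtain r where r: "r \<in> R" "\<And>\<psi>. is_char S \<psi> \<Longrightarrow> \<psi> r = of_real (max (- e) (min e (Re (\<psi> f) - s)))"
        using functional_calculus[OF c2 f] by blast
      define G where "G = m - r"
      have G: "G \<in> R" unfolding G_def by (intro R_closed mR r)
      have FG: "F * G = 0"
      proof (rule char_eqI)
        fix \<psi> assume \<psi>: "is_char S \<psi>"
        define t where "t = Re (\<psi> f)"
        have rS: "r \<in> S" "f - of_real s \<in> S" "f \<in> S" "of_real s \<in> S" "F \<in> S" "G \<in> S"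
          using r F G f by (auto intro: R_sub R_closed)
        have "\<psi> G = of_real t - of_real s - of_real (max (- e) (min e (t - s)))"
          unfolding G_def m_def charD(10)[OF \<psi> rS(2,1)] charD(10)[OF \<psi> rS(3,4)] charD(11)[OF \<psi>] r(2)[OF \<psi>]
          using char_real[OF \<psi> f] by (simp add: t_def)
        then have "\<psi> (F * G) = of_real (max 0 (e - \<bar>t - s\<bar>) * (t - s - max (- e) (min e (t - s))))"
          using charD(2)[OF \<psi> rS(5,6)] F(2)[OF \<psi>] by (simp add: t_def)
        also have "max 0 (e - \<bar>t - s\<bar>) * (t - s - max (- e) (min e (t - s))) = 0"
          by (cases "\<bar>t - s\<bar> < e") auto
        finally show "\<psi> (F * G) = \<psi> 0" by (simp add: charD(8)[OF \<psi>])
      qed (simp_all add: R_sub F(1) G S)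
      have "F * c \<in> K" using K(2)[OF c R_sub[OF F(1)]] comm[OF R_sub[OF F(1)] KS[OF c]] by simp
      moreover have "b * G \<in> S" using b G by (intro S(3) KS R_sub)
      moreover have "(F * c) * (c * (b * G)) = 0"
      proof -
        have "(F * c) * (c * (b * G)) = (c * (c * b)) * (F * G)"
          using left_comm[of F c] left_comm[of F b] R_sub[OF F(1)] KS[OF c] KS[OF b] by (simp only: mult.assoc)
        then show ?thesis by (simp add: FG)
      qed
      ultimately have "(F * c) * v * (c * (b * G)) = 0" by (rule local)
      moreover have "c * (b * G) = b * (c * G)" using left_comm[OF KS[OF c] KS[OF b]] .
      ultimately have "F * w * G = 0" by (simp add: w_def mult.assoc)
      then have Fwm: "F * w * m = F * w * r" by (simp add: G_def algebra_simps)
      have "F * (w * (m * m) * adj w) * F = (F * w * m) * adj (F * w * m)"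
        using F mR by (simp add: adj_mult R_adj mult.assoc)
      also have "\<dots> = F * (w * (r * r) * adj w) * F"
        unfolding Fwm using F r by (simp add: adj_mult R_adj mult.assoc)
      finally have "\<phi> (F * (w * (m * m) * adj w) * F) = \<phi> (F * (w * (r * r) * adj w) * F)" by simp
      then have "\<phi> F * \<phi> (w * (m * m) * adj w) * \<phi> F = \<phi> F * \<phi> (w * (r * r) * adj w) * \<phi> F"
        using wxw[of "m * m"] wxw[of "r * r"] R_sub[OF F(1)] R_sub[OF mR] R_sub[OF r(1)] by (simp add: charD[OF \<phi>] S)
      moreover have "\<phi> F \<noteq> 0" using e by (simp add: F(2)[OF \<phi>] \<phi>f)
      ultimately have "\<phi> (z * adj z) = \<phi> (w * (r * r) * adj w)" by (simp add: \<phi>m)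
      also have "cmod \<dots> \<le> norm (w * (r * r) * adj w)"
        by (intro charD(6)[OF \<phi>] wxw S(3) R_sub r)
      also have "\<dots> \<le> norm w * (norm r * norm r) * norm w"
        by (intro order_trans[OF norm_mult_ineq] mult_mono) auto
      also have "norm r \<le> e"
      proof (rule norm_le_char[OF R_sub[OF r(1)]])
        fix \<psi> assume \<psi>: "is_char S \<psi>"
        show "cmod (\<psi> r) \<le> e" unfolding r(2)[OF \<psi>] norm_of_real using e by auto
      qed
      then have "norm w * (norm r * norm r) * norm w \<le> norm w * (e * e) * norm w"
        using e by (intro mult_mono) auto
      finally show ?thesis by (simp add: power2_eq_square ac_simps)
    qed
    have "cmod (\<phi> (z * adj z)) \<le> 0 + d" if "0 < d" for d
    proof -
      have w1: "0 < (norm w)\<^sup>2 + 1" by (rule add_nonneg_pos) simp_all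
      define e where "e = sqrt (d / ((norm w)\<^sup>2 + 1))"
      have e: "0 < e" "e\<^sup>2 = d / ((norm w)\<^sup>2 + 1)" using that w1 by (simp_all add: e_def)
      have "(norm w)\<^sup>2 * e\<^sup>2 \<le> ((norm w)\<^sup>2 + 1) * e\<^sup>2" by (intro mult_right_mono) auto
      also have "\<dots> = d" using w1 by (simp add: e)
      finally show ?thesis using le[OF e(1)] by simp
    qed
    then have "cmod (\<phi> (z * adj z)) \<le> 0" by (rule field_le_epsilon)
    then show "\<phi> (z * adj z) = \<phi> 0" by (simp add: charD(8)[OF \<phi>])
  qed
  then show ?thesis by (simp add: mult_adj_self_eq_0 z_def w_def)
qed

text \<open>Adjoining to \<open>B\<close> a self-adjoint element that commutes with it keeps the
  algebra abelian, so maximality absorbs it; this is applied to the two parts of \<open>x\<close>.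
  The premise speaks of self-adjoint \<open>b\<close> because
  \<open>normalizer_commutes_or_moves\<close> delivers commutation with these.\<close>

lemma maximal_abelian_commutant:
  assumes B: "maximal_abelian B" and x: "\<And>b. b \<in> B \<Longrightarrow> adj b = b \<Longrightarrow> b * x = x * b"
  shows "x \<in> B"
proof -
  have sub: "cstar_subalgebra B" and ab: "abelian B" using B by (auto simp: maximal_abelian_def)
  have sa: "y \<in> B" if y: "adj y = y" "\<And>b. b \<in> B \<Longrightarrow> b * y = y * b" for y
  proof -
    have "abelian (cstar_gen (insert y B))"
      by (rule abelian_cstar_gen) (use y ab cstar_subalgebraD(4)[OF sub] in \<open>auto simp: abelian_def\<close>)
    then have "cstar_gen (insert y B) = B"
      using B cstar_subalgebra_gen[of "insert y B"] cstar_gen_superset[of "insert y B"]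
      by (auto simp: maximal_abelian_def)
    then show ?thesis using cstar_gen_superset[of "insert y B"] by auto
  qed
  have comm: "b * x = x * b" if "b \<in> B" for b
  proof -
    obtain p q where pq: "adj p = p" "adj q = q" "b = p + cscale \<i> q"
      "p = (1/2) *\<^sub>R (b + adj b)" "q = cscale (-\<i>/2) (b - adj b)" by (rule cscale_ii_parts[of b])
    have "p \<in> B" "q \<in> B" unfolding pq(4,5) by (intro cstar_subalgebraD[OF sub] that)+
    then show ?thesis unfolding pq(3)
      using x pq(1,2) by (simp add: distrib_left distrib_right cscale_mult_left cscale_mult_right)
  qed
  have comm': "b * adj x = adj x * b" if "b \<in> B" for b
  proof -
    have "adj (adj b * x) = adj (x * adj b)" using comm[OF cstar_subalgebraD(4)[OF sub that]] by simp
    then show ?thesis by (simp add: adj_mult adj_adj)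
  qed
  obtain p q where pq: "adj p = p" "adj q = q" "x = p + cscale \<i> q"
    "p = (1/2) *\<^sub>R (x + adj x)" "q = cscale (-\<i>/2) (x - adj x)" by (rule cscale_ii_parts[of x])
  have "p \<in> B" by (rule sa[OF pq(1)]) (simp add: pq(4) algebra_simps comm comm')
  moreover have "q \<in> B"
    by (rule sa[OF pq(2)]) (simp add: pq(5) algebra_simps comm comm' cscale_mult_left cscale_mult_right)
  ultimately show ?thesis unfolding pq(3) by (intro cstar_subalgebraD[OF sub])
qed

locale cartan_inclusion = cond_exp +
  assumes masa: "maximal_abelian B" and regular: "closure (cspan (normalizers B)) = UNIV"
begin

text \<open>It says that \<open>x\<close> and \<open>\<Delta> x\<close> agree after compression to
  the support of \<open>c\<close>. The inserted \<open>b\<close> makes the property pass from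
  \<open>c\<close> to \<open>c * l\<close>: moving \<open>l\<close> through the compression leaves a
  factor in the middle, which \<open>b\<close> absorbs.\<close>

definition local_at :: "'a \<Rightarrow> 'a \<Rightarrow> bool" where
  "local_at c x \<longleftrightarrow> (\<forall>b\<in>B. c * x * b * c = c * \<Delta> x * b * c)"

lemma local_at_mult:
  assumes "local_at c x" "c \<in> B" "l \<in> B" shows "local_at (c * l) x"
  unfolding local_at_def
proof
  fix b assume b: "b \<in> B"
  have "c * x * (b * l) * c = c * \<Delta> x * (b * l) * c" using assms(1) b assms(3) by (simp add: local_at_def B)
  then have "l * (c * x * (b * l) * c) = l * (c * \<Delta> x * (b * l) * c)" by simp
  moreover have "(c * l) * y * b * (c * l) = l * (c * y * (b * l) * c)" for y
  proof -
    have "c * l = l * c" using B_comm assms(2,3) by blast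
    then have "(c * l) * y * b * (c * l) = (l * c) * y * b * (l * c)" by simp
    then show ?thesis by (simp add: mult.assoc)
  qed
  ultimately show "c * l * x * b * (c * l) = c * l * \<Delta> x * b * (c * l)" by simp
qed

text \<open>If \<open>v\<close> moves the support of some \<open>c * k\<close> off itself, both
  compressions vanish. Otherwise every \<open>c * v * b * c\<close> commutes with \<open>B\<close>,
  lies in \<open>B\<close> by maximality and is fixed by \<open>\<Delta>\<close>.\<close>

lemma normalizer_local_at:
  assumes v: "v \<in> normalizers B" and c: "c \<in> B" "c \<noteq> 0"
  shows "\<exists>k\<in>B. c * k \<noteq> 0 \<and> local_at (c * k) v"
proof (cases "\<exists>k\<in>B. c * k \<noteq> 0 \<and> (\<forall>b\<in>B. (c * k) * v * b * (c * k) = 0)")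
  case True
  then obtain k where k: "k \<in> B" "c * k \<noteq> 0" "\<And>b. b \<in> B \<Longrightarrow> (c * k) * v * b * (c * k) = 0" by blast
  have ck: "c * k \<in> B" using B c k by simp
  have "local_at (c * k) v"
    unfolding local_at_def
  proof
    fix b assume b: "b \<in> B"
    have "(c * k) * \<Delta> v * (b * (c * k)) = \<Delta> ((c * k) * v * (b * (c * k)))"
      by (rule Delta_bimodule[symmetric]) (simp_all add: b ck B)
    also have "\<dots> = 0" using k(3)[OF b] Delta_zero by (simp add: mult.assoc)
    finally show "(c * k) * v * b * (c * k) = (c * k) * \<Delta> v * b * (c * k)"
      using k(3)[OF b] by (simp add: mult.assoc)
  qed
  with k show ?thesis by blast
next
  case False
  have vb: "v * k * adj v \<in> B" "adj v * k * v \<in> B" if "k \<in> B" for k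
    using v that by (simp_all add: normalizers_def)
  have cvb: "c * v * b * c \<in> B" if b: "b \<in> B" for b
  proof (rule maximal_abelian_commutant[OF masa])
    fix f assume f: "f \<in> B" "adj f = f"
    have "unz_inc f * (unz_inc c * unz_inc v * unz_inc b * unz_inc c)
      = (unz_inc c * unz_inc v * unz_inc b * unz_inc c) * unz_inc f"
    proof (rule U.normalizer_commutes_or_moves[where K = "unz_inc ` B"])
      show "unz_inc ` B \<subseteq> unz_sub B" by auto
      show "k * s \<in> unz_inc ` B" if "k \<in> unz_inc ` B" "s \<in> unz_sub B" for k s
      proof -
        obtain x where x: "k = unz_inc x" "x \<in> B" using \<open>k \<in> unz_inc ` B\<close> by blast
        have "k * s = s * k" using that U.comm x by simp
        also have "\<dots> = unz_inc (unz_act s x)" by (simp add: x unz_mult_inc)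
        finally show ?thesis using x that(2) by (auto simp: unz_act_def unz_sub_def B)
      qed
      show "unz_inc v * k * adj (unz_inc v) \<in> unz_inc ` B" "adj (unz_inc v) * k * unz_inc v \<in> unz_inc ` B"
        if "k \<in> unz_inc ` B" for k
        using that vb by (auto simp flip: unz_inc_simps)
      show "\<exists>b\<in>unz_inc ` B. unz_inc c * k * unz_inc v * b * (unz_inc c * k) \<noteq> 0"
        if k: "k \<in> unz_inc ` B" "unz_inc c * k \<noteq> 0" for k
      proof -
        obtain x where x: "k = unz_inc x" "x \<in> B" using k by blast
        have "c * x \<noteq> 0" using k(2) unfolding x by (auto simp: unz_inc_simps simp flip: unz_inc_simps(3))
        then obtain b where "b \<in> B" "(c * x) * v * b * (c * x) \<noteq> 0" using False x by blast
        moreover have "unz_inc y \<noteq> 0" if "y \<noteq> 0" for y :: 'a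
          using that unz_inc_eq_iff[of y 0] by (simp add: unz_inc_simps)
        ultimately show ?thesis unfolding x by (intro bexI[of _ "unz_inc b"]) (simp_all flip: unz_inc_simps)
      qed
    qed (use c b f in \<open>auto simp: unz_inc_R B simp flip: unz_inc_simps\<close>)
    then have "unz_inc (f * (c * v * b * c)) = unz_inc ((c * v * b * c) * f)" by (simp only: unz_inc_simps)
    then show "f * (c * v * b * c) = (c * v * b * c) * f" by simp
  qed
  have "local_at c v"
    unfolding local_at_def
  proof
    fix b assume b: "b \<in> B"
    have "c * v * b * c = \<Delta> (c * v * (b * c))" using Delta_id[OF cvb[OF b]] by (simp add: mult.assoc)
    also have "\<dots> = c * \<Delta> v * (b * c)" by (rule Delta_bimodule) (simp_all add: b c B)
    finally show "c * v * b * c = c * \<Delta> v * b * c" by (simp add: mult.assoc)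
  qed
  \<comment> \<open>The conclusion asks for a factor \<open>k\<close> from \<open>B\<close>, and
    \<open>B\<close> may have no unit; \<open>adj c\<close> serves because \<open>c * adj c\<close>
    is nonzero.\<close>
  then have "local_at (c * adj c) v" using c by (intro local_at_mult B)
  moreover have "c * adj c \<noteq> 0" using c by (simp add: mult_adj_self_eq_0)
  ultimately show ?thesis using B(4)[OF c(1)] by blast
qed

lemma finite_normalizers_local_at:
  assumes "finite F" "F \<subseteq> normalizers B" "c \<in> B" "c \<noteq> 0"
  shows "\<exists>k\<in>B. c * k \<noteq> 0 \<and> (\<forall>v\<in>F. local_at (c * k) v)"
  using assms
proof (induction F)
  case empty
  then have "c * adj c \<noteq> 0" by (simp add: mult_adj_self_eq_0)
  with B(4)[OF empty(2)] show ?case by auto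
next
  case (insert v F)
  then obtain k where k: "k \<in> B" "c * k \<noteq> 0" "\<forall>v\<in>F. local_at (c * k) v" by auto
  have ck: "c * k \<in> B" using k insert.prems by (simp add: B)
  obtain l where l: "l \<in> B" "c * k * l \<noteq> 0" "local_at (c * k * l) v"
    using normalizer_local_at[OF _ ck k(2)] insert.prems by blast
  have "\<forall>u\<in>F. local_at (c * k * l) u" using k(3) local_at_mult ck l(1) by blast
  then show ?case using k(1) l B(3) by (intro bexI[of _ "k * l"]) (simp_all add: mult.assoc)
qed

lemma cspan_local_at:
  assumes "s \<in> cspan (normalizers B)" "c \<in> B" "c \<noteq> 0"
  shows "\<exists>k\<in>B. c * k \<noteq> 0 \<and> local_at (c * k) s"
proof -
  obtain F a where F: "finite F" "F \<subseteq> normalizers B" "s = (\<Sum>x\<in>F. cscale (a x) x)"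
    using assms(1) by (auto simp: cspan_def)
  obtain k where k: "k \<in> B" "c * k \<noteq> 0" "\<forall>v\<in>F. local_at (c * k) v"
    using finite_normalizers_local_at[OF F(1,2) assms(2,3)] by blast
  have "local_at d (\<Sum>x\<in>F. cscale (a x) x)" if "\<forall>v\<in>F. local_at d v" for d
    using F(1) that
  proof (induction F)
    case (insert v F)
    then show ?case
      by (simp add: local_at_def Delta_add Delta_cscale distrib_left distrib_right cscale_mult_left cscale_mult_right)
  qed (simp add: local_at_def Delta_zero)
  with k show ?thesis unfolding F(3) by blast
qed

end

lemma (in abelian_subalgebra) char_of_adj_mult:
  assumes "is_char (unz_sub B) \<phi>" "x \<in> B"
  shows "\<phi> (unz_inc (adj x * x)) = of_real ((cmod (\<phi> (unz_inc x)))\<^sup>2)"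
  using assms complex_norm_square[of "\<phi> (unz_inc x)"]
  by (simp add: unz_inc_simps U.charD U.S mult.commute)

context cartan_inclusion
begin

theorem closed_ideal_meets_cartan:
  assumes I: "closed_ideal_in UNIV I" and a: "a \<in> I" "a \<noteq> 0"
  obtains y where "y \<in> I" "y \<in> B" "y \<noteq> 0"
proof -
  have I': "csubspace I" "closed I" "\<And>s x. x \<in> I \<Longrightarrow> s * x \<in> I" "\<And>s x. x \<in> I \<Longrightarrow> x * s \<in> I"
    using I by (auto simp: closed_ideal_in_def)
  define a' where "a' = adj a * a"
  have a': "a' \<in> I" using I'(3)[OF a(1)] by (simp add: a'_def)
  define p where "p = \<Delta> a'"
  have p0: "p \<noteq> 0" using Delta_faithful[of a] a by (auto simp: p_def a'_def)
  have pB: "p \<in> B" by (simp add: p_def Delta_in)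
  \<comment> \<open>The values of \<open>q\<close> are squared moduli, hence nonnegative, and
    \<open>adj p\<close> times an inverse of \<open>q\<close> is an inverse of \<open>p\<close>;
    this is the origin of \<open>d\<close>.\<close>
  define q where "q = adj p * p"
  have q: "q \<in> B" "adj q = q" using pB by (simp_all add: q_def B adj_mult adj_adj)
  define \<rho> where "\<rho> = (norm p)\<^sup>2"
  have \<rho>: "0 < \<rho>" "norm q = \<rho>" using p0 by (simp_all add: \<rho>_def q_def cstar_identity)
  have \<phi>q: "\<phi> (unz_inc q) = of_real (Re (\<phi> (unz_inc q))) \<and> 0 \<le> Re (\<phi> (unz_inc q))"
    if "is_char (unz_sub B) \<phi>" for \<phi>
    using char_of_adj_mult[OF that pB] by (simp add: q_def)
  \<comment> \<open>A continuous substitute for the reciprocal: it vanishes at 0, as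
    \<open>functional_calculus0\<close> requires, equals \<open>1 / t\<close> for
    \<open>\<bar>t\<bar> \<ge> r\<close>, and is bounded by \<open>1 / r\<close>.\<close>
  define g :: "real \<Rightarrow> real \<Rightarrow> real" where "g r t = t / max (t\<^sup>2) (r\<^sup>2)" for r t
  have g_cont: "continuous_on UNIV (g r)" if "0 < r" for r
    unfolding g_def using that by (intro continuous_intros) (auto simp: max_def)
  have g_eq: "t * g r t = 1" if "0 < r" "r \<le> t" for r t
  proof -
    have "r\<^sup>2 \<le> t\<^sup>2" using that by (intro power_mono) auto
    then show ?thesis using that by (simp add: g_def max_def power2_eq_square)
  qed
  have g_le: "\<bar>g r t\<bar> \<le> 1 / r" if "0 < r" for r t
  proof -
    have "r * \<bar>t\<bar> \<le> max (t\<^sup>2) (r\<^sup>2)"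
    proof (cases "r \<le> \<bar>t\<bar>")
      case True
      then have "r * \<bar>t\<bar> \<le> \<bar>t\<bar> * \<bar>t\<bar>" by (intro mult_right_mono) auto
      then show ?thesis by (simp add: power2_eq_square le_max_iff_disj)
    next
      case False
      then have "r * \<bar>t\<bar> \<le> r * r" using that by (intro mult_left_mono) auto
      then show ?thesis by (simp add: power2_eq_square le_max_iff_disj)
    qed
    moreover have "0 < max (t\<^sup>2) (r\<^sup>2)" using that by (simp add: less_max_iff_disj)
    ultimately show ?thesis using that by (simp add: g_def abs_mult field_simps)
  qed
  have bump: "continuous_on UNIV (\<lambda>t. max 0 (t - r))" for r :: real by (intro continuous_intros)
  have bump0: "max 0 (0 - r) = 0" if "0 < r" for r :: real using that by simp
  have g0: "g r 0 = 0" for r by (simp add: g_def)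
  have nonzero: "y \<noteq> 0"
    if y: "\<And>\<phi>. is_char (unz_sub B) \<phi> \<Longrightarrow> \<phi> (unz_inc y) = of_real (max 0 (Re (\<phi> (unz_inc x)) - norm x / 2))"
      and x: "x = adj z * z" "z \<in> B" "x \<noteq> 0" for x y z
  proof
    assume "y = 0"
    have "unz_inc x \<in> unz_sub B" using x by (simp add: B)
    then obtain \<phi> where \<phi>: "is_char (unz_sub B) \<phi>" "cmod (\<phi> (unz_inc x)) = norm (unz_inc x)"
      by (rule U.exists_char_norm)
    have "Re (\<phi> (unz_inc x)) = norm x"
      using \<phi>(2) char_of_adj_mult[OF \<phi>(1) x(2)] by (simp add: x(1) norm_mult flip: of_real_power)
    then have "\<phi> (unz_inc y) = of_real (norm x / 2)" unfolding y[OF \<phi>(1)] by (simp add: max_def)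
    with x(3) \<open>y = 0\<close> show False by (simp add: U.charD(8)[OF \<phi>(1)] unz_inc_simps)
  qed
  obtain c0 where c0: "c0 \<in> B" "\<And>\<phi>. is_char (unz_sub B) \<phi> \<Longrightarrow> \<phi> (unz_inc c0) = of_real (max 0 (Re (\<phi> (unz_inc q)) - \<rho> / 2))"
    using functional_calculus0[OF bump bump0 q, of "\<rho> / 2"] \<rho>(1) by auto
  have c0_nz: "c0 \<noteq> 0" by (rule nonzero[of c0 q p]) (use c0 \<rho> pB in \<open>auto simp: q_def\<close>)
  have \<rho>2: "0 < \<rho> / 2" using \<rho> by simp
  obtain D where D: "D \<in> B" "\<And>\<phi>. is_char (unz_sub B) \<phi> \<Longrightarrow> \<phi> (unz_inc D) = of_real (g (\<rho> / 2) (Re (\<phi> (unz_inc q))))"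
    using functional_calculus0[OF g_cont[OF \<rho>2] g0 q] by blast
  define d where "d = adj p * D"
  have dB: "d \<in> B" using pB D by (simp add: d_def B)
  have c0pd: "c0 * (p * d) = c0"
  proof -
    have "c0 * (p * d) = c0 * (q * D)"
      using B_comm[OF pB B(4)[OF pB]] by (simp add: d_def q_def flip: mult.assoc)
    also have "\<dots> = c0"
    proof (rule B_eqI)
      fix \<phi> assume \<phi>: "is_char (unz_sub B) \<phi>"
      define t where "t = Re (\<phi> (unz_inc q))"
      have "\<phi> (unz_inc q) = of_real t" using \<phi>q[OF \<phi>] by (simp add: t_def)
      then have "\<phi> (unz_inc (c0 * (q * D))) = of_real (max 0 (t - \<rho> / 2) * (t * g (\<rho> / 2) t))"
        using q D c0 by (simp add: unz_inc_simps U.charD[OF \<phi>] U.S c0(2)[OF \<phi>] D(2)[OF \<phi>] flip: t_def)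
      also have "max 0 (t - \<rho> / 2) * (t * g (\<rho> / 2) t) = max 0 (t - \<rho> / 2)"
        using g_eq[OF \<rho>2, of t] by (cases "\<rho> / 2 \<le> t") auto
      finally show "\<phi> (unz_inc (c0 * (q * D))) = \<phi> (unz_inc c0)" by (simp add: c0(2)[OF \<phi>] t_def)
    qed (use c0 q D in \<open>simp_all add: B\<close>)
    finally show ?thesis .
  qed
  have "norm D \<le> 1 / (\<rho> / 2)"
    by (rule B_norm_le[OF D(1)]) (use g_le[OF \<rho>2] in \<open>simp add: D(2)\<close>)
  then have "norm p * norm D \<le> norm p * (1 / (\<rho> / 2))" by (intro mult_left_mono) auto
  then have "norm d \<le> norm p * (1 / (\<rho> / 2))"
    using norm_mult_ineq[of "adj p" D] unfolding d_def norm_adj by linarith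
  also have "\<dots> = 2 / norm p" using p0 by (simp add: \<rho>_def power2_eq_square)
  finally have nd: "norm d \<le> 2 / norm p" .
  \<comment> \<open>Since \<open>norm d \<le> 2 / norm p\<close>, the errors
    \<open>2 * \<epsilon>\<close> from \<open>\<Delta>\<close> and \<open>\<epsilon>\<close> from
    \<open>s\<close> add up to \<open>6 * \<epsilon> / norm p = 3/4 < 1\<close>.\<close>
  define \<epsilon> where "\<epsilon> = norm p / 8"
  have \<epsilon>: "0 < \<epsilon>" using p0 by (simp add: \<epsilon>_def)
  have "a' \<in> closure (cspan (normalizers B))" using regular by simp
  then obtain s where s: "s \<in> cspan (normalizers B)" "norm (s - a') < \<epsilon>"
    using \<epsilon> unfolding closure_approachable dist_norm by blast
  obtain k where k: "k \<in> B" "c0 * k \<noteq> 0" "local_at (c0 * k) s"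
    using cspan_local_at[OF s(1) c0(1) c0_nz] by blast
  define c where "c = c0 * k"
  have c: "c \<in> B" "c \<noteq> 0" using k c0 by (simp_all add: c_def B)
  define m where "m = adj c * c"
  have m: "m \<in> B" "adj m = m" using c by (simp_all add: m_def B adj_mult adj_adj)
  have m_nz: "m \<noteq> 0" using c by (simp add: m_def adj_mult_self_eq_0)
  define \<mu> where "\<mu> = norm m / 2"
  have \<mu>: "0 < \<mu>" using m_nz by (simp add: \<mu>_def)
  obtain G where G: "G \<in> B" "\<And>\<phi>. is_char (unz_sub B) \<phi> \<Longrightarrow> \<phi> (unz_inc G) = of_real (g \<mu> (Re (\<phi> (unz_inc m))))"
    using functional_calculus0[OF g_cont[OF \<mu>] g0 m] by blast
  obtain c' where c': "c' \<in> B" "\<And>\<phi>. is_char (unz_sub B) \<phi> \<Longrightarrow> \<phi> (unz_inc c') = of_real (max 0 (Re (\<phi> (unz_inc m)) - \<mu>))"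
    using functional_calculus0[OF bump bump0[OF \<mu>] m] by blast
  have c'_nz: "c' \<noteq> 0" by (rule nonzero[of c' m c]) (use c' c m_nz in \<open>auto simp: m_def \<mu>_def\<close>)
  have \<phi>m: "\<phi> (unz_inc m) = of_real (Re (\<phi> (unz_inc m))) \<and> 0 \<le> Re (\<phi> (unz_inc m))"
    if "is_char (unz_sub B) \<phi>" for \<phi>
    using char_of_adj_mult[OF that c(1)] by (simp add: m_def)
  define l where "l = adj c * G"
  define e where "e = c * l"
  have lB: "l \<in> B" using c G by (simp add: l_def B)
  have eB: "e \<in> B" using c lB by (simp add: e_def B)
  have em: "e = m * G"
    using B_comm[OF c(1) B(4)[OF c(1)]] by (simp add: e_def l_def m_def flip: mult.assoc)
  have \<phi>e: "\<phi> (unz_inc e) = of_real (Re (\<phi> (unz_inc m)) * g \<mu> (Re (\<phi> (unz_inc m))))" if \<phi>: "is_char (unz_sub B) \<phi>" for \<phi>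
  proof -
    obtain t where t: "\<phi> (unz_inc m) = of_real t" using \<phi>m[OF \<phi>] by blast
    show ?thesis unfolding em using m G by (simp add: unz_inc_simps U.charD[OF \<phi>] G(2)[OF \<phi>] t)
  qed
  have ec': "e * c' = c'"
  proof (rule B_eqI)
    fix \<phi> assume \<phi>: "is_char (unz_sub B) \<phi>"
    define t where "t = Re (\<phi> (unz_inc m))"
    have "\<phi> (unz_inc (e * c')) = of_real ((t * g \<mu> t) * max 0 (t - \<mu>))"
      using eB c' by (simp add: unz_inc_simps U.charD[OF \<phi>] \<phi>e[OF \<phi>] c'(2)[OF \<phi>] flip: t_def)
    also have "(t * g \<mu> t) * max 0 (t - \<mu>) = max 0 (t - \<mu>)"
      using g_eq[OF \<mu>, of t] by (cases "\<mu> \<le> t") auto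
    finally show "\<phi> (unz_inc (e * c')) = \<phi> (unz_inc c')" by (simp add: c'(2)[OF \<phi>] t_def)
  qed (use eB c' in \<open>simp_all add: B\<close>)
  have ne: "norm e \<le> 1"
  proof (rule B_norm_le[OF eB])
    fix \<phi> assume \<phi>: "is_char (unz_sub B) \<phi>"
    define t where "t = Re (\<phi> (unz_inc m))"
    have "0 < max (t\<^sup>2) (\<mu>\<^sup>2)" using \<mu> by (simp add: less_max_iff_disj)
    then have "\<bar>t * g \<mu> t\<bar> \<le> 1" by (simp add: g_def power2_eq_square abs_mult divide_le_eq)
    then show "cmod (\<phi> (unz_inc e)) \<le> 1" unfolding \<phi>e[OF \<phi>] norm_of_real t_def .
  qed
  have "local_at e s" unfolding e_def by (rule local_at_mult) (use k lB c in \<open>simp_all add: c_def\<close>)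
  then have es: "e * s * d * e = e * \<Delta> s * d * e" using dB by (simp add: local_at_def)
  have pd: "p * d * c' = c'"
  proof -
    have "c' = c0 * (k * (l * c'))" using ec' by (simp add: e_def c_def mult.assoc)
    moreover have "p * d * (c0 * X) = c0 * X" for X
    proof -
      have "p * d * c0 = c0" using c0pd B_comm[OF c0(1) B(3)[OF pB dB]] by simp
      then show ?thesis by (simp flip: mult.assoc)
    qed
    ultimately show ?thesis by metis
  qed
  \<comment> \<open>On the support of \<open>c'\<close> both \<open>e\<close> and
    \<open>p * d\<close> act as 1, so \<open>c' - y * c'\<close> lies in \<open>I\<close>. Locality
    of \<open>s\<close> cancels the main terms of \<open>y\<close> and leaves only two approximation
    errors.\<close>
  define y where "y = e * p * d * e - e * a' * d * e"
  have "y = e * (p - \<Delta> s) * d * e + e * (s - a') * d * e"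
    using es by (simp add: y_def algebra_simps)
  moreover have sandwich: "norm (e * x * d * e) \<le> norm x * (2 / norm p)" for x
  proof -
    have "norm (e * x * d * e) \<le> norm (e * x * d) * 1"
      using ne by (intro order_trans[OF norm_mult_ineq] mult_left_mono) auto
    also have "\<dots> \<le> norm (e * x) * (2 / norm p)"
      using nd by (simp only: mult_1_right) (intro order_trans[OF norm_mult_ineq] mult_left_mono, auto)
    also have "\<dots> \<le> norm x * (2 / norm p)"
      using ne by (intro mult_right_mono order_trans[OF norm_mult_ineq]) (auto intro: mult_left_le_one_le)
    finally show ?thesis .
  qed
  ultimately have "norm y \<le> norm (p - \<Delta> s) * (2 / norm p) + norm (s - a') * (2 / norm p)"
    using norm_triangle_le add_mono by metis
  also have "\<dots> \<le> (2 * \<epsilon>) * (2 / norm p) + \<epsilon> * (2 / norm p)"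
  proof (intro add_mono mult_right_mono)
    have "p - \<Delta> s = \<Delta> (a' - s)" by (simp add: p_def Delta_diff)
    then show "norm (p - \<Delta> s) \<le> 2 * \<epsilon>"
      using norm_Delta_le[of "a' - s"] s(2) by (simp add: norm_minus_commute)
  qed (use s in auto)
  also have "\<dots> < 1" using p0 by (simp add: \<epsilon>_def)
  finally have ny: "norm y < 1" .
  have "y * c' = c' - e * a' * d * e * c'"
    using pd ec' by (simp add: y_def left_diff_distrib mult.assoc)
  then have "c' - y * c' = e * a' * d * e * c'" by simp
  then have step: "c' - y * c' \<in> I" using a' I'(3,4) by simp
  \<comment> \<open>Modulo \<open>I\<close> the element \<open>c'\<close> equals
    \<open>y * c'\<close>, hence every iterate \<open>z n\<close>, and these tend to 0. This avoids
    inverting \<open>1 - y\<close> in an algebra that may have no unit.\<close>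
  define z where "z n = ((*) y ^^ n) c'" for n
  have zI: "c' - z n \<in> I" for n
  proof (induction n)
    case 0
    show ?case by (simp add: z_def csubspace_zero[OF I'(1)])
  next
    case (Suc n)
    have E: "c' - z (Suc n) = (c' - y * c') + y * (c' - z n)" by (simp add: z_def algebra_simps)
    show ?case unfolding E by (rule csubspace_add[OF I'(1) step I'(3)[OF Suc]])
  qed
  have zn: "norm (z n) \<le> norm y ^ n * norm c'" for n
  proof (induction n)
    case (Suc n)
    have "norm (z (Suc n)) \<le> norm y * norm (z n)" by (simp add: z_def norm_mult_ineq)
    also have "\<dots> \<le> norm y * (norm y ^ n * norm c')" by (intro mult_left_mono Suc) simp
    finally show ?case by (simp add: mult.assoc)
  qed (simp add: z_def)
  have "(\<lambda>n. norm y ^ n * norm c') \<longlonglongrightarrow> 0"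
    using ny by (intro tendsto_mult_left_zero LIMSEQ_realpow_zero) auto
  then have "z \<longlonglongrightarrow> 0" by (rule Lim_null_comparison[rotated]) (simp add: zn)
  then have "(\<lambda>n. c' - z n) \<longlonglongrightarrow> c'" using tendsto_diff[OF tendsto_const, of z 0 sequentially c'] by simp
  from closed_sequentially[OF I'(2) zI this] have "c' \<in> I" .
  with c' c'_nz that show ?thesis by blast
qed

end

section \<open>The Cartan envelope\<close>

lemma cspan_subset: "csubspace M \<Longrightarrow> X \<subseteq> M \<Longrightarrow> cspan X \<subseteq> M"
  by (auto simp: cspan_def intro!: csubspace_sum csubspace_cscale)

lemma csubspace_closed_regular:
  assumes "closure (cspan X) = UNIV" "csubspace M" "closed M" "X \<subseteq> M"
  shows "M = UNIV"
  using assms closure_minimal[OF cspan_subset] by blast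

lemma in_closed_approx:
  fixes x :: "'a::real_normed_vector"
  assumes "closed M" "\<And>e. 0 < e \<Longrightarrow> \<exists>y\<in>M. norm (x - y) < e"
  shows "x \<in> M"
proof -
  have "x \<in> closure M" using assms(2) by (simp add: closure_approachable dist_norm norm_minus_commute)
  then show ?thesis using assms(1) by simp
qed

lemma nonzero_in_ideal: "closed_ideal_in S I \<Longrightarrow> I \<noteq> {0} \<Longrightarrow> \<exists>x\<in>I. x \<noteq> 0"
  by (auto simp: closed_ideal_in_def csubspace_def)

lemma closed_preimage:
  assumes "bounded_linear f" "closed M"
  shows "closed {x. f x \<in> M}"
  using continuous_closed_vimage[OF assms(2), of f] linear_continuous_at[OF assms(1)] by (simp add: vimage_def)

text \<open>For \<open>a \<in> right_unit_set J\<close> the product \<open>a v\<close> is approximated by \<open>a (j v)\<close>, and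
  \<open>w = j v\<close> satisfies \<open>w\<^sup>* w \<in> J\<close>.\<close>

lemma right_unit_set_normalizer:
  assumes J: "abelian_algebra J"
    and v: "\<And>j. j \<in> J \<Longrightarrow> adj v * (adj j * j) * v \<in> J" and a: "a \<in> right_unit_set J"
  shows "a * v \<in> right_unit_set J"
proof (rule in_closed_approx[OF closed_right_unit_set[OF J]])
  fix e :: real assume "0 < e"
  have nv: "0 < norm v + 1" by (rule add_nonneg_pos) simp_all
  obtain j where j: "j \<in> J" "norm (a - a * j) < e / (norm v + 1)"
    using right_unit_setD[OF J a, of "e / (norm v + 1)"] nv \<open>0 < e\<close> by auto
  have "j * v \<in> right_unit_set J"
  proof (rule in_right_unit_set[OF J])
    show "adj (j * v) * (j * v) \<in> J" using v[OF j(1)] by (simp add: adj_mult mult.assoc)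
  qed
  then have "a * (j * v) \<in> right_unit_set J" by (rule right_unit_set_left_mult[OF J])
  moreover have "norm (a * v - a * (j * v)) < e"
  proof -
    have "norm (a * v - a * (j * v)) = norm ((a - a * j) * v)" by (simp add: algebra_simps)
    also have "\<dots> \<le> norm (a - a * j) * (norm v + 1)"
      by (rule order_trans[OF norm_mult_ineq]) (simp add: mult_left_mono)
    also have "\<dots> < e" using j(2) nv by (simp add: field_simps)
    finally show ?thesis .
  qed
  ultimately show "\<exists>y\<in>right_unit_set J. norm (a * v - y) < e" by blast
qed

text \<open>Minimality of \<open>cstar_gen\<close> is available only against subalgebras stable
  under \<open>adj\<close>. This allows closed multiplicative subspaces, such as ideals and
  multiplier algebras, to be compared with it.\<close>

lemma cstar_subalgebra_both_adj:
  assumes "csubspace M" "closed M" and mult: "\<And>x y. x \<in> M \<Longrightarrow> y \<in> M \<Longrightarrow> x * y \<in> M"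
  shows "cstar_subalgebra {x. x \<in> M \<and> adj x \<in> M}"
  unfolding cstar_subalgebra_def csubspace_def
proof (intro conjI ballI allI impI)
  have "closed (M \<inter> {x. adj x \<in> M})"
    by (intro closed_Int assms closed_preimage bounded_linear_adj)
  then show "closed {x. x \<in> M \<and> adj x \<in> M}" by (simp add: Int_def)
qed (use assms(1) in \<open>auto simp: adj_add adj_cscale adj_mult adj_adj csubspace_zero csubspace_add csubspace_cscale mult\<close>)

lemma csubspace_star_hom_image:
  assumes f: "star_hom f" and S: "csubspace S"
  shows "csubspace (f ` S)"
  unfolding csubspace_def
proof (intro conjI ballI allI impI)
  show "0 \<in> f ` S" using csubspace_zero[OF S] star_homD(5)[OF f] by (metis imageI)
next
  fix x y assume "x \<in> f ` S" "y \<in> f ` S"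
  then obtain a b where "x = f a" "y = f b" "a \<in> S" "b \<in> S" by blast
  then show "x + y \<in> f ` S" by (simp add: csubspace_add[OF S] flip: star_homD(1)[OF f])
next
  fix c x assume "x \<in> f ` S"
  then obtain a where "x = f a" "a \<in> S" by blast
  then show "cscale c x \<in> f ` S" by (simp add: csubspace_cscale[OF S] flip: star_homD(2)[OF f])
qed

section \<open>Countable dense subalgebras\<close>

definition gaussian_rational :: "rat \<times> rat \<Rightarrow> complex" where
  "gaussian_rational r = Complex (of_rat (fst r)) (of_rat (snd r))"

lemma gaussian_rational_dense:
  assumes "0 < e"
  shows "\<exists>r. cmod (gaussian_rational r - a) < e"
proof -
  obtain p where p: "Re a < of_rat p" "of_rat p < Re a + e / 2"
    using of_rat_dense[of "Re a" "Re a + e / 2"] assms by auto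
  obtain q where q: "Im a < of_rat q" "of_rat q < Im a + e / 2"
    using of_rat_dense[of "Im a" "Im a + e / 2"] assms by auto
  have "cmod (gaussian_rational (p, q) - a) \<le> \<bar>of_rat p - Re a\<bar> + \<bar>of_rat q - Im a\<bar>"
    using cmod_le[of "gaussian_rational (p, q) - a"] by (simp add: gaussian_rational_def)
  with p q show ?thesis by (intro exI[of _ "(p, q)"]) auto
qed

definition alg_step :: "'a::cstar_algebra set \<Rightarrow> 'a set" where
  "alg_step X = X \<union> (\<lambda>(x, y). x + y) ` (X \<times> X) \<union> (\<lambda>(x, y). x * y) ` (X \<times> X) \<union> adj ` X \<union>
     (\<lambda>(r, x). cscale (gaussian_rational r) x) ` (UNIV \<times> X)"

lemma countable_dense_in_gen:
  fixes X :: "'a::cstar_algebra set"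
  assumes "countable X"
  obtains Q where "countable Q" "X \<subseteq> Q" "cstar_subalgebra (closure Q)"
proof
  \<comment> \<open>Inserting 0 covers the case of empty \<open>X\<close>, where iterating
    \<open>alg_step\<close> would produce nothing.\<close>
  define Qn where "Qn n = (alg_step ^^ n) (insert 0 X)" for n
  define Q where "Q = (\<Union>n. Qn n)"
  have "countable (Qn n)" for n
    by (induction n) (use assms in \<open>auto simp: Qn_def alg_step_def\<close>)
  then show "countable Q" by (simp add: Q_def)
  have Q0: "insert 0 X \<subseteq> Q" unfolding Q_def by (rule subset_trans[OF _ UN_upper[of 0]]) (auto simp: Qn_def)
  then show "X \<subseteq> Q" by blast
  have step: "alg_step (Qn n) = Qn (Suc n)" for n by (simp add: Qn_def)
  have sub: "Qn n \<subseteq> Qn (Suc n)" for n unfolding step[symmetric] by (auto simp: alg_step_def)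
  have mono: "Qn m \<subseteq> Qn n" if "m \<le> n" for m n by (rule lift_Suc_mono_le[of Qn, OF sub that])
  have pair: "\<exists>n. x \<in> Qn n \<and> y \<in> Qn n" if "x \<in> Q" "y \<in> Q" for x y
  proof -
    obtain m n where "x \<in> Qn m" "y \<in> Qn n" using \<open>x \<in> Q\<close> \<open>y \<in> Q\<close> by (auto simp: Q_def)
    then have "x \<in> Qn (max m n)" "y \<in> Qn (max m n)" using mono[of m "max m n"] mono[of n "max m n"] by auto
    then show ?thesis by blast
  qed
  have QI: "x \<in> alg_step (Qn n) \<Longrightarrow> x \<in> Q" for x n unfolding step by (auto simp: Q_def)
  have add: "x + y \<in> Q" and mult: "x * y \<in> Q" if xy: "x \<in> Q" "y \<in> Q" for x y
  proof -
    obtain n where "x \<in> Qn n" "y \<in> Qn n" using pair[OF xy] by blast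
    then have "x + y \<in> alg_step (Qn n)" "x * y \<in> alg_step (Qn n)" by (force simp: alg_step_def)+
    then show "x + y \<in> Q" "x * y \<in> Q" using QI by blast+
  qed
  have adj: "adj x \<in> Q" and scale: "cscale (gaussian_rational r) x \<in> Q" if x: "x \<in> Q" for x r
  proof -
    obtain n where "x \<in> Qn n" using x by (auto simp: Q_def)
    then have "adj x \<in> alg_step (Qn n)" "cscale (gaussian_rational r) x \<in> alg_step (Qn n)"
      by (force simp: alg_step_def)+
    then show "adj x \<in> Q" "cscale (gaussian_rational r) x \<in> Q" using QI by blast+
  qed
  show "cstar_subalgebra (closure Q)"
    unfolding cstar_subalgebra_def csubspace_def
  proof (intro conjI ballI allI impI)
    show "0 \<in> closure Q" using Q0 closure_subset by blast
    show "closed (closure Q)" by simp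
    show "x + y \<in> closure Q" "x * y \<in> closure Q" if "x \<in> closure Q" "y \<in> closure Q" for x y
    proof -
      obtain f g where fg: "\<And>n. f n \<in> Q" "f \<longlonglongrightarrow> x" "\<And>n. g n \<in> Q" "g \<longlonglongrightarrow> y"
        using \<open>x \<in> closure Q\<close> \<open>y \<in> closure Q\<close> unfolding closure_sequential by blast
      have lim: "(\<lambda>n. f n + g n) \<longlonglongrightarrow> x + y" "(\<lambda>n. f n * g n) \<longlonglongrightarrow> x * y"
        using fg by (auto intro: tendsto_add tendsto_mult)
      have cl: "f n + g n \<in> closure Q" "f n * g n \<in> closure Q" for n
        using add[OF fg(1,3)] mult[OF fg(1,3)] closure_subset by blast+
      show "x + y \<in> closure Q" by (rule closed_sequentially[OF closed_closure cl(1) lim(1)])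
      show "x * y \<in> closure Q" by (rule closed_sequentially[OF closed_closure cl(2) lim(2)])
    qed
    show "adj x \<in> closure Q" if "x \<in> closure Q" for x
    proof -
      obtain f where f: "\<And>n. f n \<in> Q" "f \<longlonglongrightarrow> x" using \<open>x \<in> closure Q\<close> unfolding closure_sequential by blast
      have "(\<lambda>n. adj (f n)) \<longlonglongrightarrow> adj x" by (rule bounded_linear.tendsto[OF bounded_linear_adj f(2)])
      moreover have "adj (f n) \<in> closure Q" for n using adj[OF f(1)] closure_subset by blast
      ultimately show ?thesis by (rule closed_sequentially[OF closed_closure, rotated])
    qed
    have rat: "cscale (gaussian_rational r) x \<in> closure Q" if "x \<in> closure Q" for x r
    proof -
      obtain f where f: "\<And>n. f n \<in> Q" "f \<longlonglongrightarrow> x" using \<open>x \<in> closure Q\<close> unfolding closure_sequential by blast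
      have "(\<lambda>n. cscale (gaussian_rational r) (f n)) \<longlonglongrightarrow> cscale (gaussian_rational r) x"
        by (rule bounded_linear.tendsto[OF bounded_linear_cscale f(2)])
      moreover have "cscale (gaussian_rational r) (f n) \<in> closure Q" for n
        using scale[OF f(1)] closure_subset by blast
      ultimately show ?thesis by (rule closed_sequentially[OF closed_closure, rotated])
    qed
    show "cscale a x \<in> closure Q" if x: "x \<in> closure Q" for a x
    proof (rule in_closed_approx)
      fix e :: real assume "0 < e"
      have nx: "0 < norm x + 1" by (rule add_nonneg_pos) simp_all
      obtain r where r: "cmod (gaussian_rational r - a) < e / (norm x + 1)"
        using gaussian_rational_dense[of "e / (norm x + 1)" a] \<open>0 < e\<close> nx by auto
      have "cscale a x - cscale (gaussian_rational r) x = cscale (a - gaussian_rational r) x"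
        using cscale_add_left[of "a - gaussian_rational r" "gaussian_rational r" x] by simp
      then have "norm (cscale a x - cscale (gaussian_rational r) x) = cmod (gaussian_rational r - a) * norm x"
        by (simp add: norm_cscale norm_minus_commute)
      also have "\<dots> \<le> cmod (gaussian_rational r - a) * (norm x + 1)" by (intro mult_left_mono) auto
      also have "\<dots> < e" using r nx by (simp add: field_simps)
      finally show "\<exists>y\<in>closure Q. norm (cscale a x - y) < e" using rat[OF x] by blast
    qed simp
  qed
qed

locale envelope = cartan_inclusion B \<Delta> for B :: "'a::cstar_algebra set" and \<Delta> +
  fixes D :: "'c::cstar_algebra set" and \<alpha> :: "'c \<Rightarrow> 'a"
  assumes pc: "pseudo_cartan D" and hom: "star_hom \<alpha>" and inj: "inj \<alpha>"
    and \<alpha>_normalizers: "\<alpha> ` normalizers D \<subseteq> normalizers B" and \<alpha>_D: "\<alpha> ` D \<subseteq> B"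
    and iip: "ideal_intersection_property B (\<alpha> ` D)"
    and B_gen: "B = cstar_gen (\<Delta> ` range \<alpha>)" and A_gen: "UNIV = cstar_gen (range \<alpha> \<union> B)"
begin

lemmas \<alpha> = star_homD[OF hom]

lemma norm_\<alpha>: "norm (\<alpha> x) = norm x"
  by (rule star_hom_isometry[OF hom inj])

lemma \<alpha>_eq_0: "\<alpha> x = 0 \<longleftrightarrow> x = 0"
  using norm_\<alpha>[of x] by (metis norm_eq_zero)

lemma D_sub: "cstar_subalgebra D" and D_ab: "abelian D"
  and D_regular: "closure (cspan (normalizers D)) = UNIV"
  using pc by (simp_all add: pseudo_cartan_def regular_inclusion_def)

lemmas D = cstar_subalgebraD[OF D_sub]

lemma normalizer_D: "v \<in> normalizers D \<Longrightarrow> d \<in> D \<Longrightarrow> adj v * d * v \<in> D"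
  by (simp add: normalizers_def)

lemma B_subset: "cstar_subalgebra M \<Longrightarrow> (\<And>c. \<Delta> (\<alpha> c) \<in> M) \<Longrightarrow> B \<subseteq> M"
  using cstar_gen_least[of M "\<Delta> ` range \<alpha>"] B_gen by blast

lemma UNIV_subset: "cstar_subalgebra M \<Longrightarrow> (\<And>c. \<alpha> c \<in> M) \<Longrightarrow> B \<subseteq> M \<Longrightarrow> M = UNIV"
  using cstar_gen_least[of M "range \<alpha> \<union> B"] A_gen by blast

text \<open>The two intersection properties of a pseudo-Cartan inclusion are composed: the part of
  \<open>I\<close> in the relative commutant is a nonzero closed ideal there, and hence meets
  \<open>D\<close>.\<close>

lemma ideal_meets_D:
  assumes I: "closed_ideal_in UNIV I" "I \<noteq> {0}"
  obtains d where "d \<in> I" "d \<in> D" "d \<noteq> 0"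
proof -
  let ?E = "relative_commutant D"
  have E: "cstar_subalgebra ?E" using D(4) by (rule cstar_subalgebra_commutant)
  note E' = cstar_subalgebraD[OF E]
  have I': "csubspace I" "closed I" "\<And>s x. x \<in> I \<Longrightarrow> s * x \<in> I \<and> x * s \<in> I"
    using I(1) by (auto simp: closed_ideal_in_def)
  have "csubspace (I \<inter> ?E)" using I'(1) E'(1) by (auto simp: csubspace_def)
  then have "closed_ideal_in ?E (I \<inter> ?E)"
    unfolding closed_ideal_in_def using I'(2,3) E'(2,3) by (auto intro: closed_Int)
  moreover have "I \<inter> ?E \<noteq> {0}" using pc I by (simp add: pseudo_cartan_def ideal_intersection_property_def)
  ultimately have "I \<inter> ?E \<inter> D \<noteq> {0}" using pc by (simp add: pseudo_cartan_def ideal_intersection_property_def)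
  moreover have "0 \<in> I \<inter> ?E \<inter> D" using I'(1) E'(5) D(5) by (simp add: csubspace_zero)
  ultimately show ?thesis using that by blast
qed

section \<open>Simplicity\<close>

lemma simple_of_envelope: assumes A: "cstar_simple TYPE('a)" shows "cstar_simple TYPE('c)"
  unfolding cstar_simple_def
proof (intro conjI allI impI)
  show "(UNIV :: 'c set) \<noteq> {0}"
  proof
    assume C0: "(UNIV :: 'c set) = {0}"
    have z: "cstar_subalgebra {0 :: 'a}" by (simp add: cstar_subalgebra_def csubspace_def)
    have c0: "c = 0" for c :: 'c using C0 by blast
    have \<alpha>0: "\<alpha> c = 0" for c using c0[of c] by (simp add: \<alpha>)
    have "B \<subseteq> {0}" by (rule B_subset[OF z]) (simp add: \<alpha>0 Delta_zero)
    from UNIV_subset[OF z _ this] have "(UNIV :: 'a set) = {0}" by (simp add: \<alpha>0)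
    then show False using A by (simp add: cstar_simple_def)
  qed
  fix I :: "'c set" assume I: "closed_ideal_in UNIV I"
  have I': "csubspace I" "closed I" "\<And>s x. x \<in> I \<Longrightarrow> s * x \<in> I" "\<And>s x. x \<in> I \<Longrightarrow> x * s \<in> I"
    using I by (auto simp: closed_ideal_in_def)
  show "I = {0} \<or> I = UNIV"
  proof (cases "I = {0}")
    case False
    obtain d where d: "d \<in> I" "d \<in> D" "d \<noteq> 0" using ideal_meets_D[OF I False] .
    define J where "J = \<alpha> ` (I \<inter> D)"
    have J: "abelian_algebra J"
  unfolding abelian_algebra_def
    proof (intro conjI ballI)
      have "csubspace (I \<inter> D)" using I'(1) D(1) by (auto simp: csubspace_def)
      then show "csubspace J" unfolding J_def by (rule csubspace_star_hom_image[OF hom])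
      show "x * y \<in> J" if "x \<in> J" "y \<in> J" for x y
        using that I'(3) D(3) by (auto simp: J_def simp flip: \<alpha>(3))
      show "abelian J" using D_ab by (auto simp: J_def abelian_def simp flip: \<alpha>(3))
    qed
    let ?L = "right_unit_set J"
    have L: "csubspace ?L" "closed ?L" "\<And>a x. a \<in> ?L \<Longrightarrow> x * a \<in> ?L"
      using csubspace_right_unit_set[OF J] closed_right_unit_set[OF J] right_unit_set_left_mult[OF J] by auto
    \<comment> \<open>\<open>M\<close> consists of the right multipliers of the left ideal
      \<open>?L\<close>. It is a closed algebra; it contains \<open>B\<close>, which commutes with
      \<open>J\<close>, and the images of normalizers, so it is everything and \<open>?L\<close> is
      two-sided.\<close>
    define M where "M = {x. \<forall>a\<in>?L. a * x \<in> ?L}"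
    have "M = (\<Inter>a\<in>?L. {x. a * x \<in> ?L})" by (auto simp: M_def)
    then have clM: "closed M"
      by (auto intro!: closed_INT closed_preimage bounded_linear_mult_right L)
    have csM: "csubspace M"
      using L(1) by (auto simp: M_def csubspace_def distrib_left cscale_mult_right)
    have mM: "x * y \<in> M" if "x \<in> M" "y \<in> M" for x y
      using that by (auto simp: M_def simp flip: mult.assoc)
    have BM: "B \<subseteq> M"
    proof
      fix b assume b: "b \<in> B"
      have "j * b = b * j" if "j \<in> J" for j
        using that \<alpha>_D b by (intro B_comm) (auto simp: J_def)
      then show "b \<in> M" using right_unit_set_right_mult[OF J] by (simp add: M_def)
    qed
    have "csubspace {x. \<alpha> x \<in> M}" using csM by (auto simp: csubspace_def \<alpha>)
    moreover have "closed {x. \<alpha> x \<in> M}" by (rule closed_preimage[OF bounded_linear_star_hom[OF hom] clM])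
    moreover have "normalizers D \<subseteq> {x. \<alpha> x \<in> M}"
    proof
      fix v assume v: "v \<in> normalizers D"
      have "adj (\<alpha> v) * (adj j * j) * \<alpha> v \<in> J" if "j \<in> J" for j
      proof -
        obtain x where x: "j = \<alpha> x" "x \<in> I" "x \<in> D" using \<open>j \<in> J\<close> by (auto simp: J_def)
        have "adj v * (adj x * x) * v \<in> I \<inter> D" using x I'(3,4) normalizer_D[OF v] D(3,4) by simp
        then show ?thesis unfolding J_def x(1) by (simp flip: \<alpha>(3,4))
      qed
      then show "v \<in> {x. \<alpha> x \<in> M}" using right_unit_set_normalizer[OF J] by (simp add: M_def)
    qed
    ultimately have \<alpha>M: "\<alpha> c \<in> M" for c using csubspace_closed_regular[OF D_regular] by blast
    have "{x. x \<in> M \<and> adj x \<in> M} = UNIV"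
      by (rule UNIV_subset[OF cstar_subalgebra_both_adj[OF csM clM mM]])
        (use \<alpha>M BM B(4) in \<open>auto simp flip: \<alpha>(4)\<close>)
    then have "closed_ideal_in UNIV ?L" using L by (auto simp: closed_ideal_in_def M_def)
    moreover have "\<alpha> d \<in> ?L"
      by (rule in_right_unit_set[OF J]) (use d I'(3) D(3,4) in \<open>auto simp: J_def simp flip: \<alpha>(3,4)\<close>)
    then have "?L \<noteq> {0}" using d(3) \<alpha>_eq_0 by auto
    ultimately have LU: "?L = UNIV" using A unfolding cstar_simple_def by blast
    have "c \<in> I" for c
    proof (rule in_closed_approx[OF I'(2)])
      fix e :: real assume "0 < e"
      have "\<alpha> c \<in> ?L" using LU by simp
      then obtain j where j: "j \<in> J" "norm (\<alpha> c - \<alpha> c * j) < e" using right_unit_setD[OF J _ \<open>0 < e\<close>] by blast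
      then obtain x where x: "j = \<alpha> x" "x \<in> I" by (auto simp: J_def)
      have "norm (c - c * x) < e" using j(2) norm_\<alpha>[of "c - c * x"] by (simp add: x \<alpha>)
      then show "\<exists>y\<in>I. norm (c - y) < e" using I'(3)[OF x(2)] by blast
    qed
    then show ?thesis by blast
  qed simp
qed

lemma envelope_simple: assumes C: "cstar_simple TYPE('c)" shows "cstar_simple TYPE('a)"
  unfolding cstar_simple_def
proof (intro conjI allI impI)
  obtain c :: 'c where "c \<noteq> 0" using C by (auto simp: cstar_simple_def)
  then show "(UNIV :: 'a set) \<noteq> {0}" using \<alpha>_eq_0[of c] by blast
  fix I :: "'a set" assume I: "closed_ideal_in UNIV I"
  have I': "csubspace I" "closed I" "\<And>s x. x \<in> I \<Longrightarrow> s * x \<in> I" "\<And>s x. x \<in> I \<Longrightarrow> x * s \<in> I"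
    using I by (auto simp: closed_ideal_in_def)
  show "I = {0} \<or> I = UNIV"
  proof (cases "I = {0}")
    case False
    obtain a where "a \<in> I" "a \<noteq> 0" using nonzero_in_ideal[OF I False] by blast
    then obtain y where y: "y \<in> I" "y \<in> B" "y \<noteq> 0" by (rule closed_ideal_meets_cartan[OF I])
    have "csubspace (I \<inter> B)" using I'(1) B(1) by (auto simp: csubspace_def)
    then have "closed_ideal_in B (I \<inter> B)"
      unfolding closed_ideal_in_def using I' B(2,3) by (auto intro: closed_Int)
    moreover have "I \<inter> B \<noteq> {0}" using y by blast
    ultimately have "I \<inter> B \<inter> \<alpha> ` D \<noteq> {0}" using iip by (simp add: ideal_intersection_property_def)
    moreover have "0 \<in> I \<inter> B \<inter> \<alpha> ` D"
      using csubspace_zero[OF I'(1)] B(5) D(5) \<alpha>(5) by (metis IntI imageI)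
    ultimately obtain d where d: "d \<in> D" "\<alpha> d \<in> I" "\<alpha> d \<noteq> 0" by blast
    have d0: "d \<noteq> 0" using d(3) \<alpha>(5) by blast
    have "csubspace {x. \<alpha> x \<in> I}" using I'(1) by (auto simp: csubspace_def \<alpha>)
    moreover have "closed {x. \<alpha> x \<in> I}" by (rule closed_preimage[OF bounded_linear_star_hom[OF hom] I'(2)])
    ultimately have "closed_ideal_in UNIV {x. \<alpha> x \<in> I}"
      using I'(3,4) by (simp add: closed_ideal_in_def \<alpha>)
    then have "{x. \<alpha> x \<in> I} = UNIV" using C d d0 unfolding cstar_simple_def by blast
    then have \<alpha>I: "\<alpha> c \<in> I" for c by blast
    \<comment> \<open>Simplicity of the smaller algebra is used a second time: the elements with
      right units in \<open>D\<close> form a nonzero closed ideal. Thus \<open>c\<close> is close to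
      \<open>c * j\<close> with \<open>j \<in> D\<close>, and \<open>\<Delta>\<close> turns this
      into closeness of \<open>\<Delta> (\<alpha> c)\<close> to
      \<open>\<Delta> (\<alpha> c) * \<alpha> j\<close>, an element of \<open>I\<close>.\<close>
    let ?L = "right_unit_set D"
    have DJ: "abelian_algebra D" using D_ab by (simp add: abelian_algebra_def D)
    have L: "csubspace ?L" "closed ?L" "\<And>a x. a \<in> ?L \<Longrightarrow> x * a \<in> ?L"
      using csubspace_right_unit_set[OF DJ] closed_right_unit_set[OF DJ] right_unit_set_left_mult[OF DJ] by auto
    have "{x. \<forall>a\<in>?L. a * x \<in> ?L} = UNIV"
    proof (rule csubspace_closed_regular[OF D_regular])
      show "csubspace {x. \<forall>a\<in>?L. a * x \<in> ?L}"
        using L(1) by (auto simp: csubspace_def distrib_left cscale_mult_right)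
      have "{x. \<forall>a\<in>?L. a * x \<in> ?L} = (\<Inter>a\<in>?L. {x. a * x \<in> ?L})" by auto
      then show "closed {x. \<forall>a\<in>?L. a * x \<in> ?L}"
        by (auto intro!: closed_INT closed_preimage bounded_linear_mult_right L)
      show "normalizers D \<subseteq> {x. \<forall>a\<in>?L. a * x \<in> ?L}"
        using right_unit_set_normalizer[OF DJ] normalizer_D D(3,4) by blast
    qed
    then have "closed_ideal_in UNIV ?L" using L by (auto simp: closed_ideal_in_def)
    moreover have "d \<in> ?L" by (rule in_right_unit_set[OF DJ]) (rule D(3)[OF D(4)[OF d(1)] d(1)])
    ultimately have LU: "?L = UNIV" using C d0 unfolding cstar_simple_def by blast
    have \<Delta>I: "\<Delta> (\<alpha> c) \<in> I" for c
    proof (rule in_closed_approx[OF I'(2)])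
      fix e :: real assume "0 < e"
      then have "0 < e / 2" by simp
      moreover have "c \<in> ?L" using LU by simp
      ultimately obtain j where j: "j \<in> D" "norm (c - c * j) < e / 2" using right_unit_setD[OF DJ] by metis
      have jB: "\<alpha> j \<in> B" using j \<alpha>_D by blast
      have "\<Delta> (\<alpha> c) - \<Delta> (\<alpha> c) * \<alpha> j = \<Delta> (\<alpha> (c - c * j))"
        by (simp add: \<alpha> Delta_diff Delta_mult_right[OF jB])
      then have "norm (\<Delta> (\<alpha> c) - \<Delta> (\<alpha> c) * \<alpha> j) < e"
        using norm_Delta_le[of "\<alpha> (c - c * j)"] j(2) by (simp add: norm_\<alpha>)
      then show "\<exists>y\<in>I. norm (\<Delta> (\<alpha> c) - y) < e" using I'(3)[OF \<alpha>I] by blast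
    qed
    have N: "cstar_subalgebra {x. x \<in> I \<and> adj x \<in> I}"
      by (rule cstar_subalgebra_both_adj[OF I'(1,2)]) (rule I'(3))
    have "B \<subseteq> {x. x \<in> I \<and> adj x \<in> I}"
      by (rule B_subset[OF N]) (use \<Delta>I in \<open>auto simp flip: Delta_adj \<alpha>(4)\<close>)
    then have "{x. x \<in> I \<and> adj x \<in> I} = UNIV"
      by (intro UNIV_subset[OF N]) (use \<alpha>I in \<open>auto simp flip: \<alpha>(4)\<close>)
    then show ?thesis by blast
  qed simp
qed

section \<open>Units\<close>

lemma envelope_unital: assumes C: "cstar_unital TYPE('c)" shows "cstar_unital TYPE('a)"
proof -
  obtain e :: 'c where e: "\<And>x. e * x = x" "\<And>x. x * e = x" using C by (auto simp: cstar_unital_def)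
  define f where "f = \<Delta> (\<alpha> e)"
  have fB: "f \<in> B" by (simp add: f_def Delta_in)
  have DB: "\<alpha> d \<in> B" if "d \<in> D" for d using that \<alpha>_D by blast
  have f\<alpha>: "f * \<alpha> d = \<alpha> d" if d: "d \<in> D" for d
  proof -
    have "f * \<alpha> d = \<Delta> (\<alpha> (e * d))" by (simp add: f_def \<alpha>(3) Delta_mult_right DB d)
    then show ?thesis by (simp add: e Delta_id DB d)
  qed
  \<comment> \<open>The annihilator of the image of \<open>D\<close> meets that image only in 0,
    because such an element satisfies \<open>b * adj b = 0\<close>. Hence it is zero, which will
    apply to \<open>f * b - b\<close>.\<close>
  define I where "I = {b \<in> B. \<forall>d\<in>D. b * \<alpha> d = 0}"
  have "closed_ideal_in B I"
    unfolding closed_ideal_in_def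
  proof (intro conjI ballI)
    have "closed {b. b * \<alpha> d = 0}" for d
      using closed_preimage[OF bounded_linear_mult_left, of "{0}" "\<alpha> d"] by simp
    moreover have "I = B \<inter> (\<Inter>d\<in>D. {b. b * \<alpha> d = 0})" by (auto simp: I_def)
    ultimately show "closed I" by (simp add: B closed_Int closed_INT)
    show "csubspace I" using B by (auto simp: csubspace_def I_def distrib_right cscale_mult_left)
    fix s x assume s: "s \<in> B" and x: "x \<in> I"
    then show "s * x \<in> I" by (auto simp: I_def B mult.assoc)
    then show "x * s \<in> I" using B_comm[OF s, of x] x by (simp add: I_def)
  qed (auto simp: I_def)
  moreover have "I \<inter> \<alpha> ` D = {0}"
  proof -
    have "b = 0" if b: "b \<in> I" "b \<in> \<alpha> ` D" for b
    proof -
      obtain d where d: "d \<in> D" "b = \<alpha> d" using b by blast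
      have "b * \<alpha> (adj d) = 0" using b(1) D(4)[OF d(1)] by (simp add: I_def)
      then show ?thesis using mult_adj_self_eq_0[of b] by (simp add: d(2) \<alpha>)
    qed
    moreover have "0 \<in> I" "0 \<in> \<alpha> ` D" using B(5) D(5) \<alpha>(5) by (auto simp: I_def image_iff)
    ultimately show ?thesis by blast
  qed
  ultimately have I0: "I = {0}" using iip unfolding ideal_intersection_property_def by blast
  have fb: "f * b = b" "b * f = b" if b: "b \<in> B" for b
  proof -
    have "(f * b - b) * \<alpha> d = 0" if d: "d \<in> D" for d
    proof -
      have "f * b * \<alpha> d = b * (f * \<alpha> d)" using B_comm[OF fB b] by (simp add: mult.assoc)
      then show ?thesis using f\<alpha>[OF d] by (simp add: left_diff_distrib)
    qed
    then have "f * b - b \<in> I" using b fB by (simp add: I_def B)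
    then show "f * b = b" using I0 by simp
    then show "b * f = b" using B_comm[OF fB b] by simp
  qed
  have corner: "x = f * x + x * f - f * x * f" for x
  proof -
    \<comment> \<open>This is \<open>(1 - f) x (1 - f)\<close> without a unit. It annihilates
      \<open>B\<close> on both sides and so lies in \<open>B\<close> by maximality; there
      \<open>f * z\<close> is both \<open>z\<close> and 0.\<close>
    define z where "z = x - f * x - x * f + f * x * f"
    have bz: "b * z = 0" "z * b = 0" if b: "b \<in> B" for b
    proof -
      have l: "b * (f * X) = b * X" for X using fb(2)[OF b] by (simp flip: mult.assoc)
      have r: "X * f * b = X * b" for X using fb(1)[OF b] by (simp add: mult.assoc)
      show "b * z = 0" by (simp add: z_def algebra_simps l)
      show "z * b = 0" unfolding z_def by (simp only: distrib_right left_diff_distrib r) simp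
    qed
    have "z \<in> B" by (rule maximal_abelian_commutant[OF masa]) (simp add: bz)
    then have "z = 0" using fb(1)[of z] bz(1)[OF fB] by simp
    then show ?thesis by (simp add: z_def algebra_simps eq_neg_iff_add_eq_0)
  qed
  have fa: "adj f = f"
  proof -
    have 1: "f * adj f = adj f" by (rule fb(1)[OF B(4)[OF fB]])
    then have "adj (f * adj f) = adj (adj f)" by simp
    then have "f * adj f = f" by (simp only: adj_mult adj_adj)
    with 1 show ?thesis by metis
  qed
  have right: "x * f = x" for x
  proof -
    \<comment> \<open>From \<open>y * f = 0\<close> it follows that \<open>adj y * y\<close> equals
      its own corner, which vanishes.\<close>
    define y where "y = x - x * f"
    have yf: "y * f = 0" using fb(1)[OF fB] by (simp add: y_def algebra_simps)
    then have "adj (y * f) = 0" by simp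
    then have fy: "f * adj y = 0" by (simp add: adj_mult fa)
    have "adj y * y = 0"
      using corner[of "adj y * y"] yf fy by (simp add: mult.assoc) (simp add: fy flip: mult.assoc)
    then show ?thesis by (simp add: adj_mult_self_eq_0 y_def)
  qed
  have "f * x = x" for x
  proof -
    have "adj (adj x * f) = adj (adj x)" using right[of "adj x"] by simp
    then show ?thesis by (simp add: adj_mult adj_adj fa)
  qed
  with right show ?thesis by (auto simp: cstar_unital_def)
qed

lemma unital_of_envelope: assumes A: "cstar_unital TYPE('a)" shows "cstar_unital TYPE('c)"
proof -
  obtain u :: 'a where u: "\<And>x. u * x = x" "\<And>x. x * u = x" using A by (auto simp: cstar_unital_def)
  have uB: "u \<in> B" by (rule maximal_abelian_commutant[OF masa]) (simp add: u)
  define J where "J = range \<alpha> \<inter> B"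
  have J: "abelian_algebra J"
  unfolding abelian_algebra_def
  proof (intro conjI ballI)
    have "csubspace (range \<alpha>)"
      by (rule csubspace_star_hom_image[OF hom cstar_subalgebraD(1)[OF cstar_subalgebra_UNIV]])
    then show "csubspace J" using B(1) by (auto simp: csubspace_def J_def)
    show "x * y \<in> J" if "x \<in> J" "y \<in> J" for x y using that B by (auto simp: J_def simp flip: \<alpha>(3))
    show "abelian J" using B_ab by (auto simp: J_def abelian_def)
  qed
  let ?L = "right_unit_set J"
  have L: "csubspace ?L" "closed ?L" "\<And>a x. a \<in> ?L \<Longrightarrow> x * a \<in> ?L"
    using csubspace_right_unit_set[OF J] closed_right_unit_set[OF J] right_unit_set_left_mult[OF J] by auto
  have "{x. \<alpha> x \<in> ?L} = UNIV"
  proof (rule csubspace_closed_regular[OF D_regular])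
    show "csubspace {x. \<alpha> x \<in> ?L}" using L(1) by (auto simp: csubspace_def \<alpha>)
    show "closed {x. \<alpha> x \<in> ?L}" by (rule closed_preimage[OF bounded_linear_star_hom[OF hom] L(2)])
    show "normalizers D \<subseteq> {x. \<alpha> x \<in> ?L}"
    proof
      fix v assume "v \<in> normalizers D"
      then have "\<alpha> v \<in> normalizers B" using \<alpha>_normalizers by blast
      then have "adj (\<alpha> v) * u * \<alpha> v \<in> B" using uB by (simp add: normalizers_def)
      then have "adj (\<alpha> v) * \<alpha> v \<in> J" by (simp add: J_def u flip: \<alpha>(3,4))
      then show "v \<in> {x. \<alpha> x \<in> ?L}" using in_right_unit_set[OF J] by blast
    qed
  qed
  then have \<alpha>L: "\<alpha> c \<in> ?L" for c by blast
  have \<Delta>L: "\<Delta> (\<alpha> c) \<in> ?L" for c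
    unfolding right_unit_set_def
  proof (intro CollectI allI impI)
    fix e :: real assume "0 < e"
    then have "0 < e / 2" by simp
    then obtain j where j: "j \<in> J" "\<And>x. norm (x - x * j) \<le> norm x" "norm (\<alpha> c - \<alpha> c * j) < e / 2"
      using right_unit_setD[OF J \<alpha>L[of c]] by metis
    have "\<Delta> (\<alpha> c) - \<Delta> (\<alpha> c) * j = \<Delta> (\<alpha> c - \<alpha> c * j)"
      using j(1) by (simp add: J_def Delta_diff Delta_mult_right)
    then have "norm (\<Delta> (\<alpha> c) - \<Delta> (\<alpha> c) * j) < e"
      using norm_Delta_le[of "\<alpha> c - \<alpha> c * j"] j(3) by simp
    with j show "\<exists>j\<in>J. (\<forall>x. norm (x - x * j) \<le> norm x) \<and> norm (\<Delta> (\<alpha> c) - \<Delta> (\<alpha> c) * j) < e" by blast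
  qed
  have "B \<subseteq> {x. x \<in> ?L \<and> adj x \<in> ?L}"
    by (rule B_subset[OF cstar_subalgebra_both_adj[OF L(1,2) L(3)]])
      (use \<Delta>L in \<open>auto simp flip: Delta_adj \<alpha>(4)\<close>)
  then have "u \<in> ?L" using uB by blast
  then obtain j where j: "j \<in> J" "norm (u - u * j) < 1 / 2" using right_unit_setD[OF J, of u "1 / 2"] by auto
  then obtain k where k: "j = \<alpha> k" by (auto simp: J_def)
  \<comment> \<open>Because \<open>r < 1\<close>, the powers \<open>(u - \<alpha> k)^n\<close> tend
    to 0, so the images of \<open>gapp k n\<close> converge to \<open>u\<close>. As
    \<open>\<alpha>\<close> is isometric, \<open>gapp k n\<close> itself converges, and its limit is
    the unit sought.\<close>
  define r where "r = norm (u - \<alpha> k)"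
  have r: "0 \<le> r" "r < 1" using j(2) by (simp_all add: r_def k u)
  have g: "norm (u - \<alpha> (gapp k n)) \<le> r ^ n * norm u" for n
  proof (induction n)
    case (Suc n)
    have "u - \<alpha> (gapp k (Suc n)) = (u - \<alpha> k) * (u - \<alpha> (gapp k n)) \<or>
      u - \<alpha> (gapp k (Suc n)) = (u - \<alpha> (gapp k n)) * (u - \<alpha> k)"
      by (simp add: \<alpha> algebra_simps u)
    then have "norm (u - \<alpha> (gapp k (Suc n))) \<le> r * norm (u - \<alpha> (gapp k n))"
      using norm_mult_ineq[of "u - \<alpha> k" "u - \<alpha> (gapp k n)"] norm_mult_ineq[of "u - \<alpha> (gapp k n)" "u - \<alpha> k"]
      by (auto simp: r_def mult.commute)
    also have "\<dots> \<le> r * (r ^ n * norm u)" by (intro mult_left_mono Suc r)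
    finally show ?case by (simp add: mult.assoc)
  qed (simp add: \<alpha>)
  have "(\<lambda>n. r ^ n * norm u) \<longlonglongrightarrow> 0"
    using r by (intro tendsto_mult_left_zero LIMSEQ_realpow_zero) auto
  then have "(\<lambda>n. u - \<alpha> (gapp k n)) \<longlonglongrightarrow> 0" by (rule Lim_null_comparison[rotated]) (simp add: g)
  then have lim: "(\<lambda>n. \<alpha> (gapp k n)) \<longlonglongrightarrow> u"
    using tendsto_diff[OF tendsto_const, of "\<lambda>n. u - \<alpha> (gapp k n)" 0 sequentially u] by simp
  have "Cauchy (\<lambda>n. gapp k n)"
    using LIMSEQ_imp_Cauchy[OF lim] unfolding Cauchy_def dist_norm
    by (simp only: \<alpha>(8)[symmetric] norm_\<alpha>)
  then obtain e where e: "(\<lambda>n. gapp k n) \<longlonglongrightarrow> e" using Cauchy_convergent convergent_def by blast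
  have "\<alpha> e = u"
    using LIMSEQ_unique[OF bounded_linear.tendsto[OF bounded_linear_star_hom[OF hom] e] lim] .
  then have "\<alpha> (e * x) = \<alpha> x \<and> \<alpha> (x * e) = \<alpha> x" for x by (simp add: \<alpha> u)
  then have "\<forall>x. e * x = x \<and> x * e = x" using inj by (simp add: inj_eq)
  then show ?thesis by (auto simp: cstar_unital_def)
qed

section \<open>Separability\<close>

lemma envelope_separable: assumes C: "cstar_separable TYPE('c)" shows "cstar_separable TYPE('a)"
proof -
  obtain S :: "'c set" where S: "countable S" "closure S = UNIV" using C by (auto simp: cstar_separable_def)
  have "countable (\<alpha> ` S \<union> (\<lambda>c. \<Delta> (\<alpha> c)) ` S)" using S by simp
  then obtain Q where Q: "countable Q" "\<alpha> ` S \<union> (\<lambda>c. \<Delta> (\<alpha> c)) ` S \<subseteq> Q" "cstar_subalgebra (closure Q)"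
    by (rule countable_dense_in_gen)
  have in_Q: "f c \<in> closure Q" if f: "bounded_linear f" "f ` S \<subseteq> Q" for f :: "'c \<Rightarrow> 'a" and c
  proof -
    have "closed {x. f x \<in> closure Q}" by (rule closed_preimage[OF f(1)]) simp
    moreover have "S \<subseteq> {x. f x \<in> closure Q}" using f(2) closure_subset by blast
    ultimately have "closure S \<subseteq> {x. f x \<in> closure Q}" by (rule closure_minimal[rotated])
    then show ?thesis using S(2) by blast
  qed
  have \<alpha>Q: "\<alpha> c \<in> closure Q" for c by (rule in_Q[OF bounded_linear_star_hom[OF hom]]) (use Q in blast)
  have "\<Delta> (\<alpha> c) \<in> closure Q" for c
    by (rule in_Q[OF bounded_linear_compose[OF bounded_linear_Delta bounded_linear_star_hom[OF hom]]]) (use Q in blast)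
  then have "closure Q = UNIV" using UNIV_subset[OF Q(3) \<alpha>Q] B_subset[OF Q(3)] by blast
  then show ?thesis using Q(1) by (auto simp: cstar_separable_def)
qed

lemma separable_of_envelope: assumes A: "cstar_separable TYPE('a)" shows "cstar_separable TYPE('c)"
proof -
  obtain S :: "'a set" where S: "countable S" "closure S = UNIV" using A by (auto simp: cstar_separable_def)
  \<comment> \<open>The dense set of the larger algebra need not meet the range of
    \<open>\<alpha>\<close>, so nearby points of the range are chosen. Where none is near enough,
    \<open>SOME\<close> gives an arbitrary element, which leaves \<open>T\<close> countable and is
    harmless for density.\<close>
  define pick where "pick = (\<lambda>(s, n). SOME c. norm (\<alpha> c - s) < 1 / real (Suc n))"
  define T where "T = pick ` (S \<times> UNIV)"
  have "countable T" unfolding T_def using S(1) by auto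
  moreover have "x \<in> closure T" for x
    unfolding closure_approachable dist_norm
  proof (intro allI impI)
    fix e :: real assume "0 < e"
    then have "0 < e / 2" by simp
    then obtain n :: nat where n: "1 / real (Suc n) < e / 2" by (rule nat_approx_posE)
    have "\<alpha> x \<in> closure S" using S by simp
    then obtain s where s: "s \<in> S" "norm (s - \<alpha> x) < 1 / real (Suc n)"
      unfolding closure_approachable dist_norm by (meson of_nat_0_less_iff zero_less_Suc zero_less_divide_1_iff)
    then have "norm (\<alpha> x - s) < 1 / real (Suc n)" by (simp add: norm_minus_commute)
    then have p: "norm (\<alpha> (pick (s, n)) - s) < 1 / real (Suc n)"
      unfolding pick_def by (simp only: prod.case) (rule someI)
    have "pick (s, n) \<in> T" using s by (simp add: T_def)
    moreover have "norm (pick (s, n) - x) < e"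
    proof -
      have "norm (pick (s, n) - x) = norm (\<alpha> (pick (s, n)) - \<alpha> x)" by (simp add: norm_\<alpha> flip: \<alpha>(8))
      also have "\<dots> \<le> norm (\<alpha> (pick (s, n)) - s) + norm (s - \<alpha> x)"
        using norm_triangle_ineq[of "\<alpha> (pick (s, n)) - s" "s - \<alpha> x"] by simp
      also have "\<dots> < e" using p s(2) n by linarith
      finally show ?thesis .
    qed
    ultimately show "\<exists>y\<in>T. norm (y - x) < e" by blast
  qed
  ultimately show ?thesis by (auto simp: cstar_separable_def)
qed

end

theorem theorem4p3p6:
  fixes D :: "'c::cstar_algebra set" and B :: "'a::cstar_algebra set"
    and \<alpha> :: "'c \<Rightarrow> 'a"
  assumes "pseudo_cartan D"
    and "cartan_envelope D B \<alpha>"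
  shows "(cstar_simple TYPE('c) \<longleftrightarrow> cstar_simple TYPE('a))
       \<and> (cstar_unital TYPE('c) \<longleftrightarrow> cstar_unital TYPE('a))
       \<and> (cstar_separable TYPE('c) \<longleftrightarrow> cstar_separable TYPE('a))"
proof -
  obtain \<Delta> where e: "regular_inclusion B" "maximal_abelian B" "faithful_cond_exp B \<Delta>"
    "star_hom \<alpha>" "inj \<alpha>" "\<alpha> ` normalizers D \<subseteq> normalizers B"
    "\<alpha> ` D \<subseteq> B" "ideal_intersection_property B (\<alpha> ` D)"
    "B = cstar_gen (\<Delta> ` range \<alpha>)" "UNIV = cstar_gen (range \<alpha> \<union> B)"
    using assms(2) unfolding cartan_envelope_def by (elim exE conjE)
  have "cstar_subalgebra B" "abelian B" "closure (cspan (normalizers B)) = UNIV"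
    using e(1,2) unfolding maximal_abelian_def regular_inclusion_def by blast+
  note B = this
  interpret envelope B \<Delta> D \<alpha>
    by unfold_locales (fact assms(1) e B)+
  show ?thesis
    using simple_of_envelope envelope_simple envelope_unital unital_of_envelope envelope_separable separable_of_envelope by blast
qed

end
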